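(* Let $A$ be a homologically unambiguous monomial algebra having finite global dimension. Then the Hilbert series $\mathrm{HS}(A)$ is an algebraic function.
   Context: $\mathbb{K}$ is any field, $X=\{x_1,\ldots,x_n\}$ is a finite set, $X^*$ is the free monoid of words on $X$, $|w|$ is the length of a word $w$, and $X^+=\{w\in X^*\mid |w|\ge 1\}$. $F=\mathbb{K}\langle X\rangle$ is the free associative algebra with the standard grading by length. A monomial ideal is a two-sided ideal $I$ of $F$ generated by words; it has a unique minimal monomial basis $L_1$, i.e. a generating set of words which is an antichain (no word of it is a subword of a different word of it). A monomial algebra is $A=F/I$ with $I$ a monomial ideal; $N(I)=X^*\setminus I$ is its set of normal words. Its Hilbert series is $\mathrm{HS}(A)=\sum_{d\ge 0}(\dim A_d)t^d$. A power series $f(t)$ is an algebraic function if it is an algebraic element over the rational function field $\mathbb{K}(t)$, i.e. a root of a nonzero univariate polynomial with coefficients in $\mathbb{K}(t)$. Chain languages $L_i=L_i(A)$ (for $L_1\subset (X^+)^2$, i.e. all words of $L_1$ of length at least $2$): $L_0=X$, and $L_1$ is the minimal monomial basis of $I$. Each $w\in L_1$ is written $w=st$ with $s\in L_0$ its first letter (its prefix $0$-chain) and $t\in N(I)$ (its tail). Inductively, for $i\ge 1$, suppose each $w\in L_i$ is written $w=st$ with prefix $(i-1)$-chain $s\in L_{i-1}$ and tail $t\in N(I)$. Let $\bar L'_{i+1}$ be the set of pairs $(w,u)$ with $w=st\in L_i$, $u\in X^*$, such that there exist $w'\in L_1$ and $v\in X^*$ with $wu=vw'$, $|u|<|w'|$,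 $|v|\ge |s|$. Let $\bar L_{i+1}$ be the set of those $(w,u)\in\bar L'_{i+1}$ for which there is no $(w,u_1)\in\bar L'_{i+1}$ with $u_1$ a proper prefix of $u$. Then $L_{i+1}=\{wu\mid (w,u)\in\bar L_{i+1}\}$, where $wu$ has prefix $i$-chain $w$ and tail $u$. These languages give the minimal graded free right $A$-module resolution $\cdots\to\mathbb{K}L_1\otimes A\to\mathbb{K}L_0\otimes A\to A\to\mathbb{K}\to 0$. If this resolution is finite, $0\to\mathbb{K}L_k\otimes A\to\cdots\to\mathbb{K}L_0\otimes A\to A\to\mathbb{K}\to 0$, the global (homological) dimension of $A$ is $k+1$; otherwise it is infinite. A context-free grammar $G$ is unambiguous if every word of the language it generates has a unique leftmost derivation from the start variable; a language is an unambiguous context-free language if it is generated by some unambiguous context-free grammar. A monomial algebra $A$ with $L_1(A)\subset (X^+)^2$ is called homologically unambiguous if all chain languages $L_i(A)$ $(i\ge 1)$ are unambiguous context-free languages. *)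

theory Defs
  imports
    "HOL-Algebra.Algebra"
    "HOL-Algebra.Algebraic_Closure_Type"
    "HOL-Library.Poly_Mapping"
    "HOL-Library.Sublist"
    "HOL-Library.Extended_Nat"
    "HOL-Computational_Algebra.Computational_Algebra"
begin

section \<open>The free associative algebra and monomial ideals\<close>

text \<open>
  Words on an alphabet \<open>X\<close> are lists over a finite type \<open>'x\<close>. They form a monoid under
  concatenation, written additively because \<open>HOL-Library.Poly_Mapping\<close> equips finitely supported
  functions on an additive monoid with the convolution product. Hence \<open>'x list \<Rightarrow>\<^sub>0 'k\<close> is the
  monoid algebra of the free monoid, i.e. the free associative algebra.
\<close>

instantiation list :: (type) monoid_add
begin

definition zero_list :: "'a list" where "zero_list = []"

definition plus_list :: "'a list \<Rightarrow> 'a list \<Rightarrow> 'a list" where "plus_list = (@)"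

instance
  by standard (simp_all add: zero_list_def plus_list_def)

end

abbreviation free_algebra :: "('x list \<Rightarrow>\<^sub>0 'k::field) ring"
  where "free_algebra \<equiv> ring_of_type_algebra"

definition monomial :: "'x list \<Rightarrow> ('x list \<Rightarrow>\<^sub>0 'k::field)"
  where "monomial w = Poly_Mapping.single w 1"

definition homogeneous :: "nat \<Rightarrow> ('x list \<Rightarrow>\<^sub>0 'k::field) set"
  where "homogeneous d = {f. \<forall>w \<in> Poly_Mapping.keys f. length w = d}"

definition monomial_ideal :: "('x list \<Rightarrow>\<^sub>0 'k::field) set \<Rightarrow> bool"
  where "monomial_ideal I \<longleftrightarrow> (\<exists>W. I = genideal free_algebra (monomial ` W))"

definition word_antichain :: "'x list set \<Rightarrow> bool"
  where "word_antichain L \<longleftrightarrow> (\<forall>u\<in>L. \<forall>v\<in>L. sublist u v \<longrightarrow> u = v)"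

definition monomial_basis :: "('x list \<Rightarrow>\<^sub>0 'k::field) set \<Rightarrow> 'x list set"
  where "monomial_basis I =
    (THE L. word_antichain L \<and> I = genideal free_algebra (monomial ` L))"

definition monomial_algebra :: "('x list \<Rightarrow>\<^sub>0 'k::field) set \<Rightarrow> ('x list \<Rightarrow>\<^sub>0 'k) set ring"
  where "monomial_algebra I = free_algebra Quot I"


section \<open>Hilbert series and algebraic functions\<close>

definition proj_class :: "('x list \<Rightarrow>\<^sub>0 'k::field) set \<Rightarrow> ('x list \<Rightarrow>\<^sub>0 'k) \<Rightarrow> ('x list \<Rightarrow>\<^sub>0 'k) set"
  where "proj_class I f = I +>\<^bsub>free_algebra\<^esub> f"

definition scalars :: "('x list \<Rightarrow>\<^sub>0 'k::field) set \<Rightarrow> ('x list \<Rightarrow>\<^sub>0 'k) set set"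
  where "scalars I = proj_class I ` range (Poly_Mapping.single [])"

text \<open>
  For a proper ideal \<open>I\<close>, \<^term>\<open>scalars I\<close> is the copy of the ground field in the quotient, and
  the dimension is that of a subspace over this subfield.
\<close>

definition graded_dim :: "('x list \<Rightarrow>\<^sub>0 'k::field) set \<Rightarrow> nat \<Rightarrow> nat"
  where "graded_dim I d =
    ring.dim (monomial_algebra I) (scalars I) (proj_class I ` homogeneous d)"

text \<open>
  The coefficients are natural numbers; the result type selects the coefficient ring in which they
  are read.
\<close>

definition hilbert_series :: "('x list \<Rightarrow>\<^sub>0 'k::field) set \<Rightarrow> 'f::semiring_1 fps"
  where "hilbert_series I = Abs_fps (\<lambda>d. of_nat (graded_dim I d))"

text \<open>The field of rational functions, inside the field of formal Laurent series.\<close>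

definition rational_functions :: "'f::field fls set"
  where "rational_functions =
    {fps_to_fls (fps_of_poly p) / fps_to_fls (fps_of_poly q) | p q. q \<noteq> 0}"

definition algebraic_function :: "'f::field fps \<Rightarrow> bool"
  where "algebraic_function f \<longleftrightarrow>
    (\<exists>P :: 'f fls poly. P \<noteq> 0 \<and> (\<forall>i. coeff P i \<in> rational_functions) \<and>
       poly P (fps_to_fls f) = 0)"


section \<open>Chain languages\<close>

text \<open>
  \<open>chain_ext L s t\<close> consists of the words \<open>u\<close> such that \<open>(st, u)\<close> is a candidate for an extension
  of the chain \<open>st\<close> with prefix chain \<open>s\<close> and tail \<open>t\<close>.
\<close>

definition chain_ext :: "'x list set \<Rightarrow> 'x list \<Rightarrow> 'x list \<Rightarrow> 'x list set"
  where "chain_ext L s t =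
    {u. \<exists>w'\<in>L. \<exists>v. s @ t @ u = v @ w' \<and> length u < length w' \<and> length s \<le> length v}"

text \<open>
  \<open>chain_splits L i\<close> is the set of the \<open>(i+1)\<close>-chains, each given as the pair of its prefix
  \<open>i\<close>-chain and its tail.
\<close>

primrec chain_splits :: "'x list set \<Rightarrow> nat \<Rightarrow> ('x list \<times> 'x list) set" where
  "chain_splits L 0 = {([x], t) | x t. x # t \<in> L}"
| "chain_splits L (Suc i) =
    {(s @ t, u) | s t u. (s, t) \<in> chain_splits L i \<and> u \<in> chain_ext L s t \<and>
       \<not> (\<exists>u1 \<in> chain_ext L s t. strict_prefix u1 u)}"

fun chain_language :: "'x list set \<Rightarrow> nat \<Rightarrow> 'x list set" where
  "chain_language L 0 = {[x] | x. True}"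
| "chain_language L (Suc i) = {s @ t | s t. (s, t) \<in> chain_splits L i}"


section \<open>Unambiguous context-free languages\<close>

datatype ('n, 't) csym = NT 'n | Tm 't

record ('n, 't) cfg =
  start :: 'n
  prods :: "('n \<times> ('n, 't) csym list) set"

definition derive_step ::
    "('n, 't) cfg \<Rightarrow> ('n, 't) csym list \<Rightarrow> ('n, 't) csym list \<Rightarrow> bool"
  where "derive_step G \<alpha> \<beta> \<longleftrightarrow>
    (\<exists>\<mu> A \<nu> \<gamma>. (A, \<gamma>) \<in> prods G \<and> \<alpha> = \<mu> @ NT A # \<nu> \<and> \<beta> = \<mu> @ \<gamma> @ \<nu>)"

definition leftmost_step ::
    "('n, 't) cfg \<Rightarrow> ('n, 't) csym list \<Rightarrow> ('n, 't) csym list \<Rightarrow> bool"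
  where "leftmost_step G \<alpha> \<beta> \<longleftrightarrow>
    (\<exists>u A \<nu> \<gamma>. (A, \<gamma>) \<in> prods G \<and> \<alpha> = map Tm u @ NT A # \<nu> \<and> \<beta> = map Tm u @ \<gamma> @ \<nu>)"

definition cfg_language :: "('n, 't) cfg \<Rightarrow> 't list set"
  where "cfg_language G = {w. (derive_step G)\<^sup>*\<^sup>* [NT (start G)] (map Tm w)}"

text \<open>
  A leftmost derivation is recorded as its sequence of sentential forms; these determine the
  productions applied, since the position of the rewritten variable is forced.
\<close>

definition leftmost_derivation ::
    "('n, 't) cfg \<Rightarrow> ('n, 't) csym list list \<Rightarrow> 't list \<Rightarrow> bool"
  where "leftmost_derivation G ds w \<longleftrightarrow>
    ds \<noteq> [] \<and> hd ds = [NT (start G)] \<and> last ds = map Tm w \<and> successively (leftmost_step G) ds"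

definition unambiguous_cfg :: "('n, 't) cfg \<Rightarrow> bool"
  where "unambiguous_cfg G \<longleftrightarrow> (\<forall>w \<in> cfg_language G. \<exists>!ds. leftmost_derivation G ds w)"

text \<open>
  Only the finitely many variables occurring in productions matter, so they may be taken to be
  natural numbers.
\<close>

definition unambiguous_cfl :: "'t list set \<Rightarrow> bool"
  where "unambiguous_cfl L \<longleftrightarrow>
    (\<exists>G :: (nat, 't) cfg. finite (prods G) \<and> unambiguous_cfg G \<and> cfg_language G = L)"

definition homologically_unambiguous :: "('x list \<Rightarrow>\<^sub>0 'k::field) set \<Rightarrow> bool"
  where "homologically_unambiguous I \<longleftrightarrow>
    (\<forall>w \<in> monomial_basis I. 2 \<le> length w) \<and>
    (\<forall>i\<ge>1. unambiguous_cfl (chain_language (monomial_basis I) i))"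


section \<open>Global dimension\<close>

text \<open>
  Right modules over a (noncommutative) ring. We reuse the record type of \<open>HOL-Algebra\<close> modules;
  its components \<open>mult\<close> and \<open>one\<close> are irrelevant, and \<open>a \<odot> m\<close> stands for the right
  action \<open>m \<cdot> a\<close>.
\<close>

locale right_module = A?: ring A + M?: abelian_group M
  for A :: "('a, 'r) ring_scheme" and M :: "('a, 'm) module" (structure) +
  assumes smult_closed: "\<lbrakk>a \<in> carrier A; m \<in> carrier M\<rbrakk> \<Longrightarrow> a \<odot>\<^bsub>M\<^esub> m \<in> carrier M"
    and smult_add_ring: "\<lbrakk>a \<in> carrier A; b \<in> carrier A; m \<in> carrier M\<rbrakk> \<Longrightarrow>
      (a \<oplus>\<^bsub>A\<^esub> b) \<odot>\<^bsub>M\<^esub> m = a \<odot>\<^bsub>M\<^esub> m \<oplus>\<^bsub>M\<^esub> b \<odot>\<^bsub>M\<^esub> m"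
    and smult_add_module: "\<lbrakk>a \<in> carrier A; m \<in> carrier M; m' \<in> carrier M\<rbrakk> \<Longrightarrow>
      a \<odot>\<^bsub>M\<^esub> (m \<oplus>\<^bsub>M\<^esub> m') = a \<odot>\<^bsub>M\<^esub> m \<oplus>\<^bsub>M\<^esub> a \<odot>\<^bsub>M\<^esub> m'"
    and smult_assoc_right: "\<lbrakk>a \<in> carrier A; b \<in> carrier A; m \<in> carrier M\<rbrakk> \<Longrightarrow>
      (a \<otimes>\<^bsub>A\<^esub> b) \<odot>\<^bsub>M\<^esub> m = b \<odot>\<^bsub>M\<^esub> (a \<odot>\<^bsub>M\<^esub> m)"
    and smult_one: "m \<in> carrier M \<Longrightarrow> \<one>\<^bsub>A\<^esub> \<odot>\<^bsub>M\<^esub> m = m"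

definition module_hom ::
    "('a, 'r) ring_scheme \<Rightarrow> ('a, 'm) module \<Rightarrow> ('a, 'n) module \<Rightarrow> ('m \<Rightarrow> 'n) set"
  where "module_hom A M N = {h. h \<in> carrier M \<rightarrow> carrier N \<and>
    (\<forall>x\<in>carrier M. \<forall>y\<in>carrier M. h (x \<oplus>\<^bsub>M\<^esub> y) = h x \<oplus>\<^bsub>N\<^esub> h y) \<and>
    (\<forall>a\<in>carrier A. \<forall>x\<in>carrier M. h (a \<odot>\<^bsub>M\<^esub> x) = a \<odot>\<^bsub>N\<^esub> h x)}"

text \<open>
  HOL cannot quantify over modules of all types, so all modules considered have their elements in
  one type \<open>'m\<close>, which plays the role of a universe. If \<open>'m\<close> is infinite and at least as
  large as the ring, it contains copies of all cyclic modules and of the free modules covering any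
  of its modules. Then projectivity and projective dimension agree with the usual notions, and so
  does the global dimension, which is attained on cyclic modules by Auslander's theorem.
\<close>

definition projective :: "('a, 'r) ring_scheme \<Rightarrow> ('a, 'm) module \<Rightarrow> bool"
  where "projective A P \<longleftrightarrow> right_module A P \<and>
    (\<forall>(M :: ('a, 'm) module) (N :: ('a, 'm) module) g f.
       right_module A M \<and> right_module A N \<and>
       g \<in> module_hom A M N \<and> g ` carrier M = carrier N \<and> f \<in> module_hom A P N \<longrightarrow>
       (\<exists>h \<in> module_hom A P M. \<forall>x\<in>carrier P. g (h x) = f x))"

definition projective_resolution ::
    "('a, 'r) ring_scheme \<Rightarrow> ('a, 'm) module \<Rightarrow>
     (nat \<Rightarrow> ('a, 'm) module) \<Rightarrow> (nat \<Rightarrow> 'm \<Rightarrow> 'm) \<Rightarrow> ('m \<Rightarrow> 'm) \<Rightarrow> bool"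
  where "projective_resolution A M P d e \<longleftrightarrow>
    (\<forall>i. projective A (P i)) \<and>
    e \<in> module_hom A (P 0) M \<and> (\<forall>i. d i \<in> module_hom A (P (Suc i)) (P i)) \<and>
    e ` carrier (P 0) = carrier M \<and>
    d 0 ` carrier (P 1) = a_kernel (P 0) M e \<and>
    (\<forall>i. d (Suc i) ` carrier (P (Suc (Suc i))) = a_kernel (P (Suc i)) (P i) (d i))"

definition projective_dim :: "('a, 'r) ring_scheme \<Rightarrow> ('a, 'm) module \<Rightarrow> enat"
  where "projective_dim A M =
    Inf {enat n | n. \<exists>P d e. projective_resolution A M P d e \<and>
                       (\<forall>i>n. carrier (P i) = {\<zero>\<^bsub>P i\<^esub>})}"

definition right_global_dim :: "'m itself \<Rightarrow> ('a, 'r) ring_scheme \<Rightarrow> enat"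
  where "right_global_dim _ A = Sup {projective_dim A M | M :: ('a, 'm) module. right_module A M}"

text \<open>The type of residue classes is infinite, hence large enough for a monomial algebra.\<close>

definition global_dim :: "('x list \<Rightarrow>\<^sub>0 'k::field) set \<Rightarrow> enat"
  where "global_dim I = right_global_dim TYPE(('x list \<Rightarrow>\<^sub>0 'k) set) (monomial_algebra I)"

end

theory Submission
  imports Defs
begin

text \<open>
  Let \<open>A\<close> be the monomial algebra with minimal basis \<open>L\<close>, let \<open>H\<close> be its Hilbert series and \<open>C\<^sub>i\<close> the
  generating series of the \<open>i\<close>-chains. The proof has three independent parts.

  \<^emph>\<open>Chains determine the Hilbert series.\<close> Let \<open>t\<close> be the tail of an \<open>i\<close>-chain and \<open>n\<close> a normal word. If
  \<open>t n\<close> is not normal, then \<open>n\<close> begins with exactly one minimal extension of \<open>t\<close>. Hence the pairs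
  (\<open>i\<close>-chain, normal word) in which the tail and the word have a non-normal product correspond to the
  pairs (\<open>(i+1)\<close>-chain, normal word) in which they have a normal product. Counting by length, the sum
  telescopes to \<open>H (1 - C\<^sub>0 + C\<^sub>1 - \<dots>) = 1\<close> as soon as one chain language is empty
  (\<open>normal_series_relation\<close>). So \<open>H\<close> is the inverse of a finite sum of algebraic functions.

  \<^emph>\<open>Finite global dimension makes a chain language empty.\<close> If \<open>u\<close> is a minimal extension of \<open>t\<close>, then the
  right ideal \<open>u A\<close> is a direct summand of the right annihilator of \<open>t\<close>, which is the first syzygy of
  \<open>t A\<close>. The tails of a long chain thus describe a long non-trivial part of the minimal resolution.
  Instead of comparing that resolution with a given projective one by chain maps and homotopies, the
  proof propagates a single property of a pair \<open>(t, M)\<close>: the identity of \<open>t A\<close> is the sum of a map that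
  factors through \<open>M\<close> and a map that factors through the free module \<open>A\<close>. It holds for \<open>M = t A\<close>, it
  passes to \<open>(u, M')\<close> with \<open>M'\<close> the kernel of a map from a projective module onto \<open>M\<close>
  (\<open>stable_summand_syzygy\<close>), and it fails for \<open>M = 0\<close> (\<open>stable_summand_trivial_module\<close>). Hence a
  projective resolution of length \<open>n\<close> bounds the length of chains
  (\<open>finite_global_dim_chain_level_empty\<close>).

  \<^emph>\<open>Unambiguous context-free languages have algebraic generating series\<close> (the theorem of Chomsky and
  Schuetzenberger, \<open>unambiguous_cfl_algebraic\<close>). The series \<open>y\<^sub>A\<close> of the words derived from a variable
  \<open>A\<close> solve the polynomial system \<open>Y\<^sub>A = P\<^sub>A(t, Y)\<close> of the grammar. The coefficient field is arbitrary, so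
  derivations are of no use for elimination. Instead one deforms the system to
  \<open>Y\<^sub>A = P\<^sub>A(t, Y) + \<epsilon> (Y\<^sub>A - c\<^sub>A)\<^sup>D\<close> with \<open>c\<^sub>A = y\<^sub>A(0)\<close> and \<open>D\<close> larger than all degrees. It still has a
  power series solution, which specializes to \<open>y\<close> at \<open>\<epsilon> = 0\<close>. Now, however, up to powers of \<open>\<epsilon>\<close> every
  monomial in the \<open>Y\<^sub>A - c\<^sub>A\<close> is a combination over \<open>K[t, \<epsilon>]\<close> of the finitely many monomials with all
  exponents below \<open>D\<close>. So the powers of \<open>Y\<^sub>A\<close> are linearly dependent over \<open>K[t, \<epsilon>]\<close>, and the coefficients of
  the lowest power of \<open>\<epsilon>\<close> in such a dependence form a non-trivial relation between the powers of
  \<open>y\<^sub>A\<close> over \<open>K[t]\<close> (\<open>algebraic_system\<close>).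
\<close>

section \<open>Elimination in a perturbed polynomial system\<close>

text \<open>
  Gaussian elimination without division: over a domain, more vectors than coordinates satisfy a
  non-trivial linear relation.
\<close>
lemma linear_dependence:
  fixes a :: "'i \<Rightarrow> 'j \<Rightarrow> 'a::idom"
  assumes "finite J" "finite I" "card J < card I"
  shows "\<exists>c. (\<exists>i\<in>I. c i \<noteq> 0) \<and> (\<forall>j\<in>J. (\<Sum>i\<in>I. c i * a i j) = 0)"
  using assms
proof (induction J arbitrary: I a rule: finite_induct)
  case empty
  then have "I \<noteq> {}" by auto
  then show ?case by (intro exI[of _ "\<lambda>_. 1"]) auto
next
  case (insert j J)
  show ?case
  proof (cases "\<forall>i\<in>I. a i j = 0")
    case True
    have "card J < card I" using insert by simp
    then obtain c where "\<exists>i\<in>I. c i \<noteq> 0" "\<forall>k\<in>J. (\<Sum>i\<in>I. c i * a i k) = 0"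
      using insert.IH[of I a] insert.prems by blast
    with True show ?thesis by (intro exI[of _ c]) auto
  next
    case False
    then obtain i0 where i0: "i0 \<in> I" "a i0 j \<noteq> 0" by blast
    \<comment> \<open>Clear the column \<open>j\<close> with the pivot row \<open>i0\<close>; the factor \<open>a i0 j\<close> avoids a division.\<close>
    let ?I = "I - {i0}"
    have fin: "finite ?I" using insert.prems by simp
    have "card J < card ?I" using insert i0 by simp
    then obtain c where c: "\<exists>i\<in>?I. c i \<noteq> 0"
      and c0: "\<forall>k\<in>J. (\<Sum>i\<in>?I. c i * (a i0 j * a i k - a i j * a i0 k)) = 0"
      using insert.IH[OF fin, of "\<lambda>i k. a i0 j * a i k - a i j * a i0 k"] by blast
    define d where "d i = (if i = i0 then - (\<Sum>i\<in>?I. c i * a i j) else a i0 j * c i)" for i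
    have sum_d: "(\<Sum>i\<in>I. d i * a i k) = (\<Sum>i\<in>?I. c i * (a i0 j * a i k - a i j * a i0 k))" for k
    proof -
      have "(\<Sum>i\<in>I. d i * a i k) = d i0 * a i0 k + (\<Sum>i\<in>?I. d i * a i k)"
        using i0 insert.prems by (simp add: sum.remove)
      also have "(\<Sum>i\<in>?I. d i * a i k) = (\<Sum>i\<in>?I. c i * (a i0 j * a i k))"
        by (intro sum.cong) (auto simp: d_def)
      also have "d i0 * a i0 k = - (\<Sum>i\<in>?I. c i * (a i j * a i0 k))"
        by (simp add: d_def sum_distrib_right mult.assoc)
      finally show ?thesis by (simp add: right_diff_distrib sum_subtractf)
    qed
    have "(\<Sum>i\<in>I. d i * a i k) = 0" if "k \<in> insert j J" for k
    proof (cases "k = j")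
      case True
      show ?thesis unfolding sum_d True by (simp add: mult.commute)
    next
      case False
      with that c0 show ?thesis unfolding sum_d by simp
    qed
    moreover have "\<exists>i\<in>I. d i \<noteq> 0" using c i0 by (auto simp: d_def)
    ultimately show ?thesis by blast
  qed
qed

text \<open>
  The values of polynomials of total degree at most \<open>n\<close> in the family \<open>Z\<close>, with coefficients in the
  image of \<open>h\<close>.
\<close>
inductive poly_expr :: "('s::comm_ring_1 \<Rightarrow> 'b::comm_ring_1) \<Rightarrow> ('n \<Rightarrow> 'b) \<Rightarrow> nat \<Rightarrow> 'b \<Rightarrow> bool"
  for h Z where
  const: "poly_expr h Z n (h s)"
| add: "poly_expr h Z n x \<Longrightarrow> poly_expr h Z n y \<Longrightarrow> poly_expr h Z n (x + y)"
| var: "poly_expr h Z n x \<Longrightarrow> poly_expr h Z (Suc n) (Z A * x)"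

lemma poly_expr_mono: "poly_expr h Z m x \<Longrightarrow> m \<le> n \<Longrightarrow> poly_expr h Z n x"
proof (induction arbitrary: n rule: poly_expr.induct)
  case (var m x A)
  then obtain n' where "n = Suc n'" "m \<le> n'" by (cases n) auto
  with var show ?case by (auto intro: poly_expr.var)
qed (auto intro: poly_expr.intros)

locale ring_map =
  fixes h :: "'s::comm_ring_1 \<Rightarrow> 'b::comm_ring_1"
  assumes h_add: "h (x + y) = h x + h y" and h_mult: "h (x * y) = h x * h y" and h_1: "h 1 = 1"
begin

lemma h_0: "h 0 = 0" using h_add[of 0 0] by simp

lemma h_uminus: "h (- x) = - h x" using h_add[of x "-x"] h_0 by (simp add: eq_neg_iff_add_eq_0 add.commute)

lemma h_power: "h (x ^ k) = h x ^ k" by (induction k) (auto simp: h_1 h_mult)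

lemma h_sum: "h (sum f A) = (\<Sum>x\<in>A. h (f x))"
  by (induction A rule: infinite_finite_induct) (auto simp: h_0 h_add)

lemma poly_expr_scale: "poly_expr h Z n x \<Longrightarrow> poly_expr h Z n (h s * x)"
proof (induction rule: poly_expr.induct)
  case (const n s')
  then show ?case using poly_expr.const[of h Z n "s * s'"] by (simp add: h_mult)
next
  case (var n x A)
  then show ?case using poly_expr.var[of h Z n "h s * x" A] by (simp add: mult.left_commute)
qed (auto simp: distrib_left intro: poly_expr.add)

lemma poly_expr_mult:
  "poly_expr h Z m x \<Longrightarrow> poly_expr h Z n y \<Longrightarrow> poly_expr h Z (m + n) (x * y)"
proof (induction rule: poly_expr.induct)
  case (const m s)
  then show ?case using poly_expr_mono[OF poly_expr_scale] by (metis le_add2)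
next
  case (add m x y')
  then show ?case by (auto simp: distrib_right intro: poly_expr.add)
next
  case (var m x A)
  then show ?case using poly_expr.var[of h Z "m + n" "x * y" A] by (simp add: mult.assoc)
qed

lemma poly_expr_var: "poly_expr h Z (Suc 0) (Z A)"
  using poly_expr.var[OF poly_expr.const[of h Z 0 1]] by (simp add: h_1)

lemma poly_expr_uminus: "poly_expr h Z n x \<Longrightarrow> poly_expr h Z n (- x)"
  using poly_expr_scale[of Z n x "- 1"] by (simp add: h_uminus h_1)

lemma poly_expr_sum:
  "(\<And>i. i \<in> S \<Longrightarrow> poly_expr h Z n (f i)) \<Longrightarrow> poly_expr h Z n (sum f S)"
  using poly_expr.const[of h Z n 0]
  by (induction S rule: infinite_finite_induct) (auto simp: h_0 intro: poly_expr.add)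

lemma poly_expr_prod_list:
  "(\<And>x. x \<in> set xs \<Longrightarrow> poly_expr h Z (Suc 0) (f x)) \<Longrightarrow> poly_expr h Z (length xs) (prod_list (map f xs))"
proof (induction xs)
  case Nil
  then show ?case using poly_expr.const[of h Z 0 1] by (simp add: h_1)
next
  case (Cons x xs)
  then show ?case using poly_expr_mult[of Z "Suc 0" "f x" "length xs"] by simp
qed

end

lemma finite_bounded_multisets:
  assumes "finite V"
  shows "finite {M. set_mset M \<subseteq> V \<and> (\<forall>A. count M A < D)}"
proof -
  have "inj_on (\<lambda>M. restrict (count M) V) {M. set_mset M \<subseteq> V \<and> (\<forall>A. count M A < D)}"
  proof (rule inj_onI, rule multiset_eqI)
    fix M N A
    assume "M \<in> {M. set_mset M \<subseteq> V \<and> (\<forall>A. count M A < D)}" "N \<in> {M. set_mset M \<subseteq> V \<and> (\<forall>A. count M A < D)}"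
      and eq: "restrict (count M) V = restrict (count N) V"
    then have sub: "set_mset M \<subseteq> V" "set_mset N \<subseteq> V" by auto
    show "count M A = count N A"
    proof (cases "A \<in> V")
      case True
      then show ?thesis using fun_cong[OF eq, of A] by simp
    next
      case False
      then have "A \<notin># M" "A \<notin># N" using sub by auto
      then show ?thesis by (simp add: not_in_iff)
    qed
  qed
  moreover have "(\<lambda>M. restrict (count M) V) ` {M. set_mset M \<subseteq> V \<and> (\<forall>A. count M A < D)} \<subseteq> V \<rightarrow>\<^sub>E {..<D}"
    by auto
  ultimately show ?thesis
    by (rule inj_on_finite) (simp add: assms finite_PiE)
qed

text \<open>
  If \<open>e Z\<^sub>A\<^sup>D\<close> has degree less than \<open>D\<close> in \<open>Z\<close>, then a monomial with an exponent at least \<open>D\<close> becomes,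
  after multiplication by \<open>e\<close>, a combination of monomials of smaller total degree. By induction on the
  degree, only the monomials with all exponents below \<open>D\<close> remain. Monomials are indexed by the multisets
  of their variables.
\<close>
lemma (in ring_map) finite_module_relation:
  fixes Z :: "'n \<Rightarrow> 'b"
  assumes V: "finite V" "\<And>A. A \<notin> V \<Longrightarrow> Z A = 0"
    and D: "D > 0"
    and red: "\<And>A. poly_expr h Z (D - 1) (h e * Z A ^ D)"
  shows "\<exists>R :: 'n multiset set. finite R \<and>
    (\<forall>n x. poly_expr h Z n x \<longrightarrow> (\<exists>k a. h e ^ k * x = (\<Sum>M\<in>R. h (a M) * prod_mset (image_mset Z M))))"
proof -
  define R where "R = {M. set_mset M \<subseteq> V \<and> (\<forall>A. count M A < D)}"
  have finR: "finite R" unfolding R_def by (rule finite_bounded_multisets[OF V(1)])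
  define mon where "mon M = prod_mset (image_mset Z M)" for M
  define Q where "Q x \<longleftrightarrow> (\<exists>k a. h e ^ k * x = (\<Sum>M\<in>R. h (a M) * mon M))" for x
  have Q_scale: "Q (h s * x)" if "Q x" for s x
  proof -
    obtain k a where "h e ^ k * x = (\<Sum>M\<in>R. h (a M) * mon M)" using \<open>Q x\<close> Q_def by blast
    then have "h e ^ k * (h s * x) = (\<Sum>M\<in>R. h (s * a M) * mon M)"
      by (simp add: h_mult sum_distrib_left mult.assoc mult.left_commute)
    then show ?thesis unfolding Q_def by (intro exI)
  qed
  have Q_add: "Q (x + y)" if "Q x" "Q y" for x y
  proof -
    obtain k a where a: "h e ^ k * x = (\<Sum>M\<in>R. h (a M) * mon M)" using \<open>Q x\<close> Q_def by blast
    obtain l b where b: "h e ^ l * y = (\<Sum>M\<in>R. h (b M) * mon M)" using \<open>Q y\<close> Q_def by blast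
    have "h e ^ (k + l) * (x + y) = h e ^ l * (h e ^ k * x) + h e ^ k * (h e ^ l * y)"
      by (simp add: power_add algebra_simps)
    also have "\<dots> = (\<Sum>M\<in>R. h (e ^ l * a M + e ^ k * b M) * mon M)"
      unfolding a b by (simp add: h_add h_mult h_power sum_distrib_left sum.distrib algebra_simps)
    finally show ?thesis unfolding Q_def by (intro exI)
  qed
  have Q_cancel: "Q x" if "Q (h e * x)" for x
  proof -
    obtain k a where "h e ^ k * (h e * x) = (\<Sum>M\<in>R. h (a M) * mon M)"
      using \<open>Q (h e * x)\<close> unfolding Q_def by blast
    then have "h e ^ Suc k * x = (\<Sum>M\<in>R. h (a M) * mon M)" by (simp add: mult.assoc mult.left_commute)
    then show ?thesis unfolding Q_def by blast
  qed
  have Q_expr: "Q (x * mon M')" if "poly_expr h Z n x" "\<forall>M. size M \<le> n + size M' \<longrightarrow> Q (mon M)" for n x M'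
    using that
  proof (induction arbitrary: M' rule: poly_expr.induct)
    case (const n s)
    then show ?case by (intro Q_scale) auto
  next
    case (add n x y)
    then show ?case by (simp add: distrib_right Q_add)
  next
    case (var n x A)
    have "Q (x * mon (add_mset A M'))" using var.prems by (intro var.IH) auto
    then show ?case by (simp add: mon_def mult_ac)
  qed
  have Q_mon: "Q (mon M)" for M
  proof (induction M rule: measure_induct_rule[of size])
    case (less M)
    \<comment> \<open>A variable outside of \<open>V\<close> has value zero, so that only finitely many monomials matter.\<close>
    consider "M \<in> R" | A where "A \<in># M" "A \<notin> V" | A where "D \<le> count M A"
      using not_less by (fastforce simp: R_def)
    then show ?case
    proof cases
      case 1
      have "mon M = (\<Sum>M'\<in>R. h (if M' = M then 1 else 0) * mon M')"
      proof -
        have "(\<Sum>M'\<in>R. h (if M' = M then 1 else 0) * mon M') = (\<Sum>M'\<in>R. if M' = M then mon M else 0)"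
          by (intro sum.cong) (auto simp: h_0 h_1)
        then show ?thesis using 1 finR by simp
      qed
      then have "h e ^ 0 * mon M = (\<Sum>M'\<in>R. h (if M' = M then 1 else 0) * mon M')" by simp
      then show ?thesis unfolding Q_def by (intro exI)
    next
      case 2
      then have "mon M = Z A * mon (M - {#A#})"
        unfolding mon_def by (metis image_mset_add_mset insert_DiffM prod_mset.add_mset)
      then have "h e ^ 0 * mon M = (\<Sum>M'\<in>R. h 0 * mon M')" using V 2 by (simp add: h_0)
      then show ?thesis unfolding Q_def by (intro exI)
    next
      case 3
      define M' where "M' = M - replicate_mset D A"
      have M: "M = replicate_mset D A + M'"
        using 3 unfolding M'_def by (simp add: count_le_replicate_mset_subset_eq)
      have mon: "mon M = Z A ^ D * mon M'" by (subst M) (simp add: mon_def image_replicate_mset)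
      have "Q (h e * Z A ^ D * mon M')"
      proof (rule Q_expr[OF red])
        show "\<forall>N. size N \<le> D - 1 + size M' \<longrightarrow> Q (mon N)"
          using less.IH M D by (auto intro!: less.IH)
      qed
      then have "Q (h e * mon M)" by (simp add: mon mult.assoc)
      then show ?thesis by (rule Q_cancel)
    qed
  qed
  have "Q x" if "poly_expr h Z n x" for n x
    using Q_expr[OF that, of "{#}"] Q_mon by (simp add: mon_def)
  then show ?thesis using finR unfolding Q_def mon_def by (intro exI[of _ R] conjI allI impI)
qed

lemma fps_to_fls_sum: "fps_to_fls (sum f S) = (\<Sum>x\<in>S. fps_to_fls (f x))"
  by (induction S rule: infinite_finite_induct) auto

lemma algebraic_functionI:
  fixes y :: "'k::field fps"
  assumes rel: "(\<Sum>i\<le>N. fps_of_poly (p i) * y ^ i) = 0" and nz: "i0 \<le> N" "p i0 \<noteq> 0"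
  shows "algebraic_function y"
proof -
  define P where "P = (\<Sum>i\<le>N. monom (fps_to_fls (fps_of_poly (p i))) i)"
  have coeff_P: "coeff P i = (if i \<le> N then fps_to_fls (fps_of_poly (p i)) else 0)" for i
    by (simp add: P_def coeff_sum)
  have "coeff P i \<in> rational_functions" for i
  proof -
    have "coeff P i = fps_to_fls (fps_of_poly (if i \<le> N then p i else 0)) / fps_to_fls (fps_of_poly 1)"
      by (simp add: coeff_P)
    then show ?thesis unfolding rational_functions_def using one_neq_zero by blast
  qed
  moreover have "P \<noteq> 0"
    using coeff_P[of i0] nz by (auto simp: fps_of_poly_eq_iff)
  moreover have "poly P (fps_to_fls y) = fps_to_fls (\<Sum>i\<le>N. fps_of_poly (p i) * y ^ i)"
    by (simp add: P_def poly_sum poly_monom fps_to_fls_sum fls_times_fps_to_fls fps_to_fls_power)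
  ultimately show ?thesis unfolding algebraic_function_def using rel by auto
qed

text \<open>
  An element of \<open>K[\<epsilon>][[t]]\<close> is a power series whose coefficients are polynomials in \<open>\<epsilon>\<close>; the following
  reads off the coefficient of \<open>\<epsilon>\<^sup>m\<close>. For \<open>m = 0\<close> it is the specialization \<open>\<epsilon> = 0\<close>, a ring homomorphism.
\<close>
definition eps_coeff :: "nat \<Rightarrow> 'k::comm_ring_1 poly fps \<Rightarrow> 'k fps"
  where "eps_coeff m f = Abs_fps (\<lambda>n. coeff (f $ n) m)"

lemma eps_coeff_mult:
  assumes "\<And>n l. l < m \<Longrightarrow> coeff (f $ n) l = 0"
  shows "eps_coeff m (f * g) = eps_coeff m f * eps_coeff 0 g"
proof (rule fps_ext)
  fix n
  have *: "coeff (f $ i * g $ j) m = coeff (f $ i) m * coeff (g $ j) 0" for i j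
  proof -
    have "coeff (f $ i * g $ j) m = (\<Sum>l\<le>m. coeff (f $ i) l * coeff (g $ j) (m - l))"
      by (simp add: coeff_mult)
    also have "\<dots> = (\<Sum>l\<le>m. if l = m then coeff (f $ i) m * coeff (g $ j) 0 else 0)"
      using assms by (intro sum.cong) auto
    finally show ?thesis by simp
  qed
  show "eps_coeff m (f * g) $ n = (eps_coeff m f * eps_coeff 0 g) $ n"
    by (simp add: eps_coeff_def fps_mult_nth coeff_sum *)
qed

lemma eps_coeff_sum: "eps_coeff m (sum f A) = (\<Sum>x\<in>A. eps_coeff m (f x))"
  by (rule fps_ext) (simp add: eps_coeff_def fps_sum_nth coeff_sum)

interpretation eps_zero: ring_map "eps_coeff 0 :: 'k::comm_ring_1 poly fps \<Rightarrow> 'k fps"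
proof
  fix x y :: "'k poly fps"
  show "eps_coeff 0 (x + y) = eps_coeff 0 x + eps_coeff 0 y"
    by (rule fps_ext) (simp add: eps_coeff_def)
  show "eps_coeff 0 (x * y) = eps_coeff 0 x * eps_coeff 0 y" by (rule eps_coeff_mult) simp
  show "eps_coeff 0 (1 :: 'k poly fps) = 1" by (rule fps_ext) (simp add: eps_coeff_def)
qed

text \<open>
  Putting \<open>\<epsilon> = 0\<close> in an algebraic relation over \<open>K[t, \<epsilon>]\<close> may annihilate all of its coefficients.
  The terms that carry the lowest power of \<open>\<epsilon>\<close> in the coefficients always leave a non-trivial relation.
\<close>
lemma algebraic_specialization:
  fixes Y :: "'k::field poly fps"
  assumes rel: "(\<Sum>i\<le>N. fps_of_poly (p i) * Y ^ i) = 0" and nz: "i0 \<le> N" "p i0 \<noteq> 0"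
  shows "algebraic_function (eps_coeff 0 Y)"
proof -
  define m where "m = (LEAST m. \<exists>i\<le>N. \<exists>j. coeff (coeff (p i) j) m \<noteq> 0)"
  obtain j where "coeff (p i0) j \<noteq> 0" using nz(2) by (metis leading_coeff_0_iff)
  then obtain l where "coeff (coeff (p i0) j) l \<noteq> 0" by (metis leading_coeff_0_iff)
  then have "\<exists>m. \<exists>i\<le>N. \<exists>j. coeff (coeff (p i) j) m \<noteq> 0" using nz(1) by blast
  then have "\<exists>i\<le>N. \<exists>j. coeff (coeff (p i) j) m \<noteq> 0" unfolding m_def by (rule LeastI_ex)
  then obtain i1 j1 where i1: "i1 \<le> N" "coeff (coeff (p i1) j1) m \<noteq> 0" by blast
  have low: "coeff (coeff (p i) j) l = 0" if "i \<le> N" "l < m" for i j l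
    using not_less_Least[of l "\<lambda>m. \<exists>i\<le>N. \<exists>j. coeff (coeff (p i) j) m \<noteq> 0"] that
    unfolding m_def by blast
  define q where "q i = map_poly (\<lambda>c. coeff c m) (p i)" for i
  have q: "eps_coeff m (fps_of_poly (p i)) = fps_of_poly (q i)" for i
    by (rule fps_ext) (simp add: eps_coeff_def q_def coeff_map_poly)
  have "0 = eps_coeff m (\<Sum>i\<le>N. fps_of_poly (p i) * Y ^ i)"
    unfolding rel by (rule fps_ext) (simp add: eps_coeff_def)
  also have "\<dots> = (\<Sum>i\<le>N. eps_coeff m (fps_of_poly (p i)) * eps_coeff 0 (Y ^ i))"
    unfolding eps_coeff_sum by (intro sum.cong refl eps_coeff_mult) (auto simp: low)
  finally have "(\<Sum>i\<le>N. fps_of_poly (q i) * eps_coeff 0 Y ^ i) = 0"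
    by (simp add: q eps_zero.h_power)
  moreover have "q i1 \<noteq> 0"
  proof
    assume "q i1 = 0"
    then have "coeff (q i1) j1 = 0" by simp
    then show False using i1(2) by (simp add: q_def coeff_map_poly)
  qed
  ultimately show ?thesis using i1(1) by (intro algebraic_functionI)
qed

interpretation fps_poly: ring_map "fps_of_poly :: 's::comm_ring_1 poly \<Rightarrow> 's fps"
  by standard (simp_all add: fps_of_poly_add fps_of_poly_mult)

text \<open>
  The powers of \<open>x\<close> lie, up to powers of \<open>e\<close>, in the span of one finite set over \<open>K[\<epsilon>, t]\<close>. So there is
  a linear relation between finitely many of them, that is, an algebraic equation for \<open>x\<close>.
\<close>
lemma algebraic_if_reducible:
  fixes Z :: "'n \<Rightarrow> 'k::field poly fps"
  assumes V: "finite V" "\<And>A. A \<notin> V \<Longrightarrow> Z A = 0" and D: "D > 0" and e: "e \<noteq> 0"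
    and red: "\<And>A. poly_expr fps_of_poly Z (D - 1) (fps_of_poly e * Z A ^ D)"
    and x: "poly_expr fps_of_poly Z n x"
  shows "algebraic_function (eps_coeff 0 x)"
proof -
  obtain R where R: "finite R"
    and *: "\<forall>n x. poly_expr fps_of_poly Z n x \<longrightarrow>
      (\<exists>k a. fps_of_poly e ^ k * x = (\<Sum>M\<in>R. fps_of_poly (a M) * prod_mset (image_mset Z M)))"
    using fps_poly.finite_module_relation[OF V D red] by blast
  have "poly_expr fps_of_poly Z (i * n) (x ^ i)" for i
  proof (induction i)
    case 0
    then show ?case using poly_expr.const[of fps_of_poly Z 0 1] by simp
  next
    case (Suc i)
    then show ?case using fps_poly.poly_expr_mult[OF x Suc] by simp
  qed
  then have "\<forall>i. \<exists>k a. fps_of_poly e ^ k * x ^ i = (\<Sum>M\<in>R. fps_of_poly (a M) * prod_mset (image_mset Z M))"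
    using * by blast
  then obtain k a where ka: "\<And>i. fps_of_poly e ^ k i * x ^ i =
      (\<Sum>M\<in>R. fps_of_poly (a i M) * prod_mset (image_mset Z M))"
    by metis
  have "card R < card {..card R}" by simp
  then obtain c where c: "\<exists>i\<in>{..card R}. c i \<noteq> 0" "\<forall>M\<in>R. (\<Sum>i\<le>card R. c i * a i M) = 0"
    using linear_dependence[OF R, of "{..card R}" a] by auto
  then obtain i0 where i0: "i0 \<le> card R" "c i0 \<noteq> 0" by auto
  have "(\<Sum>i\<le>card R. fps_of_poly (c i * e ^ k i) * x ^ i) =
      (\<Sum>i\<le>card R. fps_of_poly (c i) * (\<Sum>M\<in>R. fps_of_poly (a i M) * prod_mset (image_mset Z M)))"
    by (simp add: fps_poly.h_mult fps_poly.h_power mult.assoc flip: ka)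
  also have "\<dots> = (\<Sum>M\<in>R. fps_of_poly (\<Sum>i\<le>card R. c i * a i M) * prod_mset (image_mset Z M))"
    by (simp add: fps_poly.h_sum fps_poly.h_mult sum_distrib_left sum_distrib_right mult.assoc)
      (rule sum.swap)
  also have "\<dots> = 0" using c(2) by simp
  finally show ?thesis using i0 e
    by (intro algebraic_specialization[where p = "\<lambda>i. c i * e ^ k i"]) auto
qed

primrec sval :: "'a \<Rightarrow> ('n \<Rightarrow> 'a) \<Rightarrow> ('n, 't) csym \<Rightarrow> 'a" where
  "sval t Y (NT A) = Y A"
| "sval t Y (Tm a) = t"

text \<open>
  The right-hand side of the polynomial system of a grammar: every terminal is replaced by \<open>t\<close> and
  every variable by its value under \<open>Y\<close>.
\<close>
definition rhs :: "('n \<times> ('n, 't) csym list) set \<Rightarrow> 'a::comm_semiring_1 \<Rightarrow> ('n \<Rightarrow> 'a) \<Rightarrow> 'n \<Rightarrow> 'a"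
  where "rhs R t Y A = (\<Sum>\<gamma> | (A, \<gamma>) \<in> R. prod_list (map (sval t Y) \<gamma>))"

lemma (in ring_map) h_sval: "h (prod_list (map (sval t Y) \<gamma>)) = prod_list (map (sval (h t) (\<lambda>B. h (Y B))) \<gamma>)"
proof (induction \<gamma>)
  case (Cons s \<gamma>)
  then show ?case by (cases s) (auto simp: h_mult)
qed (simp add: h_1)

lemma (in ring_map) h_rhs: "h (rhs R t Y A) = rhs R (h t) (\<lambda>B. h (Y B)) A"
  by (simp add: rhs_def h_sum h_sval)

interpretation fps_const_term: ring_map "\<lambda>f :: 'a::comm_ring_1 fps. f $ 0"
  by standard simp_all

interpretation poly_const: ring_map "\<lambda>c :: 'a::comm_ring_1. [:c:]"
  by standard simp_all

text \<open>
  In a product of power series, the top coefficient \<open>d\<close> of one factor only meets the constant terms of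
  the other factors. It has no influence if one of these vanishes.
\<close>
lemma prod_list_coeff_cong:
  fixes f g :: "'s \<Rightarrow> 'a::comm_ring_1 fps"
  assumes low: "\<And>s k. s \<in> set \<gamma> \<Longrightarrow> k < d \<Longrightarrow> f s $ k = g s $ k"
    and d: "d > 0"
    and top: "\<And>\<alpha> s \<beta>. \<gamma> = \<alpha> @ s # \<beta> \<Longrightarrow> f s $ d \<noteq> g s $ d \<Longrightarrow>
      prod_list (map (\<lambda>s. f s $ 0) \<alpha>) * prod_list (map (\<lambda>s. f s $ 0) \<beta>) = 0"
  shows "prod_list (map f \<gamma>) $ d = prod_list (map g \<gamma>) $ d"
proof -
  have 0: "prod_list (map u xs) $ 0 = prod_list (map (\<lambda>s. u s $ 0) xs)" for u :: "'s \<Rightarrow> 'a fps" and xs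
    by (induction xs) auto
  \<comment> \<open>The scalar \<open>c\<close> stands for the constant terms of the factors already split off on the left.\<close>
  have "(\<forall>k<d. (prod_list (map f \<gamma>) - prod_list (map g \<gamma>)) $ k = 0) \<and>
    c * (prod_list (map f \<gamma>) - prod_list (map g \<gamma>)) $ d = 0"
    if "\<And>\<alpha> s \<beta>. \<gamma> = \<alpha> @ s # \<beta> \<Longrightarrow> f s $ d \<noteq> g s $ d \<Longrightarrow>
      c * (prod_list (map (\<lambda>s. f s $ 0) \<alpha>) * prod_list (map (\<lambda>s. f s $ 0) \<beta>)) = 0"
      "\<And>s k. s \<in> set \<gamma> \<Longrightarrow> k < d \<Longrightarrow> f s $ k = g s $ k" for c
    using that
  proof (induction \<gamma> arbitrary: c)
    case (Cons s \<gamma>)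
    let ?F = "prod_list (map f \<gamma>)" and ?G = "prod_list (map g \<gamma>)"
    have fg0: "f s $ 0 = g s $ 0" using Cons.prems(2)[of s 0] d by simp
    have "(\<forall>k<d. (?F - ?G) $ k = 0) \<and> c * f s $ 0 * (?F - ?G) $ d = 0"
    proof (rule Cons.IH)
      fix \<alpha> s' \<beta>
      assume "\<gamma> = \<alpha> @ s' # \<beta>" "f s' $ d \<noteq> g s' $ d"
      then show "c * f s $ 0 * (prod_list (map (\<lambda>s. f s $ 0) \<alpha>) * prod_list (map (\<lambda>s. f s $ 0) \<beta>)) = 0"
        using Cons.prems(1)[of "s # \<alpha>" s' \<beta>] by (simp add: mult.assoc)
    qed (use Cons.prems(2) in auto)
    then have lowFG: "\<And>k. k < d \<Longrightarrow> (?F - ?G) $ k = 0" and topFG: "c * f s $ 0 * (?F - ?G) $ d = 0"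
      by auto
    have split: "prod_list (map f (s # \<gamma>)) - prod_list (map g (s # \<gamma>)) = (f s - g s) * ?F + g s * (?F - ?G)"
      by (simp add: algebra_simps)
    have "((f s - g s) * ?F + g s * (?F - ?G)) $ k = 0" if "k < d" for k
    proof -
      have "((f s - g s) * ?F) $ k = 0"
        unfolding fps_mult_nth using Cons.prems(2)[of s] that by (intro sum.neutral) auto
      moreover have "(g s * (?F - ?G)) $ k = 0"
        unfolding fps_mult_nth using lowFG that by (intro sum.neutral ballI) auto
      ultimately show ?thesis by simp
    qed
    moreover have "((f s - g s) * ?F) $ d = (f s - g s) $ d * ?F $ 0"
    proof -
      have "((f s - g s) * ?F) $ d = (\<Sum>i=0..d. if i = d then (f s - g s) $ d * ?F $ 0 else 0)"
        unfolding fps_mult_nth using Cons.prems(2)[of s] by (intro sum.cong) auto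
      then show ?thesis by simp
    qed
    moreover have "(g s * (?F - ?G)) $ d = g s $ 0 * (?F - ?G) $ d"
    proof -
      have "(g s * (?F - ?G)) $ d = (\<Sum>i=0..d. if i = 0 then g s $ 0 * (?F - ?G) $ d else 0)"
        unfolding fps_mult_nth using lowFG by (intro sum.cong) (auto simp del: fps_sub_nth)
      then show ?thesis by simp
    qed
    moreover have "c * ((f s - g s) $ d * ?F $ 0) = 0"
      using Cons.prems(1)[of "[]" s \<gamma>] by (cases "f s $ d = g s $ d") (auto simp: 0 mult_ac, metis mult.assoc mult_zero_left)
    moreover have "c * (g s $ 0 * (?F - ?G) $ d) = 0"
      using topFG fg0 by (simp add: mult.assoc del: fps_sub_nth)
    ultimately show ?case unfolding split by (simp add: distrib_left)
  qed simp
  from this[of 1] have "(prod_list (map f \<gamma>) - prod_list (map g \<gamma>)) $ d = 0" using low top by simp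
  then show ?thesis by simp
qed

text \<open>
  The coefficients of a family of power series are ordered by an index in such a way that every
  coefficient of the image under \<open>\<Phi>\<close> depends only on coefficients of smaller index. As in Banach's
  theorem there is then exactly one fixed point with constant terms \<open>c\<close>. The constant terms are
  prescribed because they decide which coefficients a product depends on.
\<close>
locale contraction =
  fixes c :: "'n \<Rightarrow> 'a::comm_ring_1" and idx :: "'n \<Rightarrow> nat \<Rightarrow> nat"
    and \<Phi> :: "('n \<Rightarrow> 'a fps) \<Rightarrow> 'n \<Rightarrow> 'a fps"
  assumes preserve: "(\<And>A. Z A $ 0 = c A) \<Longrightarrow> \<Phi> Z A $ 0 = c A"
    and contract: "(\<And>A. Z A $ 0 = c A) \<Longrightarrow> (\<And>A. W A $ 0 = c A) \<Longrightarrow>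
      (\<And>B k. idx B k < n \<Longrightarrow> Z B $ k = W B $ k) \<Longrightarrow> idx A d \<le> n \<Longrightarrow> \<Phi> Z A $ d = \<Phi> W A $ d"
begin

lemma fixed_point_unique:
  assumes "\<And>A. Z A $ 0 = c A" "\<And>A. W A $ 0 = c A" "\<And>A. \<Phi> Z A = Z A" "\<And>A. \<Phi> W A = W A"
  shows "Z A = W A"
proof -
  have "idx A d = n \<longrightarrow> Z A $ d = W A $ d" for A d n
  proof (induction n arbitrary: A d rule: less_induct)
    case (less n)
    show ?case using contract[of Z W n A d] assms less.IH by auto
  qed
  then show ?thesis by (auto simp: fps_eq_iff)
qed

lemma fixed_point_exists:
  obtains Z where "\<And>A. Z A $ 0 = c A" "\<And>A. \<Phi> Z A = Z A"
proof -
  define F where "F k = (\<Phi> ^^ k) (\<lambda>A. fps_const (c A))" for k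
  have F_Suc: "F (Suc k) = \<Phi> (F k)" for k by (simp add: F_def)
  have F0: "F k A $ 0 = c A" for k A
    by (induction k arbitrary: A) (auto simp: F_Suc preserve, simp add: F_def)
  have step: "idx A d < k \<longrightarrow> F k A $ d = F (Suc k) A $ d" for k A d
  proof (induction k arbitrary: A d)
    case (Suc k)
    show ?case
    proof
      assume "idx A d < Suc k"
      then show "F (Suc k) A $ d = F (Suc (Suc k)) A $ d"
        unfolding F_Suc[of k] F_Suc[of "Suc k"]
        using Suc.IH by (intro contract[of _ _ k]) (auto simp: F0 F_Suc[symmetric])
    qed
  qed simp
  have stable: "F (m + k) A $ d = F k A $ d" if "idx A d < k" for A d k m
    using that step[of A d "m + k" for m] by (induction m) auto
  \<comment> \<open>The coefficient with index \<open>k\<close> no longer changes after \<open>k + 1\<close> iterations.\<close>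
  define Z where "Z A = Abs_fps (\<lambda>d. F (Suc (idx A d)) A $ d)" for A
  have Z: "Z A $ d = F k A $ d" if "idx A d < k" for A d k
    using stable[of A d "Suc (idx A d)" "k - Suc (idx A d)"] that by (simp add: Z_def)
  have Z0: "Z A $ 0 = c A" for A by (simp add: Z_def F0)
  have "\<Phi> Z A = Z A" for A
  proof (rule fps_ext)
    fix d
    have "\<Phi> Z A $ d = \<Phi> (F (idx A d)) A $ d"
      using Z by (intro contract[of _ _ "idx A d"]) (auto simp: Z0 F0)
    also have "\<dots> = Z A $ d" by (simp add: Z[of A d "Suc (idx A d)"] F_Suc)
    finally show "\<Phi> Z A $ d = Z A $ d" .
  qed
  with Z0 show thesis by (intro that)
qed

end

definition perturbed :: "('n \<times> ('n, 't) csym list) set \<Rightarrow> ('n \<Rightarrow> 'a) \<Rightarrow> ('n \<Rightarrow> 'a) \<Rightarrow> nat \<Rightarrow>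
    ('n \<Rightarrow> 'a::comm_ring_1 fps) \<Rightarrow> 'n \<Rightarrow> 'a fps"
  where "perturbed R c e D Z A = rhs R fps_X Z A + fps_const (e A) * (Z A - fps_const (c A)) ^ D"

text \<open>
  The coefficient \<open>t\<^sup>d\<close> of the right-hand side for \<open>A\<close> involves the coefficient \<open>t\<^sup>d\<close> of a variable \<open>B\<close>
  only through productions in which all other symbols have a non-zero constant term. If the rank \<open>\<rho>\<close>
  decreases along these, then the lexicographic index \<open>(d, \<rho> A)\<close>, encoded as \<open>d r + \<rho> A\<close>, decreases.
  The perturbation only involves lower powers of \<open>t\<close>, as \<open>D \<ge> 2\<close> and \<open>Z A - c A\<close> has no constant term.
\<close>
lemma perturbed_contraction:
  fixes c :: "'n \<Rightarrow> 'a::comm_ring_1" and \<rho> :: "'n \<Rightarrow> nat"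
  assumes c: "\<And>A. c A = rhs R 0 c A" and D: "D \<ge> 2" and \<rho>: "\<And>A. \<rho> A < r"
    and rank: "\<And>A \<alpha> B \<beta>. (A, \<alpha> @ NT B # \<beta>) \<in> R \<Longrightarrow>
      prod_list (map (sval 0 c) \<alpha>) * prod_list (map (sval 0 c) \<beta>) \<noteq> 0 \<Longrightarrow> \<rho> B < \<rho> A"
  shows "contraction c (\<lambda>A d. d * r + \<rho> A) (perturbed R c e D)"
proof
  have r: "r > 0" using \<rho> gr0I by fastforce
  show pres: "perturbed R c e D Z A $ 0 = c A" if "\<And>A. Z A $ 0 = c A" for Z A
  proof -
    have "rhs R fps_X Z A $ 0 = c A"
      using fps_const_term.h_rhs[of R fps_X Z A] that by (simp add: c[symmetric])
    moreover have "(Z A - fps_const (c A)) ^ D $ 0 = 0"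
      using D that by (simp add: fps_power_zeroth power_0_left)
    ultimately show ?thesis by (simp add: perturbed_def)
  qed
  fix Z W :: "'n \<Rightarrow> 'a fps" and n A d
  assume Z: "\<And>A. Z A $ 0 = c A" and W: "\<And>A. W A $ 0 = c A"
    and agree: "\<And>B k. k * r + \<rho> B < n \<Longrightarrow> Z B $ k = W B $ k" and le: "d * r + \<rho> A \<le> n"
  show "perturbed R c e D Z A $ d = perturbed R c e D W A $ d"
  proof (cases "d = 0")
    case True
    then show ?thesis using pres Z W by metis
  next
    case False
    have below: "Z B $ k = W B $ k" if "k < d" for B k
    proof (rule agree)
      have "k * r + \<rho> B < Suc k * r" using \<rho> by simp
      also have "\<dots> \<le> d * r" using that by (intro mult_le_mono1) simp
      finally show "k * r + \<rho> B < n" using le by simp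
    qed
    have sval0: "sval fps_X Z s $ 0 = sval 0 c s" for s by (cases s) (auto simp: Z)
    have "prod_list (map (sval fps_X Z) \<gamma>) $ d = prod_list (map (sval fps_X W) \<gamma>) $ d"
      if "(A, \<gamma>) \<in> R" for \<gamma>
    proof (rule prod_list_coeff_cong)
      show "sval fps_X Z s $ k = sval fps_X W s $ k" if "k < d" for s k
        using below[OF that] by (cases s) auto
      show "d > 0" using False by simp
    next
      fix \<alpha> s \<beta>
      assume s: "\<gamma> = \<alpha> @ s # \<beta>" "sval fps_X Z s $ d \<noteq> sval fps_X W s $ d"
      then obtain B where B: "s = NT B" "Z B $ d \<noteq> W B $ d" by (cases s) auto
      then have "\<not> \<rho> B < \<rho> A" using agree[of d B] le by auto
      then show "prod_list (map (\<lambda>s. sval fps_X Z s $ 0) \<alpha>) * prod_list (map (\<lambda>s. sval fps_X Z s $ 0) \<beta>) = 0"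
        using rank[of A \<alpha> B \<beta>] that s B by (auto simp: sval0)
    qed
    then have "rhs R fps_X Z A $ d = rhs R fps_X W A $ d"
      by (simp add: rhs_def fps_sum_nth)
    moreover have "(Z A - fps_const (c A)) ^ D $ d = (W A - fps_const (c A)) ^ D $ d"
    proof -
      define u where "u b = (if b then Z A - fps_const (c A) else W A - fps_const (c A))" for b
      have "prod_list (map (\<lambda>_. u True) (replicate D ())) $ d = prod_list (map (\<lambda>_. u False) (replicate D ())) $ d"
      proof (rule prod_list_coeff_cong)
        show "u True $ k = u False $ k" if "k < d" for k
          using below[OF that] by (simp add: u_def)
        show "d > 0" using False by simp
        fix \<alpha> \<beta> :: "unit list" and s
        assume eq: "replicate D () = \<alpha> @ s # \<beta>"
        have "\<alpha> \<noteq> [] \<or> \<beta> \<noteq> []" using arg_cong[OF eq, of length] D by auto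
        then show "prod_list (map (\<lambda>s. u True $ 0) \<alpha>) * prod_list (map (\<lambda>s. u True $ 0) \<beta>) = 0"
          by (cases \<alpha>; cases \<beta>) (auto simp: u_def Z)
      qed
      then show ?thesis by (simp add: u_def map_replicate_const)
    qed
    ultimately show ?thesis by (simp add: perturbed_def)
  qed
qed

text \<open>
  The exponent \<open>D\<close> exceeds the degree of every production. So the perturbed equation
  \<open>\<epsilon> (Y\<^sub>A - c\<^sub>A)\<^sup>D = Y\<^sub>A - P\<^sub>A(t, Y)\<close> has degree less than \<open>D\<close> on its right-hand side, which is the
  reduction needed for elimination.
\<close>
theorem algebraic_system:
  fixes y :: "'n \<Rightarrow> 'k::field fps" and \<rho> :: "'n \<Rightarrow> nat"
  assumes fin: "finite R" and y: "\<And>A. y A = rhs R fps_X y A" and \<rho>: "\<And>A. \<rho> A < r"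
    and rank: "\<And>A \<alpha> B \<beta>. (A, \<alpha> @ NT B # \<beta>) \<in> R \<Longrightarrow>
      prod_list (map (\<lambda>s. sval fps_X y s $ 0) \<alpha>) * prod_list (map (\<lambda>s. sval fps_X y s $ 0) \<beta>) \<noteq> 0 \<Longrightarrow> \<rho> B < \<rho> A"
  shows "algebraic_function (y S)"
proof -
  define V where "V = fst ` R"
  define c where "c A = y A $ 0" for A
  define D where "D = Suc (Suc (Max (length ` snd ` R)))"
  \<comment> \<open>Variables without productions are left unperturbed and stay zero, so that finitely many remain.\<close>
  define e where "e A = (if A \<in> V then [:0, 1:] else 0 :: 'k poly)" for A
  have len: "length \<gamma> < D - 1" if "(A, \<gamma>) \<in> R" for A \<gamma>
    using fin that by (auto simp: D_def less_Suc_eq_le intro!: Max_ge image_eqI[of _ length \<gamma>] image_eqI[of _ snd "(A, \<gamma>)"])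
  have c: "c A = rhs R 0 c A" for A
    using fps_const_term.h_rhs[of R fps_X y A] y[of A] by (simp add: c_def[abs_def])
  have sval0: "sval fps_X y s $ 0 = sval 0 c s" for s by (cases s) (auto simp: c_def)
  have rank': "\<rho> B < \<rho> A" if "(A, \<alpha> @ NT B # \<beta>) \<in> R"
      "prod_list (map (sval 0 c) \<alpha>) * prod_list (map (sval 0 c) \<beta>) \<noteq> 0" for A \<alpha> B \<beta>
    using rank[OF that(1)] that(2) by (simp add: sval0)
  have D2: "D \<ge> 2" by (simp add: D_def)
  interpret base: contraction c "\<lambda>A d. d * r + \<rho> A" "perturbed R c (\<lambda>_. 0) D"
    by (rule perturbed_contraction[OF c D2 \<rho> rank'])
  have cp: "[:c A:] = rhs R 0 (\<lambda>A. [:c A:]) A" for A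
    using poly_const.h_rhs[of R 0 c A] c[of A] by simp
  have prod_const: "prod_list (map (sval 0 (\<lambda>A. [:c A:])) \<alpha>) = [:prod_list (map (sval 0 c) \<alpha>):]" for \<alpha> :: "('n, 'b) csym list"
    using poly_const.h_sval[of 0 c \<alpha>] by simp
  interpret eps: contraction "\<lambda>A. [:c A:]" "\<lambda>A d. d * r + \<rho> A" "perturbed R (\<lambda>A. [:c A:]) e D"
  proof (rule perturbed_contraction[OF cp D2 \<rho>])
    show "\<rho> B < \<rho> A" if "(A, \<alpha> @ NT B # \<beta>) \<in> R"
      "prod_list (map (sval 0 (\<lambda>A. [:c A:])) \<alpha>) * prod_list (map (sval 0 (\<lambda>A. [:c A:])) \<beta>) \<noteq> 0" for A \<alpha> B \<beta>
      using that by (intro rank'[of A \<alpha> B \<beta>]) (auto simp: prod_const)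
  qed
  obtain Y where Y0: "\<And>A. Y A $ 0 = [:c A:]" and Y: "\<And>A. perturbed R (\<lambda>A. [:c A:]) e D Y A = Y A"
    using eps.fixed_point_exists by blast
  \<comment> \<open>The specialization at \<open>\<epsilon> = 0\<close> solves the unperturbed system, whose solution is unique.\<close>
  have spec: "eps_coeff 0 (Y A) = y A" for A
  proof (rule base.fixed_point_unique)
    show "eps_coeff 0 (Y A) $ 0 = c A" for A by (simp add: eps_coeff_def Y0)
    show "y A $ 0 = c A" for A by (simp add: c_def)
    show "perturbed R c (\<lambda>_. 0) D y A = y A" for A by (simp add: perturbed_def y[symmetric])
    show "perturbed R c (\<lambda>_. 0) D (\<lambda>A. eps_coeff 0 (Y A)) A = eps_coeff 0 (Y A)" for A
    proof -
      have X: "eps_coeff 0 fps_X = (fps_X :: 'k fps)" by (rule fps_ext) (simp add: eps_coeff_def fps_X_def)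
      have e0: "eps_coeff 0 (fps_const (e A)) = 0" by (rule fps_ext) (simp add: eps_coeff_def e_def)
      have "eps_coeff 0 (Y A) = eps_coeff 0 (perturbed R (\<lambda>A. [:c A:]) e D Y A)" by (simp add: Y)
      also have "\<dots> = rhs R fps_X (\<lambda>A. eps_coeff 0 (Y A)) A"
        by (simp add: perturbed_def eps_zero.h_add eps_zero.h_mult e0 eps_zero.h_rhs X)
      finally show ?thesis by (simp add: perturbed_def)
    qed
  qed
  define Z where "Z A = Y A - fps_const [:c A:]" for A
  have Y_Z: "Y A = Z A + fps_of_poly [:[:c A:]:]" for A by (simp add: Z_def fps_of_poly_const)
  have outside: "Z A = 0" "c A = 0" "Y A = 0" if "A \<notin> V" for A
  proof -
    have no: "{\<gamma>. (A, \<gamma>) \<in> R} = {}" using that unfolding V_def by force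
    then show "c A = 0" using c[of A] by (simp add: rhs_def)
    moreover show "Y A = 0" using Y[of A] that no by (simp add: perturbed_def rhs_def e_def)
    ultimately show "Z A = 0" by (simp add: Z_def)
  qed
  have Y_expr: "poly_expr fps_of_poly Z (Suc 0) (Y B)" for B
    unfolding Y_Z by (intro poly_expr.add fps_poly.poly_expr_var poly_expr.const)
  have "algebraic_function (eps_coeff 0 (Y S))"
  proof (rule algebraic_if_reducible)
    show "finite V" unfolding V_def using fin by simp
    show "D > 0" by (simp add: D_def)
    show "[:[:0, 1:]:] \<noteq> (0 :: 'k poly poly)" by simp
    show "poly_expr fps_of_poly Z (D - 1) (fps_of_poly [:[:0, 1:]:] * Z A ^ D)" for A
    proof (cases "A \<in> V")
      case False
      then show ?thesis using outside fps_poly.h_0 poly_expr.const[of fps_of_poly Z "D - 1" 0] D2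
        by (simp add: power_0_left)
    next
      case True
      have rhs: "poly_expr fps_of_poly Z (D - 1) (rhs R fps_X Y A)"
        unfolding rhs_def
      proof (rule fps_poly.poly_expr_sum, rule poly_expr_mono[OF fps_poly.poly_expr_prod_list])
        fix \<gamma> :: "('n, 'b) csym list" and s
        show "poly_expr fps_of_poly Z (Suc 0) (sval fps_X Y s)"
          using Y_expr poly_expr.const[of fps_of_poly Z "Suc 0" "[:0, 1:]"] by (cases s) auto
      qed (use len in \<open>auto intro: less_imp_le\<close>)
      have "fps_of_poly [:[:0, 1:]:] * Z A ^ D = Z A + fps_of_poly [:[:c A:]:] + - rhs R fps_X Y A"
        using Y[of A] True unfolding Y_Z[symmetric]
        by (simp add: perturbed_def e_def Z_def fps_of_poly_const algebra_simps)
      also have "poly_expr fps_of_poly Z (D - 1) \<dots>"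
        using D2 by (intro poly_expr.add fps_poly.poly_expr_uminus rhs poly_expr.const
          poly_expr_mono[OF fps_poly.poly_expr_var]) auto
      finally show ?thesis .
    qed
  qed (use outside Y_expr in auto)
  then show ?thesis by (simp add: spec)
qed

section \<open>Generating series of unambiguous grammars\<close>

definition count_series :: "('a \<Rightarrow> nat) \<Rightarrow> 'a set \<Rightarrow> 'f::semiring_1 fps"
  where "count_series f S = Abs_fps (\<lambda>d. of_nat (card {x \<in> S. f x = d}))"

lemma count_series_nth: "count_series f S $ d = of_nat (card {x \<in> S. f x = d})"
  by (simp add: count_series_def)

lemma count_series_empty [simp]: "count_series f {} = 0"
  by (rule fps_ext) (simp add: count_series_nth)

lemma count_series_singleton: "count_series f {x} = (fps_X ^ f x :: 'f::semiring_1 fps)"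
proof (rule fps_ext)
  fix d
  have "{y \<in> {x}. f y = d} = (if f x = d then {x} else {})" by auto
  then show "count_series f {x} $ d = (fps_X ^ f x :: 'f fps) $ d" by (simp add: count_series_nth fps_X_power_nth)
qed

lemma count_series_bij:
  assumes "bij_betw \<phi> S T" "\<And>x. x \<in> S \<Longrightarrow> g (\<phi> x) = f x"
  shows "count_series f S = count_series g T"
proof (rule fps_ext)
  fix d
  have "bij_betw \<phi> {x \<in> S. f x = d} {y \<in> T. g y = d}"
  proof (rule bij_betw_subset[OF assms(1)])
    show "\<phi> ` {x \<in> S. f x = d} = {y \<in> T. g y = d}"
      using assms(2) bij_betw_imp_surj_on[OF assms(1)] by auto
  qed auto
  then show "count_series f S $ d = count_series g T $ d"
    by (simp add: count_series_nth bij_betw_same_card)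
qed

lemma count_series_Un:
  assumes "\<And>d. finite {x \<in> S. f x = d}" "\<And>d. finite {x \<in> T. f x = d}" "S \<inter> T = {}"
  shows "count_series f (S \<union> T) = count_series f S + count_series f T"
proof (rule fps_ext)
  fix d
  have "{x \<in> S \<union> T. f x = d} = {x \<in> S. f x = d} \<union> {x \<in> T. f x = d}" by auto
  moreover have "{x \<in> S. f x = d} \<inter> {x \<in> T. f x = d} = {}" using assms(3) by auto
  ultimately show "count_series f (S \<union> T) $ d = (count_series f S + count_series f T) $ d"
    using assms by (simp add: count_series_nth card_Un_disjoint)
qed

lemma count_series_UN:
  assumes "finite I" "\<And>i d. i \<in> I \<Longrightarrow> finite {x \<in> S i. f x = d}"
    and "\<And>i j. i \<in> I \<Longrightarrow> j \<in> I \<Longrightarrow> i \<noteq> j \<Longrightarrow> S i \<inter> S j = {}"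
  shows "count_series f (\<Union>i\<in>I. S i) = (\<Sum>i\<in>I. count_series f (S i))"
proof (rule fps_ext)
  fix d
  have "{x \<in> \<Union>i\<in>I. S i. f x = d} = (\<Union>i\<in>I. {x \<in> S i. f x = d})" by auto
  moreover have "card (\<Union>i\<in>I. {x \<in> S i. f x = d}) = (\<Sum>i\<in>I. card {x \<in> S i. f x = d})"
    using assms by (intro card_UN_disjoint) (auto, blast)
  ultimately show "count_series f (\<Union>i\<in>I. S i) $ d = (\<Sum>i\<in>I. count_series f (S i)) $ d"
    by (simp add: count_series_nth fps_sum_nth)
qed

lemma count_series_Times:
  assumes S: "\<And>d. finite {x \<in> S. f x = d}" and T: "\<And>d. finite {y \<in> T. g y = d}"
  shows "count_series (\<lambda>(x, y). f x + g y) (S \<times> T) = count_series f S * count_series g T"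
proof (rule fps_ext)
  fix d
  have "{p \<in> S \<times> T. (\<lambda>(x, y). f x + g y) p = d} =
      (\<Union>i\<in>{0..d}. {x \<in> S. f x = i} \<times> {y \<in> T. g y = d - i})" by auto
  moreover have "card (\<Union>i\<in>{0..d}. {x \<in> S. f x = i} \<times> {y \<in> T. g y = d - i}) =
      (\<Sum>i\<in>{0..d}. card ({x \<in> S. f x = i} \<times> {y \<in> T. g y = d - i}))"
    using S T by (intro card_UN_disjoint) auto
  ultimately show "count_series (\<lambda>(x, y). f x + g y) (S \<times> T) $ d =
      (count_series f S * count_series g T) $ d"
    by (simp add: count_series_nth fps_mult_nth card_cartesian_product)
qed

lemma finite_words_of_length: "finite {w \<in> L. length w = d}" for L :: "'x::finite list set"
  by (rule finite_subset[OF _ finite_lists_length_eq[of UNIV d]]) auto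

text \<open>
  A leftmost derivation, run as a stack machine: the leftmost symbol is either matched with the input
  or expanded, and the productions used are recorded in order. Unlike the list of sentential forms, this
  record is compatible with concatenation of sentential forms.
\<close>
inductive parse :: "('n \<times> ('n, 't) csym list) set \<Rightarrow> ('n, 't) csym list \<Rightarrow>
    ('n \<times> ('n, 't) csym list) list \<Rightarrow> 't list \<Rightarrow> bool"
  for P where
  Nil: "parse P [] [] []"
| Tm: "parse P \<alpha> \<pi> w \<Longrightarrow> parse P (Tm a # \<alpha>) \<pi> (a # w)"
| NT: "(A, \<gamma>) \<in> P \<Longrightarrow> parse P (\<gamma> @ \<alpha>) \<pi> w \<Longrightarrow> parse P (NT A # \<alpha>) ((A, \<gamma>) # \<pi>) w"

inductive_simps parse_Nil [simp]: "parse P [] \<pi> w"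
inductive_simps parse_Tm: "parse P (Tm a # \<alpha>) \<pi> w"
inductive_simps parse_NT: "parse P (NT A # \<alpha>) \<pi> w"

lemma parse_append:
  "parse P \<alpha> \<pi> v \<Longrightarrow> parse P \<beta> \<rho> w \<Longrightarrow> parse P (\<alpha> @ \<beta>) (\<pi> @ \<rho>) (v @ w)"
proof (induction rule: parse.induct)
  case (Tm \<alpha> \<pi> v a)
  then show ?case by (simp add: parse.Tm)
next
  case (NT A \<gamma> \<alpha> \<pi> v)
  then show ?case using parse.NT[OF NT.hyps(1), of "\<alpha> @ \<beta>" "\<pi> @ \<rho>"] by simp
qed simp

lemma parse_appendE:
  assumes "parse P (\<alpha> @ \<beta>) \<pi> w"
  obtains \<pi>1 \<pi>2 w1 w2 where "\<pi> = \<pi>1 @ \<pi>2" "w = w1 @ w2" "parse P \<alpha> \<pi>1 w1" "parse P \<beta> \<pi>2 w2"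
proof -
  have "\<exists>\<pi>1 \<pi>2 w1 w2. \<pi> = \<pi>1 @ \<pi>2 \<and> w = w1 @ w2 \<and> parse P \<alpha> \<pi>1 w1 \<and> parse P \<beta> \<pi>2 w2"
    using assms
  proof (induction "\<alpha> @ \<beta>" \<pi> w arbitrary: \<alpha> rule: parse.induct)
    case Nil
    then show ?case by auto
  next
    case (Tm \<delta> \<pi> w a)
    show ?case
    proof (cases \<alpha>)
      case Nil
      with Tm show ?thesis by (intro exI[of _ "[]"] exI[of _ \<pi>] exI[of _ "a # w"]) (auto simp: parse_Tm)
    next
      case (Cons s \<alpha>')
      with Tm obtain \<pi>1 \<pi>2 w1 w2 where "\<pi> = \<pi>1 @ \<pi>2" "w = w1 @ w2" "parse P \<alpha>' \<pi>1 w1" "parse P \<beta> \<pi>2 w2"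
        by (metis Tm.hyps(2) append_Cons list.inject)
      then show ?thesis using Cons Tm.hyps(3)
        by (intro exI[of _ \<pi>1] exI[of _ \<pi>2] exI[of _ "a # w1"] exI[of _ w2]) (auto intro: parse.Tm)
    qed
  next
    case (NT A \<gamma> \<delta> \<pi> w)
    show ?case
    proof (cases \<alpha>)
      case Nil
      with NT show ?thesis
        by (intro exI[of _ "[]"] exI[of _ "(A, \<gamma>) # \<pi>"] exI[of _ "[]"] exI[of _ w]) (auto simp: parse_NT)
    next
      case (Cons s \<alpha>')
      then have "\<gamma> @ \<delta> = (\<gamma> @ \<alpha>') @ \<beta>" using NT.hyps(4) by simp
      from NT.hyps(3)[OF this] obtain \<pi>1 \<pi>2 w1 w2 where
        "\<pi> = \<pi>1 @ \<pi>2" "w = w1 @ w2" "parse P (\<gamma> @ \<alpha>') \<pi>1 w1" "parse P \<beta> \<pi>2 w2" by blast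
      then show ?thesis using Cons NT.hyps(1,4)
        by (intro exI[of _ "(A, \<gamma>) # \<pi>1"] exI[of _ \<pi>2] exI[of _ w1] exI[of _ w2]) (auto intro: parse.NT)
    qed
  qed
  then show thesis using that by blast
qed

lemma parse_single:
  assumes "(A, \<gamma>) \<in> P" "parse P \<gamma> \<pi> w"
  shows "parse P [NT A] ((A, \<gamma>) # \<pi>) w"
  using parse.NT[OF assms(1), of "[]" \<pi> w] assms(2) by simp

text \<open>
  The record of a run determines where the run ends, since the machine stops as soon as its stack is
  empty. Hence concatenated records can be split in only one way.
\<close>
lemma parse_prefix_free:
  assumes "parse P \<alpha> \<pi> w" "parse P \<alpha> \<pi>' w'" "\<pi> @ \<rho> = \<pi>' @ \<rho>'"
  shows "\<pi> = \<pi>' \<and> w = w'"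
  using assms
proof (induction arbitrary: \<pi>' w' rule: parse.induct)
  case Nil
  then show ?case by simp
next
  case (Tm \<alpha> \<pi> w a)
  from Tm.prems(1) obtain v where v: "w' = a # v" "parse P \<alpha> \<pi>' v" by (auto simp: parse_Tm)
  show ?case using Tm.IH[OF v(2) Tm.prems(2)] v(1) by simp
next
  case (NT A \<gamma> \<alpha> \<pi> w)
  from NT.prems(1) obtain \<gamma>' \<sigma> where \<sigma>: "\<pi>' = (A, \<gamma>') # \<sigma>" "parse P (\<gamma>' @ \<alpha>) \<sigma> w'"
    by (auto simp: parse_NT)
  with NT.prems(2) have "\<gamma>' = \<gamma>" "\<pi> @ \<rho> = \<sigma> @ \<rho>'" by simp_all
  with NT.IH[of \<sigma> w'] \<sigma> show ?case by simp
qed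

lemma parse_terminals: "parse P (map Tm w) [] w"
  by (induction w) (auto intro: parse.intros)

definition yield_language :: "('n \<times> ('n, 't) csym list) set \<Rightarrow> ('n, 't) csym list \<Rightarrow> 't list set"
  where "yield_language P \<alpha> = {w. \<exists>\<pi>. parse P \<alpha> \<pi> w}"

definition unique_parse :: "('n \<times> ('n, 't) csym list) set \<Rightarrow> ('n, 't) csym list \<Rightarrow> bool"
  where "unique_parse P \<alpha> \<longleftrightarrow> (\<forall>w \<pi> \<pi>'. parse P \<alpha> \<pi> w \<longrightarrow> parse P \<alpha> \<pi>' w \<longrightarrow> \<pi> = \<pi>')"

lemma unique_parseD: "unique_parse P \<alpha> \<Longrightarrow> parse P \<alpha> \<pi> w \<Longrightarrow> parse P \<alpha> \<pi>' w \<Longrightarrow> \<pi> = \<pi>'"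
  by (simp add: unique_parse_def)

lemma unique_parse_append_left:
  assumes "unique_parse P (\<alpha> @ \<beta>)" "yield_language P \<beta> \<noteq> {}"
  shows "unique_parse P \<alpha>"
  unfolding unique_parse_def
proof (intro allI impI)
  fix w \<pi> \<pi>' assume "parse P \<alpha> \<pi> w" "parse P \<alpha> \<pi>' w"
  moreover obtain \<rho> v where "parse P \<beta> \<rho> v" using assms(2) by (auto simp: yield_language_def)
  ultimately have "parse P (\<alpha> @ \<beta>) (\<pi> @ \<rho>) (w @ v)" "parse P (\<alpha> @ \<beta>) (\<pi>' @ \<rho>) (w @ v)"
    by (simp_all add: parse_append)
  then have "\<pi> @ \<rho> = \<pi>' @ \<rho>" by (rule unique_parseD[OF assms(1)])
  then show "\<pi> = \<pi>'" by simp
qed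

lemma unique_parse_append_right:
  assumes "unique_parse P (\<alpha> @ \<beta>)" "yield_language P \<alpha> \<noteq> {}"
  shows "unique_parse P \<beta>"
  unfolding unique_parse_def
proof (intro allI impI)
  fix w \<pi> \<pi>' assume "parse P \<beta> \<pi> w" "parse P \<beta> \<pi>' w"
  moreover obtain \<rho> v where "parse P \<alpha> \<rho> v" using assms(2) by (auto simp: yield_language_def)
  ultimately have "parse P (\<alpha> @ \<beta>) (\<rho> @ \<pi>) (v @ w)" "parse P (\<alpha> @ \<beta>) (\<rho> @ \<pi>') (v @ w)"
    by (simp_all add: parse_append)
  then have "\<rho> @ \<pi> = \<rho> @ \<pi>'" by (rule unique_parseD[OF assms(1)])
  then show "\<pi> = \<pi>'" by simp
qed

lemma unique_parse_production:
  assumes "unique_parse P [NT A]" "(A, \<gamma>) \<in> P"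
  shows "unique_parse P \<gamma>"
  unfolding unique_parse_def
proof (intro allI impI)
  fix w \<pi> \<pi>' assume "parse P \<gamma> \<pi> w" "parse P \<gamma> \<pi>' w"
  then have "parse P [NT A] ((A, \<gamma>) # \<pi>) w" "parse P [NT A] ((A, \<gamma>) # \<pi>') w"
    using assms(2) by (simp_all add: parse_single)
  then show "\<pi> = \<pi>'" using unique_parseD[OF assms(1)] by blast
qed

lemma yield_append:
  "yield_language P (\<alpha> @ \<beta>) = (\<lambda>(v, w). v @ w) ` (yield_language P \<alpha> \<times> yield_language P \<beta>)"
proof (intro equalityI subsetI)
  fix u assume "u \<in> yield_language P (\<alpha> @ \<beta>)"
  then obtain \<pi> where "parse P (\<alpha> @ \<beta>) \<pi> u" by (auto simp: yield_language_def)
  then obtain \<pi>1 \<pi>2 v w where u: "u = v @ w" "parse P \<alpha> \<pi>1 v" "parse P \<beta> \<pi>2 w"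
    by (rule parse_appendE)
  then have "(v, w) \<in> yield_language P \<alpha> \<times> yield_language P \<beta>" by (auto simp: yield_language_def)
  then show "u \<in> (\<lambda>(v, w). v @ w) ` (yield_language P \<alpha> \<times> yield_language P \<beta>)"
    using u(1) by (intro image_eqI[of _ _ "(v, w)"]) simp
next
  fix u assume "u \<in> (\<lambda>(v, w). v @ w) ` (yield_language P \<alpha> \<times> yield_language P \<beta>)"
  then obtain v w where u: "u = v @ w" "v \<in> yield_language P \<alpha>" "w \<in> yield_language P \<beta>"
    by auto
  then obtain \<pi> \<rho> where "parse P \<alpha> \<pi> v" "parse P \<beta> \<rho> w"
    unfolding yield_language_def by blast
  then have "parse P (\<alpha> @ \<beta>) (\<pi> @ \<rho>) u" unfolding u(1) by (rule parse_append)
  then show "u \<in> yield_language P (\<alpha> @ \<beta>)" unfolding yield_language_def by blast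
qed

lemma yield_append_empty:
  "yield_language P (\<alpha> @ \<beta>) = {} \<longleftrightarrow> yield_language P \<alpha> = {} \<or> yield_language P \<beta> = {}"
  unfolding yield_append by auto

lemma yield_NT: "yield_language P [NT A] = (\<Union>\<gamma>\<in>{\<gamma>. (A, \<gamma>) \<in> P}. yield_language P \<gamma>)"
proof (intro equalityI subsetI)
  fix w assume "w \<in> yield_language P [NT A]"
  then obtain \<pi> where "parse P [NT A] \<pi> w" unfolding yield_language_def by blast
  then obtain \<gamma> \<rho> where "(A, \<gamma>) \<in> P" "parse P \<gamma> \<rho> w" by (auto simp: parse_NT)
  then show "w \<in> (\<Union>\<gamma>\<in>{\<gamma>. (A, \<gamma>) \<in> P}. yield_language P \<gamma>)" unfolding yield_language_def by blast
next
  fix w assume "w \<in> (\<Union>\<gamma>\<in>{\<gamma>. (A, \<gamma>) \<in> P}. yield_language P \<gamma>)"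
  then obtain \<gamma> \<rho> where "(A, \<gamma>) \<in> P" "parse P \<gamma> \<rho> w" unfolding yield_language_def by blast
  then have "parse P [NT A] ((A, \<gamma>) # \<rho>) w" by (simp add: parse_NT)
  then show "w \<in> yield_language P [NT A]" unfolding yield_language_def by blast
qed

text \<open>
  Unambiguity makes every factorization unique: two factorizations of a word give two records, these
  agree, and their prefixes agree because records form a prefix code.
\<close>
lemma yield_series_append:
  fixes P :: "('n \<times> ('n, 't::finite) csym list) set"
  assumes U: "unique_parse P (\<alpha> @ \<beta>)"
  shows "count_series length (yield_language P (\<alpha> @ \<beta>)) =
    (count_series length (yield_language P \<alpha>) * count_series length (yield_language P \<beta>) :: 'f::semiring_1 fps)"
proof -
  have "bij_betw (\<lambda>(v, w). v @ w) (yield_language P \<alpha> \<times> yield_language P \<beta>) (yield_language P (\<alpha> @ \<beta>))"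
    unfolding bij_betw_def
  proof
    show "inj_on (\<lambda>(v, w). v @ w) (yield_language P \<alpha> \<times> yield_language P \<beta>)"
    proof (rule inj_onI, clarsimp simp: yield_language_def)
      fix v w v' w' \<pi> \<rho> \<pi>' \<rho>'
      assume "v @ w = v' @ w'" and *: "parse P \<alpha> \<pi> v" "parse P \<beta> \<rho> w" "parse P \<alpha> \<pi>' v'" "parse P \<beta> \<rho>' w'"
      have "parse P (\<alpha> @ \<beta>) (\<pi> @ \<rho>) (v @ w)" "parse P (\<alpha> @ \<beta>) (\<pi>' @ \<rho>') (v @ w)"
        using parse_append[OF *(1,2)] parse_append[OF *(3,4)] \<open>v @ w = v' @ w'\<close> by simp_all
      then have "\<pi> @ \<rho> = \<pi>' @ \<rho>'" by (rule unique_parseD[OF U])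
      then have "v = v'" using parse_prefix_free[OF *(1,3)] by blast
      with \<open>v @ w = v' @ w'\<close> show "v = v' \<and> w = w'" by simp
    qed
    show "(\<lambda>(v, w). v @ w) ` (yield_language P \<alpha> \<times> yield_language P \<beta>) = yield_language P (\<alpha> @ \<beta>)"
      by (rule yield_append[symmetric])
  qed
  then have "count_series length (yield_language P (\<alpha> @ \<beta>)) =
      (count_series (\<lambda>(v, w). length v + length w) (yield_language P \<alpha> \<times> yield_language P \<beta>) :: 'f fps)"
    by (rule count_series_bij[symmetric]) (simp add: split_beta)
  also have "\<dots> = count_series length (yield_language P \<alpha>) * count_series length (yield_language P \<beta>)"
    by (rule count_series_Times) (rule finite_words_of_length)+
  finally show ?thesis .
qed

lemma yield_series_production:
  fixes P :: "('n \<times> ('n, 't::finite) csym list) set"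
  assumes fin: "finite P" and U: "unique_parse P [NT A]"
  shows "count_series length (yield_language P [NT A]) =
    (\<Sum>\<gamma> | (A, \<gamma>) \<in> P. count_series length (yield_language P \<gamma>) :: 'f::semiring_1 fps)"
  unfolding yield_NT
proof (rule count_series_UN)
  have "{\<gamma>. (A, \<gamma>) \<in> P} \<subseteq> snd ` P" by force
  then show "finite {\<gamma>. (A, \<gamma>) \<in> P}" using fin by (auto intro: finite_subset)
  fix \<gamma> \<gamma>' assume \<gamma>: "\<gamma> \<in> {\<gamma>. (A, \<gamma>) \<in> P}" "\<gamma>' \<in> {\<gamma>. (A, \<gamma>) \<in> P}" "\<gamma> \<noteq> \<gamma>'"
  show "yield_language P \<gamma> \<inter> yield_language P \<gamma>' = {}"
  proof (rule ccontr)
    assume "yield_language P \<gamma> \<inter> yield_language P \<gamma>' \<noteq> {}"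
    then obtain w \<pi> \<pi>' where "parse P \<gamma> \<pi> w" "parse P \<gamma>' \<pi>' w" by (auto simp: yield_language_def)
    then have "parse P [NT A] ((A, \<gamma>) # \<pi>) w" "parse P [NT A] ((A, \<gamma>') # \<pi>') w"
      using \<gamma> by (simp_all add: parse_single)
    then show False using unique_parseD[OF U] \<gamma>(3) by blast
  qed
qed (rule finite_words_of_length)

text \<open>
  A production whose right-hand side yields no word contributes nothing to the series and may hide
  ambiguous variables, so it is discarded. The variables of the remaining productions inherit unambiguity.
\<close>
definition useful_prods :: "('n \<times> ('n, 't) csym list) set \<Rightarrow> ('n \<times> ('n, 't) csym list) set"
  where "useful_prods P = {(A, \<gamma>) \<in> P. unique_parse P [NT A] \<and> yield_language P \<gamma> \<noteq> {}}"

lemma useful_prods_decompose: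
  assumes "(A, \<alpha> @ NT B # \<beta>) \<in> useful_prods P"
  shows "unique_parse P [NT B]" "yield_language P \<alpha> \<noteq> {}" "yield_language P [NT B] \<noteq> {}" "yield_language P \<beta> \<noteq> {}"
proof -
  have "yield_language P (\<alpha> @ [NT B] @ \<beta>) \<noteq> {}" using assms by (simp add: useful_prods_def)
  then show *: "yield_language P \<alpha> \<noteq> {}" "yield_language P [NT B] \<noteq> {}" "yield_language P \<beta> \<noteq> {}"
    by (simp_all only: yield_append_empty) auto
  have "unique_parse P (\<alpha> @ [NT B] @ \<beta>)"
    using assms by (auto simp: useful_prods_def intro: unique_parse_production)
  then show "unique_parse P [NT B]" using * by (blast intro: unique_parse_append_left unique_parse_append_right)
qed

text \<open>
  The series of the unambiguous variables solve the system of the useful productions. For the rank,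
  consider a production \<open>A \<rightarrow> \<alpha> B \<beta>\<close> in which \<open>\<alpha>\<close> and \<open>\<beta>\<close> derive the empty word. It turns a derivation
  of a word from \<open>B\<close> into a longer derivation of the same word from \<open>A\<close>. A cycle of such productions would
  give a word with derivations of different lengths, contrary to unambiguity. So the relation is acyclic
  and the number of variables below \<open>A\<close> is a rank.
\<close>
theorem yield_series_algebraic:
  fixes P :: "('n \<times> ('n, 't::finite) csym list) set"
  assumes fin: "finite P" and U: "unique_parse P [NT S]"
  shows "algebraic_function (count_series length (yield_language P [NT S]) :: 'k::field fps)"
proof -
  let ?R = "useful_prods P"
  define y where "y A = (if A \<in> fst ` ?R then count_series length (yield_language P [NT A]) else 0 :: 'k fps)" for A
  have finR: "finite ?R" using fin by (rule rev_finite_subset) (auto simp: useful_prods_def)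
  have yU: "y A = count_series length (yield_language P [NT A])" if "unique_parse P [NT A]" for A
  proof (cases "A \<in> fst ` ?R")
    case False
    then have "yield_language P [NT A] = {}" using that by (force simp: yield_NT useful_prods_def)
    then show ?thesis using False by (simp add: y_def)
  qed (simp add: y_def)
  have word_series: "prod_list (map (sval fps_X y) \<gamma>) = count_series length (yield_language P \<gamma>)"
    if "unique_parse P \<gamma>" "yield_language P \<gamma> \<noteq> {}" for \<gamma>
    using that
  proof (induction \<gamma>)
    case Nil
    have "yield_language P [] = {[]}" by (simp add: yield_language_def)
    then show ?case by (simp add: count_series_singleton)
  next
    case (Cons s \<gamma>)
    have ne: "yield_language P [s] \<noteq> {}" "yield_language P \<gamma> \<noteq> {}"
      using Cons.prems(2) yield_append_empty[of P "[s]" \<gamma>] by simp_all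
    have Us: "unique_parse P [s]" and U\<gamma>: "unique_parse P \<gamma>"
      using Cons.prems(1) ne unique_parse_append_left[of P "[s]" \<gamma>] unique_parse_append_right[of P "[s]" \<gamma>] by simp_all
    have "sval fps_X y s = count_series length (yield_language P [s])"
    proof (cases s)
      case (NT B)
      then show ?thesis using yU Us by simp
    next
      case (Tm a)
      have "yield_language P [Tm a] = {[a]}" by (auto simp: yield_language_def parse_Tm)
      then show ?thesis unfolding Tm by (simp add: count_series_singleton)
    qed
    then show ?case using yield_series_append[of P "[s]" \<gamma>, where 'f = 'k] Cons.prems(1) Cons.IH[OF U\<gamma> ne(2)] by simp
  qed
  have y_system: "y A = rhs ?R fps_X y A" for A
  proof (cases "A \<in> fst ` ?R")
    case False
    then have "(A, \<gamma>) \<notin> ?R" for \<gamma> by (metis fst_conv image_eqI)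
    then show ?thesis using False by (simp add: y_def rhs_def)
  next
    case True
    then have UA: "unique_parse P [NT A]" by (auto simp: useful_prods_def)
    have "{\<gamma>. (A, \<gamma>) \<in> P} \<subseteq> snd ` P" by force
    then have finA: "finite {\<gamma>. (A, \<gamma>) \<in> P}" using fin by (auto intro: finite_subset)
    have "y A = (\<Sum>\<gamma> | (A, \<gamma>) \<in> P. count_series length (yield_language P \<gamma>))"
      using yU[OF UA] yield_series_production[OF fin UA] by simp
    also have "\<dots> = (\<Sum>\<gamma> | (A, \<gamma>) \<in> ?R. count_series length (yield_language P \<gamma>))"
      using finA UA by (intro sum.mono_neutral_right) (auto simp: useful_prods_def)
    also have "\<dots> = rhs ?R fps_X y A"
      unfolding rhs_def using unique_parse_production[OF UA]
      by (intro sum.cong refl word_series[symmetric]) (auto simp: useful_prods_def)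
    finally show ?thesis .
  qed
  have const_nz: "[] \<in> yield_language P \<alpha>" if "prod_list (map (\<lambda>s. sval fps_X y s $ 0) \<alpha>) \<noteq> 0" for \<alpha> :: "('n, 't) csym list"
    using that
  proof (induction \<alpha>)
    case Nil
    then show ?case by (simp add: yield_language_def)
  next
    case (Cons s \<alpha>)
    then have "sval fps_X y s $ 0 \<noteq> 0" and \<alpha>: "[] \<in> yield_language P \<alpha>" by auto
    then obtain B where s: "s = NT B" and "y B $ 0 \<noteq> 0" by (cases s) auto
    then have "count_series length (yield_language P [NT B]) $ 0 \<noteq> (0 :: 'k)" by (auto simp: y_def split: if_splits)
    then have "of_nat (card {w \<in> yield_language P [NT B]. w = []}) \<noteq> (0 :: 'k)"
      by (simp add: count_series_nth)
    then have "{w \<in> yield_language P [NT B]. w = []} \<noteq> {}" by (metis card.empty of_nat_0)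
    then have "[] \<in> yield_language P [NT B]" by simp
    then have "[] @ [] \<in> yield_language P ([NT B] @ \<alpha>)" using \<alpha> \<open>[] \<in> yield_language P [NT B]\<close>
      unfolding yield_append by (intro image_eqI[of _ _ "([], [])"]) auto
    then show ?case using s by simp
  qed
  define nullrel where "nullrel = {(B, A). \<exists>\<alpha> \<beta>. (A, \<alpha> @ NT B # \<beta>) \<in> ?R \<and>
    [] \<in> yield_language P \<alpha> \<and> [] \<in> yield_language P \<beta>}"
  have longer: "\<exists>\<pi>'. parse P [NT A] \<pi>' w \<and> length \<pi> < length \<pi>'" if BA: "(B, A) \<in> nullrel" and \<pi>: "parse P [NT B] \<pi> w" for A B w \<pi>
  proof -
    obtain \<alpha> \<beta> \<sigma> \<tau> where ab: "(A, \<alpha> @ NT B # \<beta>) \<in> ?R" "parse P \<alpha> \<sigma> []" "parse P \<beta> \<tau> []"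
      using BA by (auto simp: nullrel_def yield_language_def)
    have "parse P (\<alpha> @ [NT B] @ \<beta>) (\<sigma> @ \<pi> @ \<tau>) ([] @ w @ [])" by (intro parse_append ab \<pi>)
    then have "parse P [NT A] ((A, \<alpha> @ NT B # \<beta>) # \<sigma> @ \<pi> @ \<tau>) w"
      using ab by (intro parse_single) (auto simp: useful_prods_def)
    then show ?thesis by (intro exI conjI) auto
  qed
  have longer_trancl: "\<exists>\<pi>'. parse P [NT A] \<pi>' w \<and> length \<pi> < length \<pi>'" if "(B, A) \<in> nullrel\<^sup>+" "parse P [NT B] \<pi> w" for A B w \<pi>
    using that
  proof (induction rule: trancl_induct)
    case (base A)
    then show ?case using longer by blast
  next
    case (step A A')
    then obtain \<pi>1 where "parse P [NT A] \<pi>1 w" "length \<pi> < length \<pi>1" by blast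
    moreover from longer[OF step.hyps(2) this(1)] obtain \<pi>2 where "parse P [NT A'] \<pi>2 w" "length \<pi>1 < length \<pi>2"
      by blast
    ultimately show ?case using less_trans by blast
  qed
  have fst_R: "unique_parse P [NT A] \<and> yield_language P [NT A] \<noteq> {}" if BA: "(B, A) \<in> nullrel\<^sup>+" for A B
  proof -
    obtain C where "(C, A) \<in> nullrel" using tranclD2[OF BA] by blast
    then obtain \<gamma> where "(A, \<gamma>) \<in> ?R" by (auto simp: nullrel_def)
    then show ?thesis unfolding yield_NT by (auto simp: useful_prods_def)
  qed
  have acyclic: "(A, A) \<notin> nullrel\<^sup>+" for A
  proof
    assume A: "(A, A) \<in> nullrel\<^sup>+"
    obtain w where "w \<in> yield_language P [NT A]" using fst_R[OF A] by blast
    then obtain \<pi> where \<pi>: "parse P [NT A] \<pi> w" by (auto simp: yield_language_def)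
    then obtain \<pi>' where "parse P [NT A] \<pi>' w" "length \<pi> < length \<pi>'" using longer_trancl[OF A] by blast
    then show False using unique_parseD[OF conjunct1[OF fst_R[OF A]] \<pi>] by auto
  qed
  define below where "below A = {B. (B, A) \<in> nullrel\<^sup>+}" for A
  define V where "V = fst ` ?R"
  have finV: "finite V" using finR by (simp add: V_def)
  have inV: "B \<in> V" if BA: "(B, A) \<in> nullrel" for A B
  proof -
    obtain \<alpha> \<beta> where "(A, \<alpha> @ NT B # \<beta>) \<in> ?R" using BA by (auto simp: nullrel_def)
    note B = useful_prods_decompose(1,3)[OF this]
    then obtain \<gamma> where "(B, \<gamma>) \<in> P" "yield_language P \<gamma> \<noteq> {}" unfolding yield_NT by auto
    with B have "(B, \<gamma>) \<in> ?R" by (simp add: useful_prods_def)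
    then show ?thesis unfolding V_def by (metis fst_conv image_eqI)
  qed
  have below_V: "below A \<subseteq> V" for A
    using inV by (auto simp: below_def dest: tranclD)
  have "algebraic_function (y S)"
  proof (rule algebraic_system[where \<rho> = "\<lambda>A. card (below A)" and r = "Suc (card V)"])
    show "card (below A) < Suc (card V)" for A using card_mono[OF finV below_V[of A]] by simp
    fix A \<alpha> B \<beta>
    assume "(A, \<alpha> @ NT B # \<beta>) \<in> ?R"
      "prod_list (map (\<lambda>s. sval fps_X y s $ 0) \<alpha>) * prod_list (map (\<lambda>s. sval fps_X y s $ 0) \<beta>) \<noteq> 0"
    then have "(B, A) \<in> nullrel" using const_nz by (auto simp: nullrel_def)
    then have "below B \<subset> below A"
      using acyclic[of B] unfolding below_def by (blast intro: trancl_into_trancl)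
    then show "card (below B) < card (below A)"
      using finV below_V by (meson psubset_card_mono rev_finite_subset)
  qed (rule finR, rule y_system)
  then show ?thesis using yU[OF U] by simp
qed

text \<open>
  The sentential forms visited by a run, where \<open>u\<close> is the part of the input matched so far. An
  exhausted record with a variable on the stack is not a run and gets a default value.
\<close>
fun sentential_forms :: "'t list \<Rightarrow> ('n, 't) csym list \<Rightarrow> ('n \<times> ('n, 't) csym list) list \<Rightarrow> ('n, 't) csym list list" where
  "sentential_forms u [] \<pi> = [map Tm u]"
| "sentential_forms u (Tm a # \<alpha>) \<pi> = sentential_forms (u @ [a]) \<alpha> \<pi>"
| "sentential_forms u (NT A # \<alpha>) [] = []"
| "sentential_forms u (NT A # \<alpha>) (p # \<pi>) = (map Tm u @ NT A # \<alpha>) # sentential_forms u (snd p @ \<alpha>) \<pi>"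

lemma sentential_forms_derivation:
  assumes "parse (prods G) \<alpha> \<pi> w"
  shows "sentential_forms u \<alpha> \<pi> \<noteq> [] \<and> hd (sentential_forms u \<alpha> \<pi>) = map Tm u @ \<alpha> \<and>
    last (sentential_forms u \<alpha> \<pi>) = map Tm (u @ w) \<and> successively (leftmost_step G) (sentential_forms u \<alpha> \<pi>)"
  using assms
proof (induction arbitrary: u rule: parse.induct)
  case (Tm \<alpha> \<pi> w a)
  then show ?case using Tm.IH[of "u @ [a]"] by simp
next
  case (NT A \<gamma> \<alpha> \<pi> w)
  have "leftmost_step G (map Tm u @ NT A # \<alpha>) (map Tm u @ \<gamma> @ \<alpha>)"
    unfolding leftmost_step_def using NT.hyps(1) by blast
  then show ?case using NT.IH[of u] by (auto simp: successively_Cons)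
qed simp

lemma sentential_forms_inj:
  assumes "parse P \<alpha> \<pi> w" "parse P \<alpha> \<pi>' w'" "sentential_forms u \<alpha> \<pi> = sentential_forms u \<alpha> \<pi>'"
  shows "\<pi> = \<pi>'"
  using assms
proof (induction arbitrary: u \<pi>' w' rule: parse.induct)
  case (Tm \<alpha> \<pi> w a)
  then show ?case by (auto simp: parse_Tm)
next
  case (NT A \<gamma> \<alpha> \<pi> w)
  from NT.prems(1) obtain \<gamma>' \<sigma> where \<pi>': "\<pi>' = (A, \<gamma>') # \<sigma>" "parse P (\<gamma>' @ \<alpha>) \<sigma> w'"
    by (auto simp: parse_NT)
  have eq: "sentential_forms u (\<gamma> @ \<alpha>) \<pi> = sentential_forms u (\<gamma>' @ \<alpha>) \<sigma>" using NT.prems(2) \<pi>' by simp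
  have hd_eq: "hd (sentential_forms u (\<gamma> @ \<alpha>) \<pi>) = map Tm u @ \<gamma> @ \<alpha>"
    "hd (sentential_forms u (\<gamma>' @ \<alpha>) \<sigma>) = map Tm u @ \<gamma>' @ \<alpha>"
    using sentential_forms_derivation[of "\<lparr>start = A, prods = P\<rparr>"] NT.hyps(2) \<pi>'(2) by auto
  then have "\<gamma> = \<gamma>'" using eq by simp
  then show ?case using NT.IH \<pi>' eq by simp
qed simp

text \<open>
  A derivation step in an arbitrary position is absorbed into a run, because a run on a concatenation
  splits into runs on the parts.
\<close>
lemma cfg_language_eq_yield: "cfg_language G = yield_language (prods G) [NT (start G)]"
proof
  show "cfg_language G \<subseteq> yield_language (prods G) [NT (start G)]"
  proof
    fix w assume "w \<in> cfg_language G"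
    then have "(derive_step G)\<^sup>*\<^sup>* [NT (start G)] (map Tm w)" by (simp add: cfg_language_def)
    then have "\<exists>\<pi>. parse (prods G) [NT (start G)] \<pi> w"
    proof (induction rule: converse_rtranclp_induct)
      case base
      then show ?case using parse_terminals by blast
    next
      case (step \<alpha> \<beta>)
      then obtain \<mu> A \<nu> \<gamma> \<pi> where *: "(A, \<gamma>) \<in> prods G" "\<alpha> = \<mu> @ NT A # \<nu>" "\<beta> = \<mu> @ \<gamma> @ \<nu>" "parse (prods G) \<beta> \<pi> w"
        by (auto simp: derive_step_def)
      then obtain \<pi>1 \<pi>2 w1 w2 where "w = w1 @ w2" "parse (prods G) \<mu> \<pi>1 w1" "parse (prods G) (\<gamma> @ \<nu>) \<pi>2 w2"
        by (auto elim: parse_appendE)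
      then have "parse (prods G) \<alpha> (\<pi>1 @ (A, \<gamma>) # \<pi>2) w"
        using parse_append[OF _ parse.NT[OF *(1)]] *(2) by blast
      then show ?case by blast
    qed
    then show "w \<in> yield_language (prods G) [NT (start G)]" by (simp add: yield_language_def)
  qed
  show "yield_language (prods G) [NT (start G)] \<subseteq> cfg_language G"
  proof
    fix w assume "w \<in> yield_language (prods G) [NT (start G)]"
    then obtain \<pi> where "parse (prods G) [NT (start G)] \<pi> w" by (auto simp: yield_language_def)
    then have "(derive_step G)\<^sup>*\<^sup>* (map Tm u @ [NT (start G)]) (map Tm (u @ w))" for u
    proof (induction arbitrary: u rule: parse.induct)
      case (Tm \<alpha> \<pi> w a)
      then show ?case using Tm.IH[of "u @ [a]"] by simp
    next
      case (NT A \<gamma> \<alpha> \<pi> w)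
      have "derive_step G (map Tm u @ NT A # \<alpha>) (map Tm u @ \<gamma> @ \<alpha>)"
        unfolding derive_step_def using NT.hyps(1) by blast
      then show ?case using NT.IH[of u] by (rule converse_rtranclp_into_rtranclp)
    qed simp
    from this[of "[]"] show "w \<in> cfg_language G" by (simp add: cfg_language_def)
  qed
qed

lemma unambiguous_cfg_unique_parse:
  assumes "unambiguous_cfg G"
  shows "unique_parse (prods G) [NT (start G)]"
  unfolding unique_parse_def
proof (intro allI impI)
  fix w \<pi> \<pi>'
  assume p: "parse (prods G) [NT (start G)] \<pi> w" "parse (prods G) [NT (start G)] \<pi>' w"
  then have "w \<in> cfg_language G" by (auto simp: cfg_language_eq_yield yield_language_def)
  then have "\<exists>!ds. leftmost_derivation G ds w" using assms by (simp add: unambiguous_cfg_def)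
  moreover have "leftmost_derivation G (sentential_forms [] [NT (start G)] \<pi>) w"
    "leftmost_derivation G (sentential_forms [] [NT (start G)] \<pi>') w"
    using sentential_forms_derivation[OF p(1), of "[]"] sentential_forms_derivation[OF p(2), of "[]"]
    by (simp_all add: leftmost_derivation_def)
  ultimately have "sentential_forms [] [NT (start G)] \<pi> = sentential_forms [] [NT (start G)] \<pi>'" by blast
  then show "\<pi> = \<pi>'" by (rule sentential_forms_inj[OF p])
qed

theorem unambiguous_cfl_algebraic:
  fixes L :: "'t::finite list set"
  assumes "unambiguous_cfl L"
  shows "algebraic_function (count_series length L :: 'k::field fps)"
proof -
  obtain G :: "(nat, 't) cfg" where "finite (prods G)" "unambiguous_cfg G" "cfg_language G = L"
    using assms by (auto simp: unambiguous_cfl_def)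
  then show ?thesis
    using yield_series_algebraic[of "prods G" "start G"] unambiguous_cfg_unique_parse cfg_language_eq_yield by metis
qed

section \<open>The field of algebraic functions\<close>

lemma type_algebra_simps:
  fixes x y :: "'a::ring_1"
  shows "carrier (ring_of_type_algebra :: 'a ring) = UNIV"
    and "\<one>\<^bsub>(ring_of_type_algebra :: 'a ring)\<^esub> = 1" and "\<zero>\<^bsub>(ring_of_type_algebra :: 'a ring)\<^esub> = 0"
    and "x \<otimes>\<^bsub>ring_of_type_algebra\<^esub> y = x * y" and "x \<oplus>\<^bsub>ring_of_type_algebra\<^esub> y = x + y"
  by (simp_all add: ring_of_type_algebra_def)

lemma rational_functions_subfield:
  "subfield (rational_functions :: 'f::field fls set) (ring_of_type_algebra :: 'f fls ring)"
proof -
  interpret L: field "ring_of_type_algebra :: 'f fls ring" by (rule field_from_type_algebra)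
  let ?L = "ring_of_type_algebra :: 'f fls ring"
  let ?c = "\<lambda>p :: 'f poly. fps_to_fls (fps_of_poly p)"
  note L = type_algebra_simps[where 'a = "'f fls"]
  have minus: "\<ominus>\<^bsub>?L\<^esub> x = - x" for x
    by (rule L.minus_equality) (simp_all add: L)
  have inv: "inv\<^bsub>?L\<^esub> x = inverse x" if "x \<noteq> 0" for x
    using that by (intro L.inv_unique'[symmetric]) (simp_all add: L)
  have c0: "?c q \<noteq> 0" if "q \<noteq> 0" for q using that by (simp add: fps_of_poly_eq_iff[of _ 0, simplified])
  have I: "?c p / ?c q \<in> rational_functions" if "q \<noteq> 0" for p q
    using that unfolding rational_functions_def by blast
  have E: "\<exists>p q. x = ?c p / ?c q \<and> q \<noteq> 0" if "x \<in> rational_functions" for x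
    using that unfolding rational_functions_def by blast
  show ?thesis
  proof (rule L.subfieldI', rule L.subringI)
    show "\<one>\<^bsub>?L\<^esub> \<in> rational_functions" using I[of 1 1] by (simp add: L)
  next
    fix x :: "'f fls" assume "x \<in> rational_functions"
    then obtain p q where "x = ?c p / ?c q" "q \<noteq> 0" using E by blast
    then have "- x = ?c (- p) / ?c q" by (simp add: fps_of_poly_uminus)
    then show "\<ominus>\<^bsub>?L\<^esub> x \<in> rational_functions" using I[OF \<open>q \<noteq> 0\<close>] by (simp add: minus)
  next
    fix x y :: "'f fls" assume "x \<in> rational_functions" "y \<in> rational_functions"
    then obtain p q r s where x: "x = ?c p / ?c q" "q \<noteq> 0" and y: "y = ?c r / ?c s" "s \<noteq> 0" using E by blast
    have "x * y = ?c (p * r) / ?c (q * s)"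
      using x y by (simp add: fps_of_poly_mult fls_times_fps_to_fls)
    then show "x \<otimes>\<^bsub>?L\<^esub> y \<in> rational_functions" using I[of "q * s"] x y by (simp add: L)
    have "x + y = ?c (p * s + r * q) / ?c (q * s)"
      using x y c0 by (simp add: fps_of_poly_mult fps_of_poly_add fls_times_fps_to_fls field_simps)
    then show "x \<oplus>\<^bsub>?L\<^esub> y \<in> rational_functions" using I[of "q * s"] x y by (simp add: L)
  next
    fix x :: "'f fls" assume x: "x \<in> rational_functions - {\<zero>\<^bsub>?L\<^esub>}"
    then obtain p q where pq: "x = ?c p / ?c q" "q \<noteq> 0" using E by blast
    then have "inverse x = ?c q / ?c p" "p \<noteq> 0" using x by (auto simp: L)
    then show "inv\<^bsub>?L\<^esub> x \<in> rational_functions" using I[of p q] x by (simp add: inv L)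
  qed (simp add: L)
qed

text \<open>
  In the algebraic theory of rings a polynomial is the list of its coefficients with the leading one
  first.
\<close>
lemma eval_type_algebra:
  "ring.eval (ring_of_type_algebra :: 'f::field fls ring) p x = poly (Poly (rev p)) x"
proof -
  let ?L = "ring_of_type_algebra :: 'f fls ring"
  interpret L: field ?L by (rule field_from_type_algebra)
  have pow: "x [^]\<^bsub>?L\<^esub> (n :: nat) = x ^ n" for n
    by (induction n) (simp_all add: L.nat_pow_Suc ring_of_type_algebra_def nat_pow_def mult.commute)
  show ?thesis
  proof (induction p)
    case Nil
    then show ?case by (simp add: type_algebra_simps)
  next
    case (Cons a p)
    then show ?case by (simp add: Poly_snoc poly_monom pow type_algebra_simps)
  qed
qed

text \<open>
  Being an algebraic function is algebraicity over the subfield of rational functions, so that the field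
  of algebraic elements provides the closure properties.
\<close>
lemma algebraic_function_iff:
  "algebraic_function (f :: 'f::field fps) \<longleftrightarrow>
    (ring.algebraic (ring_of_type_algebra :: 'f fls ring) over rational_functions) (fps_to_fls f)"
proof -
  let ?L = "ring_of_type_algebra :: 'f fls ring"
  let ?K = "rational_functions :: 'f fls set"
  interpret L: field ?L by (rule field_from_type_algebra)
  have K: "subfield ?K ?L" by (rule rational_functions_subfield)
  have K0: "0 \<in> ?K" using subringE(2)[OF subfieldE(1)[OF K]] by (simp add: type_algebra_simps)
  show ?thesis
  proof
    assume "algebraic_function f"
    then obtain P where P: "P \<noteq> 0" "\<And>i. Polynomial.coeff P i \<in> ?K" "poly P (fps_to_fls f) = 0"
      unfolding algebraic_function_def by blast
    have "set (rev (coeffs P)) \<subseteq> ?K" using P(2) by (auto simp: coeffs_def split: if_splits)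
    moreover have "hd (rev (coeffs P)) \<noteq> 0" using P(1) by (simp add: hd_rev last_coeffs_eq_coeff_degree)
    ultimately have "rev (coeffs P) \<in> carrier (?K [X]\<^bsub>?L\<^esub>)"
      unfolding univ_poly_carrier[symmetric] polynomial_def by (simp add: type_algebra_simps)
    moreover have "L.eval (rev (coeffs P)) (fps_to_fls f) = \<zero>\<^bsub>?L\<^esub>"
      unfolding eval_type_algebra using P(3) by (simp add: type_algebra_simps)
    ultimately show "(L.algebraic over ?K) (fps_to_fls f)"
      using P(1) by (intro L.algebraicI[of "rev (coeffs P)"]) auto
  next
    assume "(L.algebraic over ?K) (fps_to_fls f)"
    then obtain p where p: "p \<in> carrier (?K [X]\<^bsub>?L\<^esub>)" "p \<noteq> []" "L.eval p (fps_to_fls f) = \<zero>\<^bsub>?L\<^esub>"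
      using L.algebraicE[OF subfieldE(1)[OF K]] by (metis UNIV_I type_algebra_simps(1))
    then have pK: "set p \<subseteq> ?K" "hd p \<noteq> 0"
      unfolding univ_poly_carrier[symmetric] polynomial_def by (auto simp: type_algebra_simps)
    have coeff: "Polynomial.coeff (Poly (rev p)) i = (if i < length p then rev p ! i else 0)" for i
      by (simp add: coeff_Poly_eq nth_default_def)
    have "Polynomial.coeff (Poly (rev p)) i \<in> ?K" for i
      unfolding coeff using pK K0 nth_mem[of i "rev p"] by auto
    moreover have "Poly (rev p) \<noteq> 0"
    proof
      assume "Poly (rev p) = 0"
      then have "rev p ! (length p - 1) = 0" using coeff[of "length p - 1"] p(2) by simp
      then show False using p(2) pK(2) by (simp add: rev_nth hd_conv_nth)
    qed
    moreover have "poly (Poly (rev p)) (fps_to_fls f) = 0"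
      using p(3) unfolding eval_type_algebra by (simp add: type_algebra_simps)
    ultimately show "algebraic_function f" unfolding algebraic_function_def by blast
  qed
qed

lemma algebraic_function_ops:
  fixes f g :: "'f::field fps"
  shows "algebraic_function (1 :: 'f fps)" "algebraic_function (fps_X :: 'f fps)"
    and "algebraic_function f \<Longrightarrow> algebraic_function (- f)"
    and "algebraic_function f \<Longrightarrow> algebraic_function g \<Longrightarrow> algebraic_function (f + g)"
    and "algebraic_function f \<Longrightarrow> algebraic_function g \<Longrightarrow> algebraic_function (f * g)"
    and "algebraic_function f \<Longrightarrow> g * f = 1 \<Longrightarrow> algebraic_function g"
proof -
  let ?L = "ring_of_type_algebra :: 'f fls ring"
  let ?K = "rational_functions :: 'f fls set"
  interpret L: field ?L by (rule field_from_type_algebra)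
  have K: "subfield ?K ?L" by (rule rational_functions_subfield)
  define S where "S = {x \<in> carrier ?L. (L.algebraic over ?K) x}"
  have S: "subfield S ?L" unfolding S_def by (rule L.subfield_of_algebraics[OF K])
  note subring = subfieldE(1)[OF S]
  have iff: "algebraic_function h \<longleftrightarrow> fps_to_fls h \<in> S" for h :: "'f fps"
    unfolding algebraic_function_iff S_def by (simp add: type_algebra_simps)
  note L = type_algebra_simps[where 'a = "'f fls"]
  have minus: "\<ominus>\<^bsub>?L\<^esub> x = - x" for x
    by (rule L.minus_equality) (simp_all add: L)
  have inv: "inv\<^bsub>?L\<^esub> x = y" if "y * x = 1" for x y
    using that by (intro L.inv_unique'[symmetric]) (simp_all add: L mult.commute)
  show "algebraic_function (1 :: 'f fps)"
    using subringE(3)[OF subring] by (simp add: iff L)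
  show "algebraic_function (fps_X :: 'f fps)"
  proof (rule algebraic_functionI[where N = 1 and p = "\<lambda>i. if i = 0 then - [:0, 1:] else 1" and ?i0.0 = 1])
    show "(\<Sum>i\<le>1. fps_of_poly (if i = 0 then - [:0, 1:] else 1) * fps_X ^ i) = (0 :: 'f fps)"
      by (simp add: fps_of_poly_uminus del: fps_of_poly_fps_X)
  qed auto
  show "algebraic_function f \<Longrightarrow> algebraic_function (- f)"
    using subringE(5)[OF subring, of "fps_to_fls f"] by (simp add: iff minus)
  show "algebraic_function f \<Longrightarrow> algebraic_function g \<Longrightarrow> algebraic_function (f + g)"
    using subringE(7)[OF subring, of "fps_to_fls f" "fps_to_fls g"] by (simp add: iff L)
  show "algebraic_function f \<Longrightarrow> algebraic_function g \<Longrightarrow> algebraic_function (f * g)"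
    using subringE(6)[OF subring, of "fps_to_fls f" "fps_to_fls g"] by (simp add: iff L fls_times_fps_to_fls)
  assume f: "algebraic_function f" and gf: "g * f = 1"
  have "fps_to_fls g * fps_to_fls f = 1" using gf by (simp flip: fls_times_fps_to_fls)
  moreover from this have "fps_to_fls f \<noteq> 0" by (metis mult_zero_right zero_neq_one)
  ultimately show "algebraic_function g"
    using L.subfield_m_inv(1)[OF S, of "fps_to_fls f"] f by (simp add: iff L inv)
qed

section \<open>Normal words and chains\<close>

definition normal_word :: "'x list set \<Rightarrow> 'x list \<Rightarrow> bool"
  where "normal_word L w \<longleftrightarrow> (\<forall>v\<in>L. \<not> sublist v w)"

lemma normal_word_sublist: "normal_word L w \<Longrightarrow> sublist v w \<Longrightarrow> normal_word L v"
  unfolding normal_word_def using sublist_order.order_trans by blast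

text \<open>
  The candidates for extending a chain do not depend on its prefix chain \<open>s\<close>: the word of \<open>L\<close> that
  ends the extended chain starts inside the tail \<open>t\<close>.
\<close>
definition tail_ext :: "'x list set \<Rightarrow> 'x list \<Rightarrow> 'x list set"
  where "tail_ext L t = {u. \<exists>w\<in>L. suffix w (t @ u) \<and> length u < length w}"

definition minimal_ext :: "'x list set \<Rightarrow> 'x list \<Rightarrow> 'x list set"
  where "minimal_ext L t = {u \<in> tail_ext L t. \<not> (\<exists>u1 \<in> tail_ext L t. strict_prefix u1 u)}"

lemma chain_ext_eq_tail_ext: "chain_ext L s t = tail_ext L t"
proof (intro equalityI subsetI)
  fix u assume "u \<in> chain_ext L s t"
  then obtain w v where w: "w \<in> L" "s @ t @ u = v @ w" "length u < length w" "length s \<le> length v"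
    by (auto simp: chain_ext_def)
  then obtain v' where "v = s @ v'" by (metis append_eq_append_conv_if append_take_drop_id)
  then have "t @ u = v' @ w" using w by simp
  then show "u \<in> tail_ext L t" using w by (auto simp: tail_ext_def suffix_def)
next
  fix u assume "u \<in> tail_ext L t"
  then obtain w v' where "w \<in> L" "t @ u = v' @ w" "length u < length w"
    by (auto simp: tail_ext_def suffix_def)
  then show "u \<in> chain_ext L s t" by (auto simp: chain_ext_def intro!: bexI[of _ w] exI[of _ "s @ v'"])
qed

text \<open>
  Pairs of a prefix chain and a tail, starting with the letters, which count as tails of the empty
  chain. With this start all steps, including the one from letters to the words of \<open>L\<close>, follow the same
  rule.
\<close>
definition chain_level :: "'x list set \<Rightarrow> nat \<Rightarrow> ('x list \<times> 'x list) set"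
  where "chain_level L i = (case i of 0 \<Rightarrow> {([], [x]) | x. True} | Suc j \<Rightarrow> chain_splits L j)"

lemma chain_level_0: "chain_level L 0 = {([], [x]) | x. True}"
  by (simp add: chain_level_def)

lemma chain_language_eq: "chain_language L i = (\<lambda>(s, t). s @ t) ` chain_level L i"
proof (cases i)
  case 0
  then show ?thesis by (auto simp: chain_level_def image_iff)
next
  case (Suc j)
  then show ?thesis by (force simp: chain_level_def)
qed

lemma tail_ext_not_normal: "u \<in> tail_ext L t \<Longrightarrow> \<not> normal_word L (t @ u)"
  by (auto simp: tail_ext_def normal_word_def)

context
  fixes L :: "'x list set"
  assumes antichain: "word_antichain L" and length_L: "\<And>w. w \<in> L \<Longrightarrow> 2 \<le> length w"
begin

lemma chain_level_Suc: "chain_level L (Suc i) = {(s @ t, u) | s t u. (s, t) \<in> chain_level L i \<and> u \<in> minimal_ext L t}"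
proof (cases i)
  case 0
  have tail: "tail_ext L [x] = {u. x # u \<in> L}" for x
  proof (intro equalityI subsetI)
    fix u assume "u \<in> tail_ext L [x]"
    then obtain w where w: "w \<in> L" "suffix w (x # u)" "length u < length w" by (auto simp: tail_ext_def)
    then have "w = x # u" by (auto simp: suffix_Cons dest: suffix_length_le)
    then show "u \<in> {u. x # u \<in> L}" using w by simp
  qed (auto simp: tail_ext_def)
  have "minimal_ext L [x] = {u. x # u \<in> L}" for x
  proof -
    have "\<not> strict_prefix u1 u" if "x # u1 \<in> L" "x # u \<in> L" for u1 u
    proof
      assume "strict_prefix u1 u"
      then have "sublist (x # u1) (x # u)" "u1 \<noteq> u" by (auto simp: strict_prefix_def)
      then show False using antichain that by (auto simp: word_antichain_def)
    qed
    then show ?thesis unfolding minimal_ext_def tail by blast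
  qed
  then show ?thesis unfolding 0 by (auto simp: chain_level_def)
next
  case (Suc j)
  then show ?thesis unfolding Suc chain_level_def
    by (simp add: chain_ext_eq_tail_ext minimal_ext_def)
qed

lemma normal_Nil: "normal_word L []" and normal_single: "normal_word L [x]"
  using length_L by (fastforce simp: normal_word_def dest!: sublist_length_le)+

text \<open>
  The shortest prefix \<open>u\<close> of \<open>n\<close> for which \<open>t u\<close> is not normal is a minimal extension: a word of \<open>L\<close>
  in \<open>t u\<close> ends where \<open>u\<close> ends as \<open>u\<close> is shortest, and starts in \<open>t\<close> as \<open>n\<close> is normal.
\<close>
lemma minimal_ext_prefix_exists:
  assumes n: "normal_word L n" and t: "normal_word L t" and tn: "\<not> normal_word L (t @ n)"
  shows "\<exists>u n'. n = u @ n' \<and> u \<in> minimal_ext L t"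
proof -
  define k where "k = (LEAST k. \<not> normal_word L (t @ take k n))"
  have "\<not> normal_word L (t @ take (length n) n)" using tn by simp
  then have k: "\<not> normal_word L (t @ take k n)" unfolding k_def by (rule LeastI)
  have least: "normal_word L (t @ take j n)" if "j < k" for j
    using not_less_Least[of j "\<lambda>k. \<not> normal_word L (t @ take k n)"] that unfolding k_def by blast
  have "k \<noteq> 0" using k t by (metis append_Nil2 take0)
  then obtain k' where k': "k = Suc k'" by (cases k) auto
  define u where "u = take k n"
  obtain w where w: "w \<in> L" "sublist w (t @ u)" using k by (auto simp: normal_word_def u_def)
  have "k' < length n"
  proof (rule ccontr)
    assume "\<not> k' < length n"
    then have "take k n = take k' n" using k' by simp
    then show False using least[of k'] k k' by simp
  qed
  then have u: "t @ u = (t @ take k' n) @ [n ! k']" by (simp add: u_def k' take_Suc_conv_app_nth)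
  have "\<not> sublist w (t @ take k' n)" using least[of k'] w(1) k' by (auto simp: normal_word_def)
  have suf: "suffix w (t @ u)"
  proof -
    obtain p q where pq: "(t @ take k' n) @ [n ! k'] = p @ w @ q" using w(2) unfolding u sublist_def by blast
    show ?thesis
    proof (cases q rule: rev_cases)
      case Nil
      then show ?thesis unfolding u pq by (simp add: suffix_def)
    next
      case (snoc q' y)
      then have "t @ take k' n = p @ w @ q'" using pq by simp
      then have "sublist w (t @ take k' n)" unfolding sublist_def by blast
      then show ?thesis using \<open>\<not> sublist w (t @ take k' n)\<close> by contradiction
    qed
  qed
  have "length u < length w"
  proof (rule ccontr)
    assume "\<not> length u < length w"
    then have "suffix w u" using suf suffix_length_suffix[of w "t @ u" u] by (simp add: suffixI)
    then have "sublist w n" unfolding u_def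
      using suffix_imp_sublist prefix_imp_sublist take_is_prefix sublist_order.order_trans by blast
    then show False using n w(1) by (auto simp: normal_word_def)
  qed
  then have "u \<in> tail_ext L t" using w suf by (auto simp: tail_ext_def)
  moreover have "\<not> strict_prefix u1 u" if "u1 \<in> tail_ext L t" for u1
  proof
    assume "strict_prefix u1 u"
    then obtain r where r: "u = u1 @ r" "r \<noteq> []" by (auto simp: strict_prefix_def prefix_def)
    then have "length u1 < length u" by simp
    then have "length u1 < k" by (simp add: u_def)
    moreover have "u1 = take (length u1) n"
      using r(1) \<open>length u1 < k\<close> unfolding u_def by (metis append_eq_conv_conj min.absorb1 less_imp_le take_take)
    ultimately have "normal_word L (t @ u1)" using least by metis
    then show False using tail_ext_not_normal[OF that] by simp
  qed
  ultimately show ?thesis by (intro exI[of _ u] exI[of _ "drop k n"]) (auto simp: minimal_ext_def u_def)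
qed

text \<open>
  The extension \<open>u\<close> is a proper suffix of a word of \<open>L\<close>, and proper subwords of words of an antichain
  are normal.
\<close>
lemma minimal_ext_normal: "u \<in> minimal_ext L t \<Longrightarrow> normal_word L u"
  unfolding normal_word_def
proof (intro ballI notI)
  fix v assume u: "u \<in> minimal_ext L t" and v: "v \<in> L" "sublist v u"
  then obtain w where w: "w \<in> L" "suffix w (t @ u)" "length u < length w"
    by (auto simp: minimal_ext_def tail_ext_def)
  then have "suffix u w" using suffix_length_suffix[of u "t @ u" w] by (simp add: suffixI)
  then have "sublist v w" using v suffix_imp_sublist sublist_order.order_trans by blast
  then have "v = w" using antichain v w by (auto simp: word_antichain_def)
  then show False using v(2) w(3) sublist_length_le by fastforce
qed

lemma minimal_ext_strict_prefix_normal: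
  assumes u: "u \<in> minimal_ext L t" and t: "normal_word L t" and u1: "strict_prefix u1 u"
  shows "normal_word L (t @ u1)"
proof (rule ccontr)
  assume not: "\<not> normal_word L (t @ u1)"
  have "normal_word L u1"
    using minimal_ext_normal[OF u] normal_word_sublist u1 by (auto simp: strict_prefix_def)
  then obtain u2 n' where "u1 = u2 @ n'" "u2 \<in> minimal_ext L t" using minimal_ext_prefix_exists t not by blast
  then have "u2 \<in> tail_ext L t" "prefix u2 u1" by (simp_all add: minimal_ext_def)
  moreover have "strict_prefix u2 u" using \<open>prefix u2 u1\<close> u1 by (rule prefix_order.le_less_trans)
  ultimately show False using u by (auto simp: minimal_ext_def)
qed

lemma minimal_ext_prefix_free:
  assumes "u \<in> minimal_ext L t" "u' \<in> minimal_ext L t" "u @ r = u' @ r'"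
  shows "u = u'"
proof -
  have "prefix u u' \<or> prefix u' u" using assms(3) by (metis prefix_same_cases prefixI)
  then show ?thesis using assms(1,2) by (auto simp: minimal_ext_def strict_prefix_def)
qed

lemma chain_level_tail_normal: "(s, t) \<in> chain_level L i \<Longrightarrow> normal_word L t"
proof (induction i)
  case 0
  then show ?case using normal_single by (auto simp: chain_level_0)
next
  case (Suc i)
  then show ?case using minimal_ext_normal by (auto simp: chain_level_Suc)
qed

text \<open>
  Chains of a fixed level form a prefix code, since two minimal extensions of one tail are not prefixes
  of each other. In particular, a chain determines its prefix chain and its tail.
\<close>
lemma chain_level_prefix_free:
  "(s, t) \<in> chain_level L i \<Longrightarrow> (s', t') \<in> chain_level L i \<Longrightarrow> s @ t @ r = s' @ t' @ r' \<Longrightarrow> s = s' \<and> t = t'"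
proof (induction i arbitrary: s t s' t' r r')
  case 0
  then show ?case by (auto simp: chain_level_0)
next
  case (Suc i)
  from Suc.prems(1) obtain a b where ab: "s = a @ b" "(a, b) \<in> chain_level L i" "t \<in> minimal_ext L b"
    by (auto simp: chain_level_Suc)
  from Suc.prems(2) obtain a' b' where ab': "s' = a' @ b'" "(a', b') \<in> chain_level L i" "t' \<in> minimal_ext L b'"
    by (auto simp: chain_level_Suc)
  have "a = a' \<and> b = b'"
    using Suc.IH[OF ab(2) ab'(2), of "t @ r" "t' @ r'"] Suc.prems(3) ab(1) ab'(1) by simp
  then show ?case using minimal_ext_prefix_free[of t b t' r r'] ab ab' Suc.prems(3) by simp
qed

end

lemma finite_word_triples:
  fixes T :: "(('x::finite list \<times> 'x list) \<times> 'x list) set"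
  shows "finite {p \<in> T. (\<lambda>((s, t), n). length s + length t + length n) p = d}"
proof (rule finite_subset)
  let ?W = "{w :: 'x list. set w \<subseteq> UNIV \<and> length w \<le> d}"
  show "{p \<in> T. (\<lambda>((s, t), n). length s + length t + length n) p = d} \<subseteq> (?W \<times> ?W) \<times> ?W" by auto
  show "finite ((?W \<times> ?W) \<times> ?W)" by (intro finite_cartesian_product finite_lists_length_le) auto
qed

text \<open>
  Let \<open>G i\<close> and \<open>B i\<close> be the sets of pairs of a chain of level \<open>i\<close> and a normal word \<open>n\<close> for which the
  product of the tail with \<open>n\<close> is normal, respectively not normal. Cutting the minimal extension off
  \<open>n\<close> identifies \<open>B i\<close> with \<open>G (i + 1)\<close>, and \<open>G 0\<close> is the set of non-empty normal words. The
  alternating sum of the equations \<open>c i * H = B i + G i\<close> telescopes.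
\<close>
theorem normal_series_relation:
  fixes L :: "'x::finite list set"
  assumes "word_antichain L" "\<And>w. w \<in> L \<Longrightarrow> 2 \<le> length w" and K: "chain_level L K = {}"
  shows "count_series length {w. normal_word L w} *
    (1 - (\<Sum>i<K. (- 1) ^ i * count_series length (chain_language L i))) = (1 :: 'f::comm_ring_1 fps)"
proof -
  note ctx = assms(1,2)
  let ?N = "{w. normal_word L w}"
  let ?wt = "\<lambda>((s, t), n). length s + length t + length (n :: 'x list)"
  define H where "H = (count_series length ?N :: 'f fps)"
  define c where "c i = (count_series length (chain_language L i) :: 'f fps)" for i
  define G where "G i = {((s, t), n). (s, t) \<in> chain_level L i \<and> normal_word L n \<and> normal_word L (t @ n)}" for i
  define B where "B i = {((s, t), n). (s, t) \<in> chain_level L i \<and> normal_word L n \<and> \<not> normal_word L (t @ n)}" for i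
  define g where "g i = (count_series ?wt (G i) :: 'f fps)" for i
  have c: "c i = count_series (\<lambda>(s, t). length s + length t) (chain_level L i)" for i
    unfolding c_def
  proof (rule count_series_bij[symmetric])
    show "bij_betw (\<lambda>(s, t). s @ t) (chain_level L i) (chain_language L i)"
      unfolding chain_language_eq
    proof (rule inj_on_imp_bij_betw, rule inj_onI, clarify)
      fix s t s' t' assume "(s, t) \<in> chain_level L i" "(s', t') \<in> chain_level L i" "s @ t = s' @ t'"
      then show "s = s' \<and> t = t'" using chain_level_prefix_free[OF ctx, of s t i s' t' "[]" "[]"] by simp
    qed
  qed auto
  have fin_pairs: "finite {p \<in> chain_level L i. (\<lambda>(s, t). length s + length t) p = d}" for i d
  proof (rule finite_subset)
    let ?W = "{w :: 'x list. set w \<subseteq> UNIV \<and> length w \<le> d}"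
    show "{p \<in> chain_level L i. (\<lambda>(s, t). length s + length t) p = d} \<subseteq> ?W \<times> ?W" by auto
    show "finite (?W \<times> ?W)" by (intro finite_cartesian_product finite_lists_length_le) auto
  qed
  have cH: "c i * H = count_series ?wt (B i) + g i" for i
  proof -
    have "c i * H = count_series (\<lambda>(p, n). (\<lambda>(s, t). length s + length t) p + length n) (chain_level L i \<times> ?N)"
      unfolding c H_def by (rule count_series_Times[symmetric]) (rule fin_pairs finite_words_of_length)+
    also have "chain_level L i \<times> ?N = B i \<union> G i" by (auto simp: B_def G_def)
    also have "(\<lambda>(p, n). (\<lambda>(s, t). length s + length t) p + length n) = ?wt" by (auto simp: fun_eq_iff)
    also have "count_series ?wt (B i \<union> G i) = count_series ?wt (B i) + g i"
      unfolding g_def by (rule count_series_Un) ((rule finite_word_triples)+, auto simp: B_def G_def)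
    finally show ?thesis .
  qed
  have Bg: "count_series ?wt (B i) = g (Suc i)" for i
  proof -
    \<comment> \<open>Both sets are images of the set of all data \<open>(s, t, u, n)\<close>: as \<open>(s, t, u n)\<close> and as \<open>(s t, u, n)\<close>.\<close>
    define E where "E = {((s, t), (u, n)). (s, t) \<in> chain_level L i \<and> u \<in> minimal_ext L t \<and> normal_word L n \<and> normal_word L (u @ n)}"
    let ?wE = "\<lambda>((s, t), (u, n)). length s + length t + length u + length (n :: 'x list)"
    have "count_series ?wE E = (count_series ?wt (B i) :: 'f fps)"
    proof (rule count_series_bij)
      show "bij_betw (\<lambda>((s, t), (u, n)). ((s, t), u @ n)) E (B i)"
        unfolding bij_betw_def
      proof
        show "inj_on (\<lambda>((s, t), (u, n)). ((s, t), u @ n)) E"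
        proof (rule inj_onI, clarsimp simp: E_def)
          fix s t u n u' n'
          assume "u \<in> minimal_ext L t" "u' \<in> minimal_ext L t" "u @ n = u' @ n'"
          then show "u = u' \<and> n = n'" using minimal_ext_prefix_free[OF ctx, of u t u' n n'] by simp
        qed
        show "(\<lambda>((s, t), (u, n)). ((s, t), u @ n)) ` E = B i"
        proof (intro equalityI subsetI)
          fix p assume "p \<in> (\<lambda>((s, t), (u, n)). ((s, t), u @ n)) ` E"
          then obtain s t u n where p: "p = ((s, t), u @ n)" "(s, t) \<in> chain_level L i" "u \<in> minimal_ext L t"
            "normal_word L (u @ n)" by (auto simp: E_def)
          then have "\<not> normal_word L (t @ u)" using tail_ext_not_normal by (auto simp: minimal_ext_def)
          then have "\<not> normal_word L (t @ u @ n)"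
            using normal_word_sublist[of L "t @ u @ n" "t @ u"] sublist_appendI[of "t @ u" "[]" n] by auto
          then show "p \<in> B i" using p by (simp add: B_def)
        next
          fix p assume "p \<in> B i"
          then obtain s t n where p: "p = ((s, t), n)" "(s, t) \<in> chain_level L i" "normal_word L n" "\<not> normal_word L (t @ n)"
            by (auto simp: B_def)
          then obtain u n' where u: "n = u @ n'" "u \<in> minimal_ext L t"
            using minimal_ext_prefix_exists[OF ctx, of n t] chain_level_tail_normal[OF ctx] by blast
          then have "normal_word L n'"
            using normal_word_sublist[OF p(3), of n'] sublist_appendI[of n' u "[]"] by simp
          then have "((s, t), (u, n')) \<in> E" using p u by (simp add: E_def)
          then show "p \<in> (\<lambda>((s, t), (u, n)). ((s, t), u @ n)) ` E" using p u by (force intro: image_eqI)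
        qed
      qed
    qed auto
    moreover have "count_series ?wE E = (count_series ?wt (G (Suc i)) :: 'f fps)"
    proof (rule count_series_bij)
      show "bij_betw (\<lambda>((s, t), (u, n)). ((s @ t, u), n)) E (G (Suc i))"
        unfolding bij_betw_def
      proof
        show "inj_on (\<lambda>((s, t), (u, n)). ((s @ t, u), n)) E"
        proof (rule inj_onI, clarsimp simp: E_def)
          fix s t s' t'
          assume "(s, t) \<in> chain_level L i" "(s', t') \<in> chain_level L i" "s @ t = s' @ t'"
          then show "s = s' \<and> t = t'" using chain_level_prefix_free[OF ctx, of s t i s' t' "[]" "[]"] by simp
        qed
        show "(\<lambda>((s, t), (u, n)). ((s @ t, u), n)) ` E = G (Suc i)"
        proof -
          have "chain_level L (Suc i) = {(s @ t, u) | s t u. (s, t) \<in> chain_level L i \<and> u \<in> minimal_ext L t}"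
            by (rule chain_level_Suc[OF ctx])
          then show ?thesis unfolding G_def E_def by (auto simp: image_iff) blast+
        qed
      qed
    qed auto
    ultimately show ?thesis by (simp add: g_def)
  qed
  have H0: "H = 1 + g 0"
  proof -
    have N: "?N = {[]} \<union> {w \<in> ?N. w \<noteq> []}" using normal_Nil[OF ctx] by auto
    have "count_series length ({[]} \<union> {w \<in> ?N. w \<noteq> []}) =
        (count_series length {[] :: 'x list} + count_series length {w \<in> ?N. w \<noteq> []} :: 'f fps)"
      by (rule count_series_Un) ((rule finite_words_of_length)+, auto)
    then have "H = count_series length {[] :: 'x list} + count_series length {w \<in> ?N. w \<noteq> []}"
      unfolding H_def N[symmetric] .
    moreover have "count_series length {w \<in> ?N. w \<noteq> []} = g 0"
      unfolding g_def
    proof (rule count_series_bij[symmetric])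
      show "bij_betw (\<lambda>((s, t), n). t @ n) (G 0) {w \<in> ?N. w \<noteq> []}"
        unfolding bij_betw_def
      proof
        show "inj_on (\<lambda>((s, t), n). t @ n) (G 0)" by (auto simp: inj_on_def G_def chain_level_0)
        show "(\<lambda>((s, t), n). t @ n) ` G 0 = {w \<in> ?N. w \<noteq> []}"
        proof (intro equalityI subsetI)
          fix w assume w: "w \<in> {w \<in> ?N. w \<noteq> []}"
          then obtain x n where xn: "w = [x] @ n" by (cases w) auto
          then have "normal_word L n"
            using w normal_word_sublist[of L w n] sublist_appendI[of n "[x]" "[]"] by simp
          then have "(([], [x]), n) \<in> G 0" using w xn by (simp add: G_def chain_level_0)
          then show "w \<in> (\<lambda>((s, t), n). t @ n) ` G 0" using xn by (force intro: image_eqI)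
        qed (auto simp: G_def chain_level_0)
      qed
    qed (auto simp: G_def chain_level_0)
    ultimately show ?thesis by (simp add: count_series_singleton)
  qed
  have expand: "H = 1 + (\<Sum>i<k. (- 1) ^ i * c i) * H + (- 1) ^ k * g k" for k
  proof (induction k)
    case (Suc k)
    have gk: "g k = c k * H - g (Suc k)" using cH[of k] Bg[of k] by simp
    show ?case using Suc by (subst (asm) gk) (simp add: algebra_simps)
  qed (use H0 in simp)
  have "G K = {}" using K by (auto simp: G_def)
  then have "g K = 0" by (simp add: g_def)
  with expand[of K] have "H = 1 + (\<Sum>i<K. (- 1) ^ i * c i) * H"
    by (simp only: mult_zero_right add_0_right)
  then have "H * (1 - (\<Sum>i<K. (- 1) ^ i * c i)) = 1" by (simp add: algebra_simps)
  then show ?thesis by (simp add: H_def c_def)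
qed

section \<open>Right modules and syzygies\<close>

lemma module_homD:
  assumes "h \<in> module_hom A M N"
  shows "x \<in> carrier M \<Longrightarrow> h x \<in> carrier N"
    and "x \<in> carrier M \<Longrightarrow> y \<in> carrier M \<Longrightarrow> h (x \<oplus>\<^bsub>M\<^esub> y) = h x \<oplus>\<^bsub>N\<^esub> h y"
    and "a \<in> carrier A \<Longrightarrow> x \<in> carrier M \<Longrightarrow> h (a \<odot>\<^bsub>M\<^esub> x) = a \<odot>\<^bsub>N\<^esub> h x"
  using assms by (auto simp: module_hom_def)

lemma module_homI:
  assumes "\<And>x. x \<in> carrier M \<Longrightarrow> h x \<in> carrier N"
    and "\<And>x y. x \<in> carrier M \<Longrightarrow> y \<in> carrier M \<Longrightarrow> h (x \<oplus>\<^bsub>M\<^esub> y) = h x \<oplus>\<^bsub>N\<^esub> h y"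
    and "\<And>a x. a \<in> carrier A \<Longrightarrow> x \<in> carrier M \<Longrightarrow> h (a \<odot>\<^bsub>M\<^esub> x) = a \<odot>\<^bsub>N\<^esub> h x"
  shows "h \<in> module_hom A M N"
  using assms by (auto simp: module_hom_def)

lemma (in right_module) smult_zero_ring:
  assumes m: "m \<in> carrier M"
  shows "\<zero>\<^bsub>A\<^esub> \<odot>\<^bsub>M\<^esub> m = \<zero>\<^bsub>M\<^esub>"
proof -
  let ?z = "\<zero>\<^bsub>A\<^esub> \<odot>\<^bsub>M\<^esub> m"
  have z: "?z \<in> carrier M" using m smult_closed by simp
  have "?z \<oplus>\<^bsub>M\<^esub> ?z = (\<zero>\<^bsub>A\<^esub> \<oplus>\<^bsub>A\<^esub> \<zero>\<^bsub>A\<^esub>) \<odot>\<^bsub>M\<^esub> m"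
    using smult_add_ring[OF A.zero_closed A.zero_closed m] by simp
  then show ?thesis using z M.add.l_cancel_one[OF z z] by simp
qed

lemma (in right_module) smult_zero_module:
  assumes a: "a \<in> carrier A"
  shows "a \<odot>\<^bsub>M\<^esub> \<zero>\<^bsub>M\<^esub> = \<zero>\<^bsub>M\<^esub>"
proof -
  let ?z = "a \<odot>\<^bsub>M\<^esub> \<zero>\<^bsub>M\<^esub>"
  have z: "?z \<in> carrier M" using a smult_closed by simp
  have "?z \<oplus>\<^bsub>M\<^esub> ?z = a \<odot>\<^bsub>M\<^esub> (\<zero>\<^bsub>M\<^esub> \<oplus>\<^bsub>M\<^esub> \<zero>\<^bsub>M\<^esub>)"
    using smult_add_module[OF a M.zero_closed M.zero_closed] by simp
  then show ?thesis using z M.add.l_cancel_one[OF z z] by simp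
qed

lemma module_hom_zero:
  assumes "right_module A M" "right_module A N" "h \<in> module_hom A M N"
  shows "h \<zero>\<^bsub>M\<^esub> = \<zero>\<^bsub>N\<^esub>"
proof -
  interpret M: right_module A M by fact
  interpret N: right_module A N by fact
  have "h (\<zero>\<^bsub>A\<^esub> \<odot>\<^bsub>M\<^esub> \<zero>\<^bsub>M\<^esub>) = \<zero>\<^bsub>A\<^esub> \<odot>\<^bsub>N\<^esub> h \<zero>\<^bsub>M\<^esub>"
    by (rule module_homD(3)[OF assms(3)]) simp_all
  then show ?thesis
    using M.smult_zero_ring[of "\<zero>\<^bsub>M\<^esub>"] N.smult_zero_ring[of "h \<zero>\<^bsub>M\<^esub>"] module_homD(1)[OF assms(3), of "\<zero>\<^bsub>M\<^esub>"]
    by simp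
qed

text \<open>
  Negatives exist because they are multiples by \<open>\<ominus> \<one>\<close>.
\<close>
lemma (in right_module) right_submodule:
  assumes sub: "K \<subseteq> carrier M" and zero: "\<zero>\<^bsub>M\<^esub> \<in> K"
    and add: "\<And>x y. x \<in> K \<Longrightarrow> y \<in> K \<Longrightarrow> x \<oplus>\<^bsub>M\<^esub> y \<in> K"
    and smult: "\<And>a x. a \<in> carrier A \<Longrightarrow> x \<in> K \<Longrightarrow> a \<odot>\<^bsub>M\<^esub> x \<in> K"
  shows "right_module A (M\<lparr>carrier := K\<rparr>)"
proof (intro right_module.intro right_module_axioms.intro)
  show "ring A" by (rule A.ring_axioms)
  show "abelian_group (M\<lparr>carrier := K\<rparr>)"
  proof (rule abelian_groupI)
    fix x assume x: "x \<in> carrier (M\<lparr>carrier := K\<rparr>)"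
    then have xM: "x \<in> carrier M" using sub by auto
    let ?y = "(\<ominus>\<^bsub>A\<^esub> \<one>\<^bsub>A\<^esub>) \<odot>\<^bsub>M\<^esub> x"
    have "?y \<oplus>\<^bsub>M\<^esub> x = (\<ominus>\<^bsub>A\<^esub> \<one>\<^bsub>A\<^esub> \<oplus>\<^bsub>A\<^esub> \<one>\<^bsub>A\<^esub>) \<odot>\<^bsub>M\<^esub> x"
      using smult_add_ring[of "\<ominus>\<^bsub>A\<^esub> \<one>\<^bsub>A\<^esub>" "\<one>\<^bsub>A\<^esub>" x] smult_one xM by simp
    also have "\<dots> = \<zero>\<^bsub>M\<^esub>" using smult_zero_ring xM by (simp add: A.l_neg)
    finally show "\<exists>y\<in>carrier (M\<lparr>carrier := K\<rparr>). y \<oplus>\<^bsub>M\<lparr>carrier := K\<rparr>\<^esub> x = \<zero>\<^bsub>M\<lparr>carrier := K\<rparr>\<^esub>"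
      using smult[of "\<ominus>\<^bsub>A\<^esub> \<one>\<^bsub>A\<^esub>" x] x by (intro bexI[of _ ?y]) auto
  qed (use sub zero add M.a_assoc M.a_comm in \<open>auto simp: subset_iff\<close>)
qed (use sub smult smult_add_ring smult_add_module smult_assoc_right smult_one in \<open>auto simp: subset_iff\<close>)

lemma right_module_kernel:
  assumes "right_module A P" "right_module A M" "e \<in> module_hom A P M"
  shows "right_module A (P\<lparr>carrier := a_kernel P M e\<rparr>)"
proof -
  interpret P: right_module A P by fact
  interpret M: right_module A M by fact
  show ?thesis
    using module_homD[OF assms(3)] module_hom_zero[OF assms]
    by (intro P.right_submodule) (auto simp: a_kernel_def' P.smult_closed M.smult_zero_module)
qed

definition regular_module :: "('a, 'r) ring_scheme \<Rightarrow> ('a, 'a) module"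
  where "regular_module A = \<lparr>carrier = carrier A, monoid.mult = monoid.mult A, one = \<one>\<^bsub>A\<^esub>, ring.zero = \<zero>\<^bsub>A\<^esub>,
    add = add A, module.smult = (\<lambda>a m. m \<otimes>\<^bsub>A\<^esub> a)\<rparr>"

lemma regular_module_simps [simp]:
  "carrier (regular_module A) = carrier A" "\<zero>\<^bsub>regular_module A\<^esub> = \<zero>\<^bsub>A\<^esub>"
  "x \<oplus>\<^bsub>regular_module A\<^esub> y = x \<oplus>\<^bsub>A\<^esub> y" "a \<odot>\<^bsub>regular_module A\<^esub> x = x \<otimes>\<^bsub>A\<^esub> a"
  by (simp_all add: regular_module_def)

lemma (in ring) right_module_regular: "right_module R (regular_module R)"
proof (intro right_module.intro right_module_axioms.intro)
  show "ring R" by (rule ring_axioms)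
  show "abelian_group (regular_module R)"
    by (rule abelian_groupI) (auto simp: a_ac intro: bexI[of _ "\<ominus> x" for x] l_neg)
qed (simp_all add: l_distr r_distr m_assoc)

definition cyclic_right_ideal :: "('a, 'r) ring_scheme \<Rightarrow> 'a \<Rightarrow> 'a set"
  where "cyclic_right_ideal A u = {u \<otimes>\<^bsub>A\<^esub> y | y. y \<in> carrier A}"

abbreviation cyclic_module :: "('a, 'r) ring_scheme \<Rightarrow> 'a \<Rightarrow> ('a, 'a) module"
  where "cyclic_module A u \<equiv> (regular_module A)\<lparr>carrier := cyclic_right_ideal A u\<rparr>"

definition right_annihilator :: "('a, 'r) ring_scheme \<Rightarrow> 'a \<Rightarrow> 'a set"
  where "right_annihilator A u = {y \<in> carrier A. u \<otimes>\<^bsub>A\<^esub> y = \<zero>\<^bsub>A\<^esub>}"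

context ring
begin

lemma right_module_cyclic:
  assumes "u \<in> carrier R"
  shows "right_module R (cyclic_module R u)"
proof -
  interpret reg: right_module R "regular_module R" by (rule right_module_regular)
  show ?thesis
  proof (rule reg.right_submodule)
    show "\<zero>\<^bsub>regular_module R\<^esub> \<in> cyclic_right_ideal R u"
      unfolding cyclic_right_ideal_def using assms by (intro CollectI exI[of _ "\<zero>"]) simp
    fix x assume "x \<in> cyclic_right_ideal R u"
    then obtain y where y: "x = u \<otimes> y" "y \<in> carrier R" by (auto simp: cyclic_right_ideal_def)
    { fix x' assume "x' \<in> cyclic_right_ideal R u"
      then obtain y' where "x' = u \<otimes> y'" "y' \<in> carrier R" by (auto simp: cyclic_right_ideal_def)
      then have "x \<oplus> x' = u \<otimes> (y \<oplus> y')" using y assms by (simp add: r_distr)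
      then show "x \<oplus>\<^bsub>regular_module R\<^esub> x' \<in> cyclic_right_ideal R u"
        using y \<open>y' \<in> carrier R\<close> by (auto simp: cyclic_right_ideal_def) }
    fix a assume "a \<in> carrier R"
    then have "x \<otimes> a = u \<otimes> (y \<otimes> a)" using y assms by (simp add: m_assoc)
    then show "a \<odot>\<^bsub>regular_module R\<^esub> x \<in> cyclic_right_ideal R u"
      using y \<open>a \<in> carrier R\<close> by (auto simp: cyclic_right_ideal_def)
  qed (use assms in \<open>auto simp: cyclic_right_ideal_def\<close>)
qed

text \<open>
  The two properties of consecutive tails of a chain that the argument uses: \<open>v R\<close> is a direct summand
  of the annihilator of \<open>u\<close>, with projection \<open>\<pi>\<close>, and \<open>\<one> \<oplus> c\<close> does not kill \<open>v\<close> when \<open>c\<close>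
  annihilates \<open>u\<close>. In a graded algebra the latter holds when such \<open>c\<close> have no constant term.
\<close>
definition summand_step :: "'a \<Rightarrow> 'a \<Rightarrow> bool"
  where "summand_step u v \<longleftrightarrow> u \<in> carrier R \<and> v \<in> right_annihilator R u \<and>
    (\<exists>\<pi>. (\<forall>x\<in>right_annihilator R u. \<pi> x \<in> cyclic_right_ideal R v) \<and>
         (\<forall>x\<in>cyclic_right_ideal R v. \<pi> x = x) \<and>
         (\<forall>x\<in>right_annihilator R u. \<forall>y\<in>right_annihilator R u. \<pi> (x \<oplus> y) = \<pi> x \<oplus> \<pi> y) \<and>
         (\<forall>x\<in>right_annihilator R u. \<forall>a\<in>carrier R. \<pi> (x \<otimes> a) = \<pi> x \<otimes> a)) \<and>
    (\<forall>c\<in>right_annihilator R u. v \<oplus> c \<otimes> v \<noteq> \<zero>)"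

text \<open>
  In the category of modules modulo projectives, \<open>u R\<close> is a direct summand of \<open>M\<close>. The part of the
  identity that factors through a projective lifts along the cover \<open>y \<mapsto> u \<otimes> y\<close> of \<open>u R\<close>, which gives
  the map \<open>r\<close> into the regular module.
\<close>
definition stable_summand :: "'a \<Rightarrow> ('a, 'a) module \<Rightarrow> bool"
  where "stable_summand u M \<longleftrightarrow> (\<exists>a b r. a \<in> module_hom R (cyclic_module R u) M \<and>
    b \<in> module_hom R M (cyclic_module R u) \<and> r \<in> module_hom R (cyclic_module R u) (regular_module R) \<and>
    (\<forall>x\<in>cyclic_right_ideal R u. b (a x) \<oplus> u \<otimes> r x = x))"

lemma generator_in_cyclic: "u \<in> carrier R \<Longrightarrow> u \<in> cyclic_right_ideal R u"
  unfolding cyclic_right_ideal_def by (intro CollectI exI[of _ "\<one>"]) simp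

lemma cyclic_hom_mult:
  assumes "r \<in> module_hom R (cyclic_module R u) N" "u \<in> carrier R" "y \<in> carrier R"
  shows "r (u \<otimes> y) = y \<odot>\<^bsub>N\<^esub> r u"
  using module_homD(3)[OF assms(1), of y u] generator_in_cyclic assms by simp

lemma annihilator_closed:
  assumes "u \<in> carrier R" "x \<in> right_annihilator R u"
  shows "a \<in> carrier R \<Longrightarrow> x \<otimes> a \<in> right_annihilator R u"
    and "y \<in> right_annihilator R u \<Longrightarrow> x \<oplus> y \<in> right_annihilator R u"
  using assms by (auto simp: right_annihilator_def r_distr m_assoc[symmetric])

text \<open>
  If \<open>M\<close> vanishes, then \<open>u \<otimes> r u = u\<close>, so \<open>c = r u \<ominus> \<one>\<close> satisfies \<open>u \<otimes> c = \<zero>\<close>. But linearity of \<open>r\<close> gives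
  \<open>r u \<otimes> v = r (u \<otimes> v) = \<zero>\<close>, so \<open>\<one> \<oplus> c\<close> kills \<open>v\<close>.
\<close>
lemma stable_summand_trivial_module:
  assumes step: "summand_step u v" and M: "right_module R M" "carrier M = {\<zero>\<^bsub>M\<^esub>}"
  shows "\<not> stable_summand u M"
proof
  assume "stable_summand u M"
  then obtain a b r where hom: "a \<in> module_hom R (cyclic_module R u) M" "b \<in> module_hom R M (cyclic_module R u)"
    "r \<in> module_hom R (cyclic_module R u) (regular_module R)"
    and fact: "\<And>x. x \<in> cyclic_right_ideal R u \<Longrightarrow> b (a x) \<oplus> u \<otimes> r x = x"
    unfolding stable_summand_def by blast
  have u: "u \<in> carrier R" and v: "v \<in> carrier R" "u \<otimes> v = \<zero>"
    using step by (auto simp: summand_step_def right_annihilator_def)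
  note cyc = right_module_cyclic[OF u]
  note u_in = generator_in_cyclic[OF u]
  have ru: "r u \<in> carrier R" using module_homD(1)[OF hom(3), of u] u_in by simp
  have "a u = \<zero>\<^bsub>M\<^esub>" using module_homD(1)[OF hom(1), of u] u_in M(2) by simp
  then have "b (a u) = \<zero>" using module_hom_zero[OF M(1) cyc hom(2)] by simp
  then have uru: "u \<otimes> r u = u" using fact[OF u_in] u ru by simp
  have "r u \<otimes> v = r (u \<otimes> v)" using cyclic_hom_mult[OF hom(3) u v(1)] by simp
  also have "\<dots> = \<zero>" using module_hom_zero[OF cyc right_module_regular hom(3)] v(2) by simp
  finally have ruv: "r u \<otimes> v = \<zero>" .
  have "r u \<ominus> \<one> \<in> right_annihilator R u"
    using u ru uru by (simp add: right_annihilator_def minus_eq r_distr r_minus r_neg)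
  moreover have "v \<oplus> (r u \<ominus> \<one>) \<otimes> v = \<zero>"
    using v ru ruv by (simp add: minus_eq l_distr l_minus r_neg)
  ultimately show False using step unfolding summand_step_def by blast
qed

text \<open>
  Choose \<open>p\<close> in \<open>P\<close> over \<open>a u\<close>, and lift the map \<open>b \<circ> e\<close> from \<open>P\<close> to \<open>u R\<close> through the cover by the
  regular module to a map \<open>g\<close>. For \<open>c = \<one> \<ominus> r u \<ominus> g p\<close> one has \<open>u \<otimes> c = \<zero>\<close>, and every \<open>y\<close> that
  annihilates \<open>u\<close> is the sum of \<open>g p \<otimes> y\<close>, which factors through the kernel of \<open>e\<close>, and \<open>c \<otimes> y\<close>, which
  factors through the regular module. Projecting to \<open>v R\<close> yields the claim.
\<close>
lemma stable_summand_syzygy: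
  assumes step: "summand_step u v" and M: "right_module R M" and P: "projective R P"
    and e: "e \<in> module_hom R P M" "e ` carrier P = carrier M" and fact: "stable_summand u M"
  shows "stable_summand v (P\<lparr>carrier := a_kernel P M e\<rparr>)"
proof -
  let ?J = "right_annihilator R u" and ?K = "P\<lparr>carrier := a_kernel P M e\<rparr>"
  obtain a b r where hom: "a \<in> module_hom R (cyclic_module R u) M" "b \<in> module_hom R M (cyclic_module R u)"
    "r \<in> module_hom R (cyclic_module R u) (regular_module R)"
    and fact: "\<And>x. x \<in> cyclic_right_ideal R u \<Longrightarrow> b (a x) \<oplus> u \<otimes> r x = x"
    using fact unfolding stable_summand_def by blast
  obtain \<pi> where \<pi>: "\<And>x. x \<in> ?J \<Longrightarrow> \<pi> x \<in> cyclic_right_ideal R v" "\<And>x. x \<in> cyclic_right_ideal R v \<Longrightarrow> \<pi> x = x"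
    "\<And>x y. x \<in> ?J \<Longrightarrow> y \<in> ?J \<Longrightarrow> \<pi> (x \<oplus> y) = \<pi> x \<oplus> \<pi> y"
    "\<And>x a. x \<in> ?J \<Longrightarrow> a \<in> carrier R \<Longrightarrow> \<pi> (x \<otimes> a) = \<pi> x \<otimes> a"
    using step unfolding summand_step_def by blast
  have u: "u \<in> carrier R" and vJ: "v \<in> ?J" and v: "v \<in> carrier R"
    using step by (auto simp: summand_step_def right_annihilator_def)
  have J: "x \<in> carrier R" "u \<otimes> x = \<zero>" if "x \<in> ?J" for x using that by (auto simp: right_annihilator_def)
  have vA_J: "x \<in> ?J" if "x \<in> cyclic_right_ideal R v" for x
    using that annihilator_closed(1)[OF u vJ] by (auto simp: cyclic_right_ideal_def)
  note cyc = right_module_cyclic[OF u]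
  note u_in = generator_in_cyclic[OF u]
  have PR: "right_module R P" using P by (simp add: projective_def)
  interpret P: right_module R P by (rule PR)
  interpret M: right_module R M by (rule M)
  have ru: "r u \<in> carrier R" using module_homD(1)[OF hom(3), of u] u_in by simp
  have "a u \<in> carrier M" using module_homD(1)[OF hom(1), of u] u_in by simp
  then obtain p where p: "p \<in> carrier P" "e p = a u" using e(2) by (metis imageE)
  have "(\<lambda>y. u \<otimes> y) \<in> module_hom R (regular_module R) (cyclic_module R u)"
    by (rule module_homI) (auto simp: u r_distr m_assoc cyclic_right_ideal_def)
  moreover have "(\<lambda>y. u \<otimes> y) ` carrier (regular_module R) = carrier (cyclic_module R u)"
    by (auto simp: cyclic_right_ideal_def)
  moreover have "(\<lambda>z. b (e z)) \<in> module_hom R P (cyclic_module R u)"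
    using module_homD[OF hom(2)] module_homD[OF e(1)] by (intro module_homI) simp_all
  ultimately have "\<exists>g\<in>module_hom R P (regular_module R). \<forall>z\<in>carrier P. (\<lambda>y. u \<otimes> y) (g z) = (\<lambda>z. b (e z)) z"
    using P right_module_regular cyc unfolding projective_def by blast
  then obtain g where g: "g \<in> module_hom R P (regular_module R)" "\<And>z. z \<in> carrier P \<Longrightarrow> u \<otimes> g z = b (e z)"
    by blast
  have gp: "g p \<in> carrier R" using module_homD(1)[OF g(1) p(1)] by simp
  define c where "c = \<one> \<ominus> r u \<ominus> g p"
  have c: "c \<in> carrier R" using ru gp by (simp add: c_def)
  have bau: "b (a u) \<in> carrier R"
    using g(2)[OF p(1)] p(2) m_closed[OF u gp] by simp
  have "u \<otimes> c = u \<ominus> u \<otimes> r u \<ominus> b (a u)"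
    using u ru gp g(2)[OF p(1)] p(2) by (simp add: c_def minus_eq r_distr r_minus)
  also have "\<dots> = b (a u) \<oplus> u \<otimes> r u \<ominus> u \<otimes> r u \<ominus> b (a u)" using fact[OF u_in] by simp
  also have "\<dots> = \<zero>" using u ru bau by (simp add: minus_eq) algebra
  finally have cJ: "c \<in> ?J" using c by (simp add: right_annihilator_def)
  have decomp: "g p \<otimes> y \<oplus> c \<otimes> y = y" if y: "y \<in> ?J" for y
  proof -
    have "r u \<otimes> y = r (u \<otimes> y)" using cyclic_hom_mult[OF hom(3) u J(1)[OF y]] by simp
    also have "\<dots> = \<zero>" using module_hom_zero[OF cyc right_module_regular hom(3)] J(2)[OF y] by simp
    finally have ruy: "r u \<otimes> y = \<zero>" .
    have "c \<otimes> y = y \<ominus> g p \<otimes> y"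
      using ru gp J(1)[OF y] ruy by (simp add: c_def minus_eq l_distr l_minus)
    then show ?thesis using gp J(1)[OF y] by (simp add: minus_eq) algebra
  qed
  obtain c' where c': "c' \<in> carrier R" "\<pi> c = v \<otimes> c'"
    using \<pi>(1)[OF cJ] by (auto simp: cyclic_right_ideal_def)
  have kerP: "z \<in> carrier P" "e z = \<zero>\<^bsub>M\<^esub>" if "z \<in> a_kernel P M e" for z
    using that by (auto simp: a_kernel_def')
  have gK: "g z \<in> ?J" if z: "z \<in> a_kernel P M e" for z
    using g(2)[of z] kerP[OF z] module_hom_zero[OF M cyc hom(2)] module_homD(1)[OF g(1), of z]
    by (simp add: right_annihilator_def)
  have gpx: "g (x \<odot>\<^bsub>P\<^esub> p) = g p \<otimes> x" if "x \<in> carrier R" for x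
    using module_homD(3)[OF g(1) that p(1)] by simp
  have xp: "x \<odot>\<^bsub>P\<^esub> p \<in> a_kernel P M e" if x: "x \<in> ?J" for x
  proof -
    have "e (x \<odot>\<^bsub>P\<^esub> p) = x \<odot>\<^bsub>M\<^esub> a u" using module_homD(3)[OF e(1) J(1)[OF x] p(1)] p(2) by simp
    also have "\<dots> = a (u \<otimes> x)" using cyclic_hom_mult[OF hom(1) u J(1)[OF x]] by simp
    also have "\<dots> = \<zero>\<^bsub>M\<^esub>" using module_hom_zero[OF cyc M hom(1)] J(2)[OF x] by simp
    finally show ?thesis using P.smult_closed[OF J(1)[OF x] p(1)] by (simp add: a_kernel_def')
  qed
  show ?thesis
    unfolding stable_summand_def
  proof (intro exI conjI ballI)
    show "(\<lambda>x. x \<odot>\<^bsub>P\<^esub> p) \<in> module_hom R (cyclic_module R v) ?K"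
    proof (rule module_homI)
      show "x \<odot>\<^bsub>P\<^esub> p \<in> carrier ?K" if "x \<in> carrier (cyclic_module R v)" for x
        using that xp vA_J by simp
    qed (use vA_J J p P.smult_add_ring P.smult_assoc_right in auto)
    show "(\<lambda>z. \<pi> (g z)) \<in> module_hom R ?K (cyclic_module R v)"
    proof (rule module_homI)
      show "\<pi> (g z) \<in> carrier (cyclic_module R v)" if "z \<in> carrier ?K" for z
        using that gK \<pi>(1) by simp
      show "\<pi> (g (z \<oplus>\<^bsub>?K\<^esub> z')) = \<pi> (g z) \<oplus>\<^bsub>cyclic_module R v\<^esub> \<pi> (g z')" if "z \<in> carrier ?K" "z' \<in> carrier ?K" for z z'
        using that \<pi>(3)[OF gK gK] module_homD(2)[OF g(1)] kerP by simp
      show "\<pi> (g (x \<odot>\<^bsub>?K\<^esub> z)) = x \<odot>\<^bsub>cyclic_module R v\<^esub> \<pi> (g z)" if "x \<in> carrier R" "z \<in> carrier ?K" for x z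
        using that \<pi>(4)[OF gK] module_homD(3)[OF g(1)] kerP by simp
    qed
    show "(\<lambda>x. c' \<otimes> x) \<in> module_hom R (cyclic_module R v) (regular_module R)"
      using c' vA_J J by (intro module_homI) (auto simp: r_distr m_assoc)
    fix x assume x: "x \<in> cyclic_right_ideal R v"
    note xJ = vA_J[OF x]
    have "v \<otimes> (c' \<otimes> x) = \<pi> (c \<otimes> x)"
      using \<pi>(4)[OF cJ J(1)[OF xJ]] c' v J(1)[OF xJ] by (simp add: m_assoc)
    moreover have "g p \<otimes> x \<in> ?J" using gK[OF xp[OF xJ]] gpx[OF J(1)[OF xJ]] by simp
    ultimately have "\<pi> (g (x \<odot>\<^bsub>P\<^esub> p)) \<oplus> v \<otimes> (c' \<otimes> x) = \<pi> (g p \<otimes> x \<oplus> c \<otimes> x)"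
      using \<pi>(3) annihilator_closed(1)[OF u cJ J(1)[OF xJ]] gpx[OF J(1)[OF xJ]] by simp
    then show "\<pi> (g (x \<odot>\<^bsub>P\<^esub> p)) \<oplus> v \<otimes> (c' \<otimes> x) = x"
      using decomp[OF xJ] \<pi>(2)[OF x] by simp
  qed
qed

lemma summand_chain_bound:
  assumes "right_module R M" "projective_resolution R M P d e" "\<And>i. n \<le> i \<Longrightarrow> carrier (P i) = {\<zero>\<^bsub>P i\<^esub>}"
    and "stable_summand (u 0) M"
  shows "\<not> (\<forall>i\<le>n. summand_step (u i) (u (Suc i)))"
  using assms
proof (induction n arbitrary: M P d e u)
  case 0
  have "e \<in> module_hom R (P 0) M" "carrier M = e ` carrier (P 0)" "right_module R (P 0)"
    using "0.prems"(2) by (auto simp: projective_resolution_def projective_def)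
  then have "carrier M = {\<zero>\<^bsub>M\<^esub>}"
    using module_hom_zero[OF _ "0.prems"(1)] "0.prems"(3)[of 0] by auto
  then show ?case using stable_summand_trivial_module "0.prems" by blast
next
  case (Suc n)
  let ?K = "(P 0)\<lparr>carrier := a_kernel (P 0) M e\<rparr>"
  have res: "\<And>i. projective R (P i)" "e \<in> module_hom R (P 0) M" "\<And>i. d i \<in> module_hom R (P (Suc i)) (P i)"
    "e ` carrier (P 0) = carrier M" "d 0 ` carrier (P 1) = a_kernel (P 0) M e"
    "\<And>i. d (Suc i) ` carrier (P (Suc (Suc i))) = a_kernel (P (Suc i)) (P i) (d i)"
    using Suc.prems(2) by (auto simp: projective_resolution_def)
  have modK: "right_module R ?K"
    using res(1)[of 0] Suc.prems(1) res(2) by (intro right_module_kernel) (simp_all add: projective_def)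
  have d0: "d 0 \<in> module_hom R (P (Suc 0)) ?K"
    using module_homD[OF res(3)[of 0]] res(5) by (intro module_homI) auto
  have resK: "projective_resolution R ?K (\<lambda>i. P (Suc i)) (\<lambda>i. d (Suc i)) (d 0)"
    unfolding projective_resolution_def
    using res d0 by (auto simp: a_kernel_def')
  show ?case
  proof
    assume steps: "\<forall>i\<le>Suc n. summand_step (u i) (u (Suc i))"
    have "stable_summand (u (Suc 0)) ?K"
      using steps Suc.prems res by (intro stable_summand_syzygy[of "u 0"]) auto
    then have "\<not> (\<forall>i\<le>n. summand_step (u (Suc i)) (u (Suc (Suc i))))"
      using Suc.IH[OF modK resK, of "\<lambda>i. u (Suc i)"] Suc.prems(3) by auto
    then show False using steps by auto
  qed
qed

text \<open>
  The cyclic module \<open>u\<^sub>0 R\<close> has a resolution of length at most the global dimension, and each step of the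
  sequence \<open>u\<close> uses up one term of it.
\<close>
theorem finite_global_dim_chain_bound:
  assumes "right_global_dim TYPE('a) R < \<infinity>"
  shows "\<exists>n. \<forall>u. \<not> (\<forall>i\<le>n. summand_step (u i) (u (Suc i)))"
proof -
  obtain n where n: "right_global_dim TYPE('a) R = enat n" using assms by (cases "right_global_dim TYPE('a) R") auto
  have "\<not> (\<forall>i\<le>Suc n. summand_step (u i) (u (Suc i)))" for u
  proof
    assume steps: "\<forall>i\<le>Suc n. summand_step (u i) (u (Suc i))"
    then have u: "u 0 \<in> carrier R" by (auto simp: summand_step_def)
    let ?M = "cyclic_module R (u 0)"
    have M: "right_module R ?M" by (rule right_module_cyclic[OF u])
    have "projective_dim R ?M \<le> enat n"
      unfolding n[symmetric] right_global_dim_def using M by (intro Sup_upper) blast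
    then have ex: "\<exists>k\<le>n. \<exists>P d e. projective_resolution R ?M P d e \<and> (\<forall>i>k. carrier (P i) = {\<zero>\<^bsub>P i\<^esub>})"
    proof -
      let ?S = "{enat k | k. \<exists>P d e. projective_resolution R ?M P d e \<and> (\<forall>i>k. carrier (P i) = {\<zero>\<^bsub>P i\<^esub>})}"
      assume le: "projective_dim R ?M \<le> enat n"
      have "?S \<noteq> {}"
      proof
        assume "?S = {}"
        then have "projective_dim R ?M = \<infinity>" unfolding projective_dim_def by (simp add: Inf_enat_def)
        with le show False by simp
      qed
      then obtain x where "x \<in> ?S" by blast
      then have "(LEAST x. x \<in> ?S) \<in> ?S" by (rule LeastI)
      then have "Inf ?S \<in> ?S" using \<open>?S \<noteq> {}\<close> by (simp only: Inf_enat_def if_False)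
      then obtain k where "Inf ?S = enat k" "\<exists>P d e. projective_resolution R ?M P d e \<and> (\<forall>i>k. carrier (P i) = {\<zero>\<^bsub>P i\<^esub>})"
        by blast
      then show ?thesis using le unfolding projective_dim_def by auto
    qed
    then obtain P d e where "projective_resolution R ?M P d e" "\<And>i. Suc n \<le> i \<Longrightarrow> carrier (P i) = {\<zero>\<^bsub>P i\<^esub>}"
      by (metis Suc_le_lessD order_le_less_trans)
    moreover have "stable_summand (u 0) ?M"
    proof -
      have cyc: "x \<in> carrier R" if "x \<in> cyclic_right_ideal R (u 0)" for x using that u by (auto simp: cyclic_right_ideal_def)
      have "(\<lambda>x. x) \<in> module_hom R ?M ?M" by (simp add: module_hom_def)
      moreover have "(\<lambda>_. \<zero>) \<in> module_hom R ?M (regular_module R)" by (simp add: module_hom_def)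
      ultimately show ?thesis unfolding stable_summand_def using cyc u
        by (intro exI[of _ "\<lambda>x. x"] exI[of _ "\<lambda>_. \<zero>"]) simp
    qed
    ultimately show False using summand_chain_bound[OF M] steps by blast
  qed
  then show ?thesis by blast
qed

end

section \<open>The ideal and the Hilbert function of a monomial algebra\<close>

lemma ring_of_type_ring: "ring (ring_of_type_algebra :: 'a::ring_1 ring)"
proof -
  have "\<exists>y. x + y = 0" for x :: 'a by (rule exI[of _ "- x"]) simp
  then show ?thesis
    unfolding ring_of_type_algebra_def using add.right_inverse
    by unfold_locales (auto simp: algebra_simps Units_def)
qed

lemma type_algebra_uminus: "\<ominus>\<^bsub>ring_of_type_algebra\<^esub> (x :: 'a::ring_1) = - x"
proof -
  interpret ring "ring_of_type_algebra :: 'a ring" by (rule ring_of_type_ring)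
  show ?thesis by (rule minus_equality) (simp_all add: type_algebra_simps)
qed

lemma type_algebra_minus: "x \<ominus>\<^bsub>ring_of_type_algebra\<^esub> y = (x - y :: 'a::ring_1)"
  by (simp add: a_minus_def type_algebra_uminus type_algebra_simps)

lemma poly_mapping_sum_single:
  "f = (\<Sum>w\<in>Poly_Mapping.keys f. Poly_Mapping.single w (Poly_Mapping.lookup f w))"
proof (rule poly_mapping_eqI)
  fix v
  have "(\<Sum>w\<in>Poly_Mapping.keys f. Poly_Mapping.lookup (Poly_Mapping.single w (Poly_Mapping.lookup f w)) v) =
      (\<Sum>w\<in>Poly_Mapping.keys f. if w = v then Poly_Mapping.lookup f v else 0)"
    by (intro sum.cong) (auto simp: lookup_single when_def)
  then show "Poly_Mapping.lookup f v =
      Poly_Mapping.lookup (\<Sum>w\<in>Poly_Mapping.keys f. Poly_Mapping.single w (Poly_Mapping.lookup f w)) v"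
    by (simp add: lookup_sum in_keys_iff)
qed

lemma keys_mult_words:
  fixes f g :: "'x list \<Rightarrow>\<^sub>0 'k::field"
  assumes "w \<in> Poly_Mapping.keys (f * g)"
  obtains u v where "u \<in> Poly_Mapping.keys f" "v \<in> Poly_Mapping.keys g" "w = u @ v"
  using assms keys_mult[of f g] by (auto simp: plus_list_def)

definition word_ideal :: "'x list set \<Rightarrow> ('x list \<Rightarrow>\<^sub>0 'k::field) set"
  where "word_ideal L = {f. \<forall>w\<in>Poly_Mapping.keys f. \<not> normal_word L w}"

lemma word_ideal_closed:
  fixes f g :: "'x list \<Rightarrow>\<^sub>0 'k::field"
  shows "0 \<in> word_ideal L"
    and "f \<in> word_ideal L \<Longrightarrow> - f \<in> word_ideal L"
    and "f \<in> word_ideal L \<Longrightarrow> g \<in> word_ideal L \<Longrightarrow> f + g \<in> word_ideal L"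
    and "f \<in> word_ideal L \<Longrightarrow> f * g \<in> word_ideal L"
    and "f \<in> word_ideal L \<Longrightarrow> g * f \<in> word_ideal L"
proof -
  show "0 \<in> word_ideal L" by (simp add: word_ideal_def)
  show "f \<in> word_ideal L \<Longrightarrow> - f \<in> word_ideal L" by (simp add: word_ideal_def in_keys_iff)
  show "f \<in> word_ideal L \<Longrightarrow> g \<in> word_ideal L \<Longrightarrow> f + g \<in> word_ideal L"
    using keys_add[of f g] by (auto simp: word_ideal_def)
  have "sublist u (u @ v)" "sublist v (u @ v)" for u v :: "'x list"
    by (simp_all add: prefix_imp_sublist suffix_imp_sublist)
  then show "f \<in> word_ideal L \<Longrightarrow> f * g \<in> word_ideal L" "f \<in> word_ideal L \<Longrightarrow> g * f \<in> word_ideal L"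
    unfolding word_ideal_def by (auto elim!: keys_mult_words dest: normal_word_sublist)
qed

lemma word_ideal_ideal: "ideal (word_ideal L :: ('x list \<Rightarrow>\<^sub>0 'k::field) set) free_algebra"
proof -
  interpret F: ring "free_algebra :: ('x list \<Rightarrow>\<^sub>0 'k) ring" by (rule ring_of_type_ring)
  show ?thesis
  proof (rule idealI[OF ring_of_type_ring])
    show "subgroup (word_ideal L) (add_monoid (free_algebra :: ('x list \<Rightarrow>\<^sub>0 'k) ring))"
    proof (rule F.add.subgroupI)
      fix f g :: "'x list \<Rightarrow>\<^sub>0 'k"
      assume f: "f \<in> word_ideal L"
      then show "\<ominus>\<^bsub>free_algebra\<^esub> f \<in> word_ideal L" by (simp add: type_algebra_uminus word_ideal_closed)
      assume "g \<in> word_ideal L"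
      with f show "f \<oplus>\<^bsub>free_algebra\<^esub> g \<in> word_ideal L" by (simp add: type_algebra_simps word_ideal_closed)
    qed (use word_ideal_closed(1) in \<open>auto simp: type_algebra_simps\<close>)
  qed (simp_all add: type_algebra_simps word_ideal_closed)
qed

lemma monomial_in_word_ideal: "(monomial w :: 'x list \<Rightarrow>\<^sub>0 'k::field) \<in> word_ideal L \<longleftrightarrow> \<not> normal_word L w"
  by (simp add: monomial_def word_ideal_def)

text \<open>
  A polynomial lies in the ideal generated by words iff each of its words does, that is, contains one of
  the generators.
\<close>
lemma genideal_monomials:
  "genideal (free_algebra :: ('x list \<Rightarrow>\<^sub>0 'k::field) ring) (monomial ` L) = word_ideal L"
proof
  interpret F: ring "free_algebra :: ('x list \<Rightarrow>\<^sub>0 'k) ring" by (rule ring_of_type_ring)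
  have "monomial ` L \<subseteq> (word_ideal L :: ('x list \<Rightarrow>\<^sub>0 'k) set)"
    using monomial_in_word_ideal by (auto simp: normal_word_def)
  then show "genideal free_algebra (monomial ` L) \<subseteq> (word_ideal L :: ('x list \<Rightarrow>\<^sub>0 'k) set)"
    by (intro F.genideal_minimal word_ideal_ideal)
  show "(word_ideal L :: ('x list \<Rightarrow>\<^sub>0 'k) set) \<subseteq> genideal free_algebra (monomial ` L)"
    unfolding genideal_def
  proof (intro Inter_greatest subsetI)
    fix J and f :: "'x list \<Rightarrow>\<^sub>0 'k"
    assume J: "J \<in> {J. ideal J (free_algebra :: ('x list \<Rightarrow>\<^sub>0 'k) ring) \<and> monomial ` L \<subseteq> J}"
      and f: "f \<in> word_ideal L"
    interpret J: ideal J "free_algebra :: ('x list \<Rightarrow>\<^sub>0 'k) ring" using J by simp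
    have single: "Poly_Mapping.single w c \<in> J" if w: "\<not> normal_word L w" for w c
    proof -
      obtain v p q where v: "v \<in> L" "w = p @ v @ q" using w by (auto simp: normal_word_def sublist_def)
      have "monomial v * Poly_Mapping.single q 1 \<in> J"
        using J v(1) J.I_r_closed[of "monomial v" "Poly_Mapping.single q 1"] by (auto simp: type_algebra_simps)
      then have "Poly_Mapping.single p c * (monomial v * Poly_Mapping.single q 1) \<in> J"
        using J.I_l_closed[of _ "Poly_Mapping.single p c"] by (auto simp: type_algebra_simps)
      then show ?thesis by (simp add: monomial_def mult_single plus_list_def v(2))
    qed
    have "(\<Sum>w\<in>S. Poly_Mapping.single w (Poly_Mapping.lookup f w)) \<in> J" if "S \<subseteq> Poly_Mapping.keys f" for S
      using finite_subset[OF that finite_keys] that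
    proof (induction S rule: finite_induct)
      case empty
      then show ?case using J.zero_closed by (simp add: type_algebra_simps)
    next
      case (insert w S)
      have "Poly_Mapping.single w (Poly_Mapping.lookup f w) \<in> J"
        using insert.prems f by (intro single) (auto simp: word_ideal_def)
      then show ?case using insert J.a_closed by (simp add: type_algebra_simps)
    qed
    then show "f \<in> J" using poly_mapping_sum_single[of f] by (metis order_refl)
  qed
qed

text \<open>
  The words in the ideal are those that contain a word of \<open>L\<close>; the minimal ones among them are the
  words of the antichain.
\<close>
lemma monomial_basis_word_ideal:
  assumes "word_antichain L"
  shows "monomial_basis (word_ideal L :: ('x list \<Rightarrow>\<^sub>0 'k::field) set) = L"
  unfolding monomial_basis_def
proof (rule the_equality)
  show "word_antichain L \<and> (word_ideal L :: ('x list \<Rightarrow>\<^sub>0 'k) set) = genideal free_algebra (monomial ` L)"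
    using assms by (simp add: genideal_monomials)
  fix L' :: "'x list set" assume "word_antichain L' \<and> (word_ideal L :: ('x list \<Rightarrow>\<^sub>0 'k) set) = genideal free_algebra (monomial ` L')"
  then have L': "word_antichain L'" and eq: "(word_ideal L :: ('x list \<Rightarrow>\<^sub>0 'k) set) = word_ideal L'"
    by (simp_all add: genideal_monomials)
  have normal_eq: "normal_word L w = normal_word L' w" for w
    using eq monomial_in_word_ideal[where 'k = 'k] by blast
  have sub: "A \<subseteq> B" if "word_antichain A" "\<And>w. normal_word A w = normal_word B w" for A B :: "'x list set"
  proof
    fix v assume v: "v \<in> A"
    then have "\<not> normal_word B v" using that(2)[of v] by (auto simp: normal_word_def)
    then obtain v' where v': "v' \<in> B" "sublist v' v" by (auto simp: normal_word_def)
    then have "\<not> normal_word A v'" using that(2)[of v'] by (auto simp: normal_word_def)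
    then obtain v'' where v'': "v'' \<in> A" "sublist v'' v'" by (auto simp: normal_word_def)
    then have "v'' = v" using that(1) v v' sublist_order.order_trans unfolding word_antichain_def by blast
    then have "v = v'" using v' v'' sublist_order.order_antisym by blast
    then show "v \<in> B" using v' by simp
  qed
  show "L' = L" using sub[of L L'] sub[of L' L] assms L' normal_eq by auto
qed

lemma monomial_ideal_word_ideal:
  assumes "monomial_ideal (I :: ('x list \<Rightarrow>\<^sub>0 'k::field) set)"
  shows "word_antichain (monomial_basis I)" and "I = word_ideal (monomial_basis I)"
proof -
  obtain W where W: "I = word_ideal W"
    using assms by (auto simp: monomial_ideal_def genideal_monomials)
  define L where "L = {w \<in> W. \<forall>v\<in>W. sublist v w \<longrightarrow> v = w}"
  have L: "word_antichain L" by (auto simp: word_antichain_def L_def)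
  have "normal_word W w = normal_word L w" for w
  proof
    assume "normal_word L w"
    show "normal_word W w"
      unfolding normal_word_def
    proof (intro ballI notI)
      fix v assume "v \<in> W" "sublist v w"
      define m where "m = (ARG_MIN length u. u \<in> W \<and> sublist u v)"
      have m: "m \<in> W" "sublist m v" and least: "\<And>u. u \<in> W \<Longrightarrow> sublist u v \<Longrightarrow> length m \<le> length u"
        using arg_min_nat_lemma[of "\<lambda>u. u \<in> W \<and> sublist u v" v length] \<open>v \<in> W\<close>
        unfolding m_def by auto
      have "m \<in> L"
        unfolding L_def
      proof (intro CollectI conjI ballI impI m(1))
        fix u assume u: "u \<in> W" "sublist u m"
        then have "length m \<le> length u" using least m(2) sublist_order.order_trans by blast
        then show "u = m" using u(2) by (auto simp: sublist_def)
      qed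
      moreover have "sublist m w" using m(2) \<open>sublist v w\<close> sublist_order.order_trans by blast
      ultimately show False using \<open>normal_word L w\<close> by (auto simp: normal_word_def)
    qed
  qed (auto simp: normal_word_def L_def)
  then have "I = word_ideal L" by (simp add: W word_ideal_def)
  then show "word_antichain (monomial_basis I)" "I = word_ideal (monomial_basis I)"
    using monomial_basis_word_ideal[OF L, where 'k = 'k] L by simp_all
qed

locale monomial_quotient =
  fixes L :: "'x list set" and I :: "('x list \<Rightarrow>\<^sub>0 'k::field) set"
  assumes antichain: "word_antichain L" and length_L: "\<And>w. w \<in> L \<Longrightarrow> 2 \<le> length w"
    and I: "I = word_ideal L"
begin

abbreviation A where "A \<equiv> monomial_algebra I"
abbreviation cls where "cls \<equiv> proj_class I"

lemma ideal_I: "ideal I free_algebra"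
  unfolding I by (rule word_ideal_ideal)

lemma mem_I: "f \<in> I \<longleftrightarrow> (\<forall>w\<in>Poly_Mapping.keys f. \<not> normal_word L w)"
  by (simp add: I word_ideal_def)

lemma cls_eq_iff: "cls f = cls g \<longleftrightarrow> f - g \<in> I"
proof -
  interpret F: ring "free_algebra :: ('x list \<Rightarrow>\<^sub>0 'k) ring" by (rule ring_of_type_ring)
  show ?thesis
    using F.quotient_eq_iff_same_a_r_cos[OF ideal_I, of f g]
    by (simp add: proj_class_def type_algebra_simps type_algebra_minus)
qed

lemma cls_hom: "cls \<in> ring_hom free_algebra A"
  using ideal.rcos_ring_hom[OF ideal_I] by (simp add: proj_class_def[abs_def] monomial_algebra_def)

lemma carrier_A: "carrier A = range cls"
  by (auto simp: monomial_algebra_def FactRing_def A_RCOSETS_defs a_r_coset_def proj_class_def type_algebra_simps)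

lemma cls_in_carrier [simp]: "cls f \<in> carrier A"
  by (simp add: carrier_A)

lemma cls_mult: "cls f \<otimes>\<^bsub>A\<^esub> cls g = cls (f * g)"
  using ring_hom_mult[OF cls_hom, of f g] by (simp add: type_algebra_simps)

lemma cls_add: "cls f \<oplus>\<^bsub>A\<^esub> cls g = cls (f + g)"
  using ring_hom_add[OF cls_hom, of f g] by (simp add: type_algebra_simps)

lemma cls_one: "\<one>\<^bsub>A\<^esub> = cls 1"
  using ring_hom_one[OF cls_hom] by (simp add: type_algebra_simps)

lemma ring_A: "ring A"
  unfolding monomial_algebra_def by (rule ideal.quotient_is_ring[OF ideal_I])

lemma cls_zero: "\<zero>\<^bsub>A\<^esub> = cls 0"
  using ring_hom_zero[OF cls_hom ring_of_type_ring ring_A] by (simp add: type_algebra_simps)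

lemma cls_eq_zero_iff: "cls f = \<zero>\<^bsub>A\<^esub> \<longleftrightarrow> f \<in> I"
  by (simp add: cls_zero cls_eq_iff)

lemma monomial_not_in_I: "normal_word L w \<Longrightarrow> monomial w \<notin> I"
  by (simp add: I monomial_in_word_ideal)

lemma scalars_subfield: "subfield (scalars I) A"
proof -
  let ?K = "ring_of_type_algebra :: 'k ring"
  interpret A: ring A by (rule ring_A)
  interpret K: field ?K by (rule field_from_type_algebra)
  define \<phi> where "\<phi> c = cls (Poly_Mapping.single [] c)" for c
  have "ring_hom_ring ?K A \<phi>"
  proof (rule ring_hom_ringI[OF K.ring_axioms ring_A])
    fix a b :: 'k
    show "\<phi> (a \<otimes>\<^bsub>?K\<^esub> b) = \<phi> a \<otimes>\<^bsub>A\<^esub> \<phi> b"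
      by (simp add: \<phi>_def cls_mult type_algebra_simps mult_single plus_list_def)
    show "\<phi> (a \<oplus>\<^bsub>?K\<^esub> b) = \<phi> a \<oplus>\<^bsub>A\<^esub> \<phi> b"
      by (simp add: \<phi>_def cls_add type_algebra_simps single_add)
    show "\<phi> \<one>\<^bsub>?K\<^esub> = \<one>\<^bsub>A\<^esub>"
      by (simp add: \<phi>_def cls_one type_algebra_simps single_one zero_list_def[symmetric])
  qed (simp add: \<phi>_def)
  moreover have "\<one>\<^bsub>A\<^esub> \<noteq> \<zero>\<^bsub>A\<^esub>"
    using monomial_not_in_I[OF normal_Nil[OF antichain length_L]]
    by (simp add: cls_one cls_eq_zero_iff monomial_def zero_list_def[symmetric])
  ultimately have "subfield (\<phi> ` carrier ?K) A"
    using ring_hom_ring.img_is_subfield(2)[of ?K A \<phi> "carrier ?K"] K.carrier_is_subfield by blast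
  then show ?thesis
    by (simp add: type_algebra_simps scalars_def \<phi>_def[abs_def] image_image)
qed

lemma combine_monomials:
  "ring.combine A (map (\<lambda>c. cls (Poly_Mapping.single [] c)) cs) (map (\<lambda>w. cls (monomial w)) ws) =
    cls (\<Sum>(c, w)\<leftarrow>zip cs ws. Poly_Mapping.single w c)"
proof (induction cs arbitrary: ws)
  case Nil
  then show ?case by (simp add: ring.combine.simps[OF ring_A] cls_zero)
next
  case (Cons c cs)
  show ?case
  proof (cases ws)
    case Nil
    then show ?thesis by (simp add: ring.combine.simps[OF ring_A] cls_zero)
  next
    case (Cons w ws')
    then show ?thesis
      using Cons.IH[of ws'] by (simp add: ring.combine.simps[OF ring_A] cls_mult cls_add monomial_def mult_single plus_list_def)
  qed
qed

lemma lookup_zip_sum: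
  assumes "v \<notin> set ws"
  shows "Poly_Mapping.lookup (\<Sum>(c, w)\<leftarrow>zip cs ws. Poly_Mapping.single w (c :: 'k)) v = 0"
  using assms
proof (induction ws arbitrary: cs)
  case (Cons w ws)
  then show ?case by (cases cs) (auto simp: lookup_add lookup_single)
qed simp

text \<open>
  The classes of the normal words of length \<open>d\<close> form a basis: modulo the ideal, all other words vanish,
  and no non-trivial combination of normal words lies in the ideal.
\<close>
lemma graded_dim_eq:
  assumes fin: "finite {w. normal_word L w \<and> length w = d}"
  shows "graded_dim I d = card {w. normal_word L w \<and> length w = d}"
proof -
  interpret A: ring A by (rule ring_A)
  let ?N = "{w. normal_word L w \<and> length w = d}" and ?K = "scalars I"
  obtain ws where ws: "set ws = ?N" "distinct ws" using finite_distinct_list[OF fin] by blast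
  let ?U = "\<lambda>ws. map (\<lambda>w. cls (monomial w)) ws"
  have Span: "A.Span ?K (?U vs) = {A.combine Ks (?U vs) | Ks. set Ks \<subseteq> ?K}" for vs
    by (rule A.Span_eq_combine_set[OF scalars_subfield]) auto
  have scal: "\<exists>cs. Ks = map (\<lambda>c. cls (Poly_Mapping.single [] c)) cs" if "set Ks \<subseteq> ?K" for Ks
    using that by (induction Ks) (auto simp: scalars_def intro: exI[of _ "c # cs" for c cs])
  have "A.independent ?K (?U vs)" if "set vs \<subseteq> ?N" "distinct vs" for vs
    using that
  proof (induction vs)
    case (Cons v vs)
    have "cls (monomial v) \<notin> A.Span ?K (?U vs)"
    proof
      assume "cls (monomial v) \<in> A.Span ?K (?U vs)"
      then obtain Ks where "set Ks \<subseteq> ?K" "cls (monomial v) = A.combine Ks (?U vs)"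
        unfolding Span by blast
      then obtain cs where "cls (monomial v) = cls (\<Sum>(c, w)\<leftarrow>zip cs vs. Poly_Mapping.single w c)"
        using scal combine_monomials by metis
      then have "monomial v - (\<Sum>(c, w)\<leftarrow>zip cs vs. Poly_Mapping.single w c) \<in> I" by (simp add: cls_eq_iff)
      moreover have "Poly_Mapping.lookup (monomial v - (\<Sum>(c, w)\<leftarrow>zip cs vs. Poly_Mapping.single w c)) v = (1 :: 'k)"
        using Cons.prems(2) lookup_zip_sum[of v vs cs] by (simp add: lookup_minus monomial_def)
      ultimately have "\<not> normal_word L v" unfolding mem_I by (metis in_keys_iff zero_neq_one)
      then show False using Cons.prems(1) by simp
    qed
    then show ?case using Cons by (auto intro: A.li_Cons)
  qed simp
  then have "A.dimension (length (?U ws)) ?K (A.Span ?K (?U ws))"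
    using ws by (intro A.dimension_independent) simp
  moreover have "A.Span ?K (?U ws) = cls ` homogeneous d"
  proof (intro equalityI subsetI)
    fix x assume "x \<in> A.Span ?K (?U ws)"
    then obtain Ks where "set Ks \<subseteq> ?K" "x = A.combine Ks (?U ws)"
      unfolding Span by blast
    then obtain cs where x: "x = cls (\<Sum>(c, w)\<leftarrow>zip cs ws. Poly_Mapping.single w c)"
      using scal combine_monomials by metis
    have "(\<Sum>(c, w)\<leftarrow>zip cs ws. Poly_Mapping.single w c) \<in> homogeneous d"
      using ws(1) lookup_zip_sum[of _ ws cs] by (auto simp: homogeneous_def in_keys_iff)
    then show "x \<in> cls ` homogeneous d" using x by blast
  next
    fix x assume "x \<in> cls ` homogeneous d"
    then obtain f where f: "x = cls f" "f \<in> homogeneous d" by blast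
    have sum: "(\<Sum>(c, w)\<leftarrow>zip (map (Poly_Mapping.lookup f) ws) ws. Poly_Mapping.single w c) =
        (\<Sum>w\<in>?N. Poly_Mapping.single w (Poly_Mapping.lookup f w))"
      using ws by (simp add: zip_map1 zip_same_conv_map comp_def sum_list_distinct_conv_sum_set)
    have "f - (\<Sum>w\<in>?N. Poly_Mapping.single w (Poly_Mapping.lookup f w)) \<in> I"
      unfolding mem_I
    proof (intro ballI notI)
      fix v assume v: "v \<in> Poly_Mapping.keys (f - (\<Sum>w\<in>?N. Poly_Mapping.single w (Poly_Mapping.lookup f w)))"
        and nv: "normal_word L v"
      have "(\<Sum>w\<in>?N. Poly_Mapping.lookup (Poly_Mapping.single w (Poly_Mapping.lookup f w)) v) =
          (\<Sum>w\<in>?N. if w = v then Poly_Mapping.lookup f v else 0)"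
        by (intro sum.cong) (auto simp: lookup_single when_def)
      also have "\<dots> = Poly_Mapping.lookup f v"
        using fin nv f(2) by (auto simp: homogeneous_def in_keys_iff)
      finally show False using v by (simp add: in_keys_iff lookup_minus lookup_sum)
    qed
    then have "x = cls (\<Sum>(c, w)\<leftarrow>zip (map (Poly_Mapping.lookup f) ws) ws. Poly_Mapping.single w c)"
      unfolding f sum cls_eq_iff .
    also have "\<dots> = A.combine (map (\<lambda>c. cls (Poly_Mapping.single [] c)) (map (Poly_Mapping.lookup f) ws)) (?U ws)"
      by (rule combine_monomials[symmetric])
    also have "\<dots> \<in> A.Span ?K (?U ws)"
    proof -
      have "set (map (\<lambda>c. cls (Poly_Mapping.single [] c)) (map (Poly_Mapping.lookup f) ws)) \<subseteq> ?K"
        by (auto simp: scalars_def)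
      then show ?thesis unfolding Span by blast
    qed
    finally show "x \<in> A.Span ?K (?U ws)" .
  qed
  ultimately have "(A.dim over ?K) (cls ` homogeneous d) = length (?U ws)"
    by (intro A.dimI scalars_subfield) simp
  then show ?thesis using ws distinct_card[of ws] by (simp add: graded_dim_def over_def)
qed

end

section \<open>Tails of chains in the monomial algebra\<close>

lemma lookup_monomial_mult:
  fixes f :: "'x list \<Rightarrow>\<^sub>0 'k::field"
  shows "Poly_Mapping.lookup (monomial t * f) (t @ w) = Poly_Mapping.lookup f w"
proof -
  have "monomial t * f = (\<Sum>v\<in>Poly_Mapping.keys f. Poly_Mapping.single (t @ v) (Poly_Mapping.lookup f v))"
    by (subst poly_mapping_sum_single[of f])
      (simp add: sum_distrib_left monomial_def mult_single plus_list_def)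
  then have "Poly_Mapping.lookup (monomial t * f) (t @ w) =
      (\<Sum>v\<in>Poly_Mapping.keys f. Poly_Mapping.lookup (Poly_Mapping.single v (Poly_Mapping.lookup f v)) w)"
    by (simp add: lookup_sum lookup_single)
  also have "\<dots> = Poly_Mapping.lookup (\<Sum>v\<in>Poly_Mapping.keys f. Poly_Mapping.single v (Poly_Mapping.lookup f v)) w"
    by (simp add: lookup_sum)
  also have "\<dots> = Poly_Mapping.lookup f w" by (simp only: poly_mapping_sum_single[symmetric])
  finally show ?thesis .
qed

lemma keys_monomial_mult:
  fixes f :: "'x list \<Rightarrow>\<^sub>0 'k::field"
  shows "Poly_Mapping.keys (monomial t * f) = (\<lambda>w. t @ w) ` Poly_Mapping.keys f"
proof (intro equalityI subsetI)
  fix v assume "v \<in> Poly_Mapping.keys (monomial t * f)"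
  then obtain p w where "p \<in> Poly_Mapping.keys (monomial t :: 'x list \<Rightarrow>\<^sub>0 'k)" "w \<in> Poly_Mapping.keys f" "v = p @ w"
    by (rule keys_mult_words)
  then show "v \<in> (\<lambda>w. t @ w) ` Poly_Mapping.keys f" by (auto simp: monomial_def)
qed (auto simp: in_keys_iff lookup_monomial_mult)

text \<open>
  On representatives, this is the projection of the annihilator of a tail onto the summand belonging
  to its minimal extension \<open>u\<close>.
\<close>
definition restrict_prefix :: "'x list \<Rightarrow> ('x list \<Rightarrow>\<^sub>0 'k::field) \<Rightarrow> ('x list \<Rightarrow>\<^sub>0 'k)"
  where "restrict_prefix u f = Poly_Mapping.mapp (\<lambda>w c. if prefix u w then c else 0) f"

lemma lookup_restrict_prefix:
  "Poly_Mapping.lookup (restrict_prefix u f) w = (if prefix u w then Poly_Mapping.lookup f w else 0)"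
  by (simp add: restrict_prefix_def lookup_mapp when_def in_keys_iff)

lemma restrict_prefix_add: "restrict_prefix u (f + g) = restrict_prefix u f + restrict_prefix u g"
  by (rule poly_mapping_eqI) (simp add: lookup_restrict_prefix lookup_add)

lemma restrict_prefix_diff: "restrict_prefix u (f - g) = restrict_prefix u f - restrict_prefix u g"
  by (rule poly_mapping_eqI) (simp add: lookup_restrict_prefix lookup_minus)

lemma keys_restrict_prefix: "Poly_Mapping.keys (restrict_prefix u f) = {w \<in> Poly_Mapping.keys f. prefix u w}"
  by (auto simp: in_keys_iff lookup_restrict_prefix split: if_splits)

lemma restrict_prefix_id:
  "(\<And>w. w \<in> Poly_Mapping.keys f \<Longrightarrow> prefix u w) \<Longrightarrow> restrict_prefix u f = f"
  by (rule poly_mapping_eqI) (auto simp: lookup_restrict_prefix in_keys_iff)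

lemma restrict_prefix_factor: "\<exists>g. restrict_prefix u f = monomial u * g"
proof
  let ?r = "restrict_prefix u f"
  have "monomial u * (\<Sum>w\<in>Poly_Mapping.keys ?r. Poly_Mapping.single (drop (length u) w) (Poly_Mapping.lookup ?r w)) =
      (\<Sum>w\<in>Poly_Mapping.keys ?r. Poly_Mapping.single w (Poly_Mapping.lookup ?r w))"
    unfolding sum_distrib_left
    by (intro sum.cong) (auto simp: monomial_def mult_single plus_list_def keys_restrict_prefix prefix_def)
  then show "?r = monomial u * (\<Sum>w\<in>Poly_Mapping.keys ?r. Poly_Mapping.single (drop (length u) w) (Poly_Mapping.lookup ?r w))"
    using poly_mapping_sum_single[of ?r] by simp
qed

context monomial_quotient
begin

lemma cls_annihilator_iff:
  "cls f \<in> right_annihilator A (cls (monomial t)) \<longleftrightarrow> (\<forall>w\<in>Poly_Mapping.keys f. \<not> normal_word L (t @ w))"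
  by (simp add: right_annihilator_def cls_mult cls_eq_zero_iff mem_I keys_monomial_mult)

lemma cls_cyclic_iff: "x \<in> cyclic_right_ideal A (cls (monomial u)) \<longleftrightarrow> (\<exists>g. x = cls (monomial u * g))"
  unfolding cyclic_right_ideal_def carrier_A using cls_mult by auto

text \<open>
  A polynomial annihilates the class of \<open>t\<close> iff \<open>t n\<close> is not normal for all its words \<open>n\<close>. Keeping
  the words with prefix \<open>u\<close> is compatible with right multiplication modulo the ideal: if \<open>n m\<close> is normal
  with prefix \<open>u\<close> but \<open>n\<close> does not have this prefix, then \<open>n\<close> is a proper prefix of \<open>u\<close>, so \<open>t n\<close>
  is normal by minimality of \<open>u\<close>. Finally, an element that annihilates \<open>t\<close> does not involve the empty
  word, so multiplying \<open>u\<close> by it produces only words different from \<open>u\<close>.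
\<close>
lemma minimal_ext_summand_step:
  assumes t: "normal_word L t" and u: "u \<in> minimal_ext L t"
  shows "ring.summand_step A (cls (monomial t)) (cls (monomial u))"
proof -
  interpret A: ring A by (rule ring_A)
  let ?J = "right_annihilator A (cls (monomial t))"
  note ctx = antichain length_L
  have J_E: "\<exists>f. x = cls f \<and> (\<forall>w\<in>Poly_Mapping.keys f. \<not> normal_word L (t @ w))" if "x \<in> ?J" for x
    using that carrier_A cls_annihilator_iff by (auto simp: right_annihilator_def)
  define \<pi> where "\<pi> x = cls (restrict_prefix u (SOME f. cls f = x))" for x
  have \<pi>: "\<pi> (cls f) = cls (restrict_prefix u f)" for f
  proof -
    define g where "g = (SOME g. cls g = cls f)"
    have "cls g = cls f" unfolding g_def by (rule someI) simp
    then have "g - f \<in> I" by (simp add: cls_eq_iff)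
    then have "restrict_prefix u g - restrict_prefix u f \<in> I"
      by (simp add: restrict_prefix_diff[symmetric] mem_I keys_restrict_prefix)
    then show ?thesis unfolding \<pi>_def g_def[symmetric] by (simp add: cls_eq_iff)
  qed
  have vJ: "cls (monomial u) \<in> ?J"
    unfolding cls_annihilator_iff using u tail_ext_not_normal by (auto simp: monomial_def minimal_ext_def)
  have \<pi>1: "\<pi> x \<in> cyclic_right_ideal A (cls (monomial u))" if x_in: "x \<in> ?J" for x
  proof -
    obtain f where "x = cls f" using J_E[OF x_in] by blast
    moreover obtain g where "restrict_prefix u f = monomial u * g" using restrict_prefix_factor by blast
    ultimately have "\<pi> x = cls (monomial u * g)" by (simp add: \<pi>)
    then show ?thesis unfolding cls_cyclic_iff by blast
  qed
  have \<pi>2: "\<pi> x = x" if x_in: "x \<in> cyclic_right_ideal A (cls (monomial u))" for x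
  proof -
    obtain g where x: "x = cls (monomial u * g)" using x_in unfolding cls_cyclic_iff by blast
    have "restrict_prefix u (monomial u * g) = monomial u * g"
      by (rule restrict_prefix_id) (auto simp: keys_monomial_mult)
    then show ?thesis by (simp add: x \<pi>)
  qed
  have \<pi>3: "\<pi> (x \<oplus>\<^bsub>A\<^esub> y) = \<pi> x \<oplus>\<^bsub>A\<^esub> \<pi> y" if xy: "x \<in> ?J" "y \<in> ?J" for x y
  proof -
    obtain f g where "x = cls f" "y = cls g" using J_E[OF xy(1)] J_E[OF xy(2)] by blast
    then show ?thesis by (simp add: \<pi> cls_add restrict_prefix_add)
  qed
  have \<pi>4: "\<pi> (x \<otimes>\<^bsub>A\<^esub> a) = \<pi> x \<otimes>\<^bsub>A\<^esub> a" if x: "x \<in> ?J" and a: "a \<in> carrier A" for x a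
  proof -
    obtain f where f: "x = cls f" "\<And>w. w \<in> Poly_Mapping.keys f \<Longrightarrow> \<not> normal_word L (t @ w)" using J_E[OF x] by blast
    obtain g where g: "a = cls g" using a carrier_A by auto
    define h where "h = f - restrict_prefix u f"
    have keys_h: "w \<in> Poly_Mapping.keys f" "\<not> prefix u w" if "w \<in> Poly_Mapping.keys h" for w
      using that by (auto simp: h_def in_keys_iff lookup_minus lookup_restrict_prefix split: if_splits)
    have "restrict_prefix u (restrict_prefix u f * g) = restrict_prefix u f * g"
      by (rule restrict_prefix_id) (auto elim!: keys_mult_words simp: keys_restrict_prefix prefix_def)
    moreover have "f * g = restrict_prefix u f * g + h * g" by (simp add: h_def algebra_simps)
    ultimately have "restrict_prefix u (f * g) - restrict_prefix u f * g = restrict_prefix u (h * g)"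
      by (simp add: restrict_prefix_add)
    also have "\<dots> \<in> I"
      unfolding mem_I
    proof (intro ballI notI)
      fix w assume w: "w \<in> Poly_Mapping.keys (restrict_prefix u (h * g))" and nw: "normal_word L w"
      then obtain n m where nm: "n \<in> Poly_Mapping.keys h" "w = n @ m" and uw: "prefix u w"
        by (auto simp: keys_restrict_prefix elim: keys_mult_words)
      have "prefix n w" using nm(2) by simp
      then have "prefix n u" using uw keys_h(2)[OF nm(1)] prefix_same_cases by blast
      then have "strict_prefix n u" using keys_h(2)[OF nm(1)] by (auto simp: strict_prefix_def)
      then have "normal_word L (t @ n)" using minimal_ext_strict_prefix_normal[OF ctx u t] by blast
      then show False using f(2) keys_h(1)[OF nm(1)] by blast
    qed
    finally show ?thesis by (simp add: f(1) g \<pi> cls_mult cls_eq_iff)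
  qed
  have "cls (monomial u) \<oplus>\<^bsub>A\<^esub> c \<otimes>\<^bsub>A\<^esub> cls (monomial u) \<noteq> \<zero>\<^bsub>A\<^esub>" if c: "c \<in> ?J" for c
  proof
    obtain f where f: "c = cls f" "\<And>w. w \<in> Poly_Mapping.keys f \<Longrightarrow> \<not> normal_word L (t @ w)" using J_E[OF c] by blast
    assume "cls (monomial u) \<oplus>\<^bsub>A\<^esub> c \<otimes>\<^bsub>A\<^esub> cls (monomial u) = \<zero>\<^bsub>A\<^esub>"
    then have *: "monomial u + f * monomial u \<in> I" by (simp add: f(1) cls_mult cls_add cls_eq_zero_iff)
    have "[] \<notin> Poly_Mapping.keys f" using f(2)[of "[]"] t by auto
    then have "u \<notin> Poly_Mapping.keys (f * monomial u)"
      by (auto simp: monomial_def elim!: keys_mult_words)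
    then have "Poly_Mapping.lookup (monomial u + f * monomial u) u = 1"
      by (simp add: lookup_add in_keys_iff monomial_def)
    then have "u \<in> Poly_Mapping.keys (monomial u + f * monomial u)" by (simp add: in_keys_iff)
    then show False using * minimal_ext_normal[OF ctx u] by (auto simp: mem_I)
  qed
  then show ?thesis
    unfolding A.summand_step_def using vJ \<pi>1 \<pi>2 \<pi>3 \<pi>4 by (intro conjI exI[of _ \<pi>] ballI) simp_all
qed

lemma chain_level_tails:
  assumes "(s, t) \<in> chain_level L m"
  shows "\<exists>\<tau>. \<tau> m = t \<and> (\<forall>i<m. normal_word L (\<tau> i) \<and> \<tau> (Suc i) \<in> minimal_ext L (\<tau> i))"
  using assms
proof (induction m arbitrary: s t)
  case 0
  then show ?case by (intro exI[of _ "\<lambda>_. t"]) simp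
next
  case (Suc m)
  from Suc.prems obtain a b where ab: "(a, b) \<in> chain_level L m" "t \<in> minimal_ext L b"
    by (auto simp: chain_level_Suc[OF antichain length_L])
  obtain \<tau> where \<tau>: "\<tau> m = b" "\<And>i. i < m \<Longrightarrow> normal_word L (\<tau> i) \<and> \<tau> (Suc i) \<in> minimal_ext L (\<tau> i)"
    using Suc.IH[OF ab(1)] by blast
  have "normal_word L b" using chain_level_tail_normal[OF antichain length_L ab(1)] .
  with \<tau> ab(2) show ?case by (intro exI[of _ "\<tau>(Suc m := t)"]) (auto simp: less_Suc_eq)
qed

lemma finite_global_dim_chain_level_empty:
  assumes "global_dim I < \<infinity>"
  shows "\<exists>K. chain_level L K = {}"
proof -
  interpret A: ring A by (rule ring_A)
  obtain n where n: "\<And>u. \<not> (\<forall>i\<le>n. A.summand_step (u i) (u (Suc i)))"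
    using A.finite_global_dim_chain_bound assms unfolding global_dim_def by blast
  have "chain_level L (Suc n) = {}"
  proof (rule ccontr)
    assume "chain_level L (Suc n) \<noteq> {}"
    then obtain s t where "(s, t) \<in> chain_level L (Suc n)" by auto
    then obtain \<tau> where "\<forall>i<Suc n. normal_word L (\<tau> i) \<and> \<tau> (Suc i) \<in> minimal_ext L (\<tau> i)"
      using chain_level_tails by blast
    then have "\<forall>i\<le>n. A.summand_step (cls (monomial (\<tau> i))) (cls (monomial (\<tau> (Suc i))))"
      using minimal_ext_summand_step by (simp add: less_Suc_eq_le)
    then show False using n[of "\<lambda>i. cls (monomial (\<tau> i))"] by simp
  qed
  then show ?thesis by blast
qed

end

lemma algebraic_function_sum:
  fixes f :: "'i \<Rightarrow> 'f::field fps"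
  assumes "\<And>i. i \<in> S \<Longrightarrow> algebraic_function (f i)"
  shows "algebraic_function (sum f S)"
proof -
  have "algebraic_function (0 :: 'f fps)"
    using algebraic_function_ops(4)[OF algebraic_function_ops(1) algebraic_function_ops(3)[OF algebraic_function_ops(1)]]
    by simp
  then show ?thesis using assms
    by (induction S rule: infinite_finite_induct) (auto intro: algebraic_function_ops(4))
qed

lemma letters_series_algebraic: "algebraic_function (count_series length {[x :: 'x::finite] | x. True} :: 'f::field fps)"
proof -
  have "{[x :: 'x] | x. True} = (\<Union>x\<in>UNIV. {[x]})" by auto
  moreover have "count_series length (\<Union>x\<in>UNIV. {[x :: 'x]}) = (\<Sum>x\<in>(UNIV :: 'x set). count_series length {[x]} :: 'f fps)"
    by (rule count_series_UN) auto
  moreover have "algebraic_function (\<Sum>x\<in>(UNIV :: 'x set). count_series length {[x]} :: 'f fps)"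
    by (rule algebraic_function_sum) (simp add: count_series_singleton algebraic_function_ops(2))
  ultimately show ?thesis by (simp only:)
qed

text \<open>
  The coefficients are read in an arbitrary field, since the relation between the series holds over
  every commutative ring.
\<close>
lemma hilbert_series_algebraic:
  fixes I :: "('x::finite list \<Rightarrow>\<^sub>0 'k::field) set"
  assumes I: "monomial_ideal I" and hom: "homologically_unambiguous I" and fin: "global_dim I < \<infinity>"
  shows "algebraic_function (hilbert_series I :: 'f::field fps)"
proof -
  define L where "L = monomial_basis I"
  have L: "word_antichain L" "I = word_ideal L" "\<And>w. w \<in> L \<Longrightarrow> 2 \<le> length w"
    "\<And>i. i \<ge> 1 \<Longrightarrow> unambiguous_cfl (chain_language L i)"
    using monomial_ideal_word_ideal[OF I] hom by (simp_all add: L_def homologically_unambiguous_def)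
  interpret monomial_quotient L I by unfold_locales (use L in auto)
  obtain K where K: "chain_level L K = {}" using finite_global_dim_chain_level_empty[OF fin] by blast
  have "graded_dim I d = card {w \<in> {w. normal_word L w}. length w = d}" for d
    using graded_dim_eq[of d] finite_words_of_length[of "{w. normal_word L w}" d] by simp
  then have H: "hilbert_series I = (count_series length {w. normal_word L w} :: 'f fps)"
    by (simp add: hilbert_series_def count_series_def)
  have "algebraic_function (count_series length (chain_language L i) :: 'f fps)" for i
    using L(4)[of i] letters_series_algebraic unambiguous_cfl_algebraic by (cases i) auto
  moreover have "algebraic_function ((- 1) ^ i :: 'f fps)" for i
    using algebraic_function_ops(1,3) by (cases "even i") auto
  ultimately have "algebraic_function (1 - (\<Sum>i<K. (- 1) ^ i * count_series length (chain_language L i)) :: 'f fps)"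
    unfolding diff_conv_add_uminus by (intro algebraic_function_ops(1,3,4,5) algebraic_function_sum)
  then show ?thesis
    unfolding H by (rule algebraic_function_ops(6)) (rule normal_series_relation[OF L(1,3) K])
qed

theorem proposition6p2:
  fixes I :: "('x::finite list \<Rightarrow>\<^sub>0 'k::field) set"
  assumes "monomial_ideal I"
    and "homologically_unambiguous I"
    and "global_dim I < \<infinity>"
  shows "algebraic_function (hilbert_series I :: 'k fps) \<and>
         algebraic_function (hilbert_series I :: rat fps)"
  using assms by (simp add: hilbert_series_algebraic)

end
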